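(* (1) Let $\Gamma\in\mathcal{Z}_+$. Then $|\mathcal{G}^+(\Gamma)|=1$. (a) If $\Theta_+(\Gamma)\in\operatorname{bd}(\mathfrak{C}_+)$, then $|\mathcal{G}(\Gamma)|=2$. (b) If $\Theta_+(\Gamma)\notin\operatorname{bd}(\mathfrak{C}_+)$, then $|\mathcal{G}(\Gamma)|=1$. (2) Let $\Gamma\in\mathcal{Z}_-$. (a) If $\Theta_-(\Gamma)=(-2,1)$, then $|\mathcal{G}^+(\Gamma)|=3$ and $|\mathcal{G}(\Gamma)|=6$. (b) If $\Theta_-(\Gamma)\in\operatorname{bd}(\mathfrak{C}_-)-\{(-2,1)\}$, then $|\mathcal{G}^+(\Gamma)|=1$ and $|\mathcal{G}(\Gamma)|=2$. (c) If $\Theta_-(\Gamma)\notin\operatorname{bd}(\mathfrak{C}_-)$, then $|\mathcal{G}^+(\Gamma)|=1$ and $|\mathcal{G}(\Gamma)|=1$. (3) Let $\Gamma\in\mathcal{Z}_0$. Then $|\mathcal{G}^+(\Gamma)|=1$. (a) If $\Theta_0(\Gamma)\in\operatorname{bd}(\mathfrak{C}_0)$, then $|\mathcal{G}(\Gamma)|=2$. (b) If $\Theta_0(\Gamma)\notin\operatorname{bd}(\mathfrak{C}_0)$, then $|\mathcal{G}(\Gamma)|=1$. (4) For $\varepsilon\in\{-,0,+\}$ the map $\tilde\Theta_\varepsilon:=(\psi_3,\Psi_3,\chi)$ is a 1-1 embedding of the oriented moduli space $\mathfrak{Z}_\varepsilon^+=\mathcal{Z}_\varepsilon/\operatorname{GL}^+(2,\mathbb{R})$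 into $\mathbb{R}^3$. The map $\Theta_\varepsilon=(\psi_3,\Psi_3)$ on $\mathfrak{Z}_\varepsilon^+$ is the composition of $\tilde\Theta_\varepsilon$ with the projection on the horizontal plane (the first two coordinates). It is a "fold" map: it is two-to-one onto its image $\Theta_\varepsilon(\mathfrak{Z}_\varepsilon)$ except over the boundary of $\Theta_\varepsilon(\mathfrak{Z}_\varepsilon)$, over which it is one-to-one, and this boundary corresponds exactly to the locus where $\chi=0$.
   Context: A point $\Gamma=(\Gamma_{11}{}^1,\Gamma_{11}{}^2,\Gamma_{12}{}^1=\Gamma_{21}{}^1,\Gamma_{12}{}^2=\Gamma_{21}{}^2,\Gamma_{22}{}^1,\Gamma_{22}{}^2)\in\mathbb{R}^6$ is regarded as the constant Christoffel symbols of a torsion-free connection $\nabla_{\partial_{x^i}}\partial_{x^j}=\Gamma_{ij}{}^k\partial_{x^k}$ on $\mathbb{R}^2$; repeated indices are summed. Its Ricci tensor $\rho=\rho_\Gamma$ is the constant symmetric bilinear form $$\rho_{11}=\Gamma_{12}{}^2(\Gamma_{11}{}^1-\Gamma_{12}{}^2)+\Gamma_{11}{}^2(\Gamma_{22}{}^2-\Gamma_{12}{}^1),\quad \rho_{12}=\rho_{21}=\Gamma_{12}{}^1\Gamma_{12}{}^2-\Gamma_{11}{}^2\Gamma_{22}{}^1,$$ $$\rho_{22}=\Gamma_{22}{}^1(\Gamma_{11}{}^1-\Gamma_{12}{}^2)+\Gamma_{12}{}^1(\Gamma_{22}{}^2-\Gamma_{12}{}^1).$$ $\mathcal{Z}_+$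 (resp. $\mathcal{Z}_0$, $\mathcal{Z}_-$) is the set of $\Gamma\in\mathbb{R}^6$ for which $\rho_\Gamma$ is positive definite (resp. indefinite, i.e. non-degenerate of signature $(1,1)$; resp. negative definite). The group $\operatorname{GL}(2,\mathbb{R})$ acts on $\mathbb{R}^6$ by linear changes of coordinates: if $T=(a_i^j)$ has inverse matrix $(\tilde a_i^j)$, then $(T^*\Gamma)_{ij}{}^k=\tilde a_i^\alpha\tilde a_j^\beta a^k_\gamma\Gamma_{\alpha\beta}{}^\gamma$. $\operatorname{GL}^+(2,\mathbb{R})$ is the subgroup of matrices of positive determinant. The unoriented and oriented moduli spaces are $\mathfrak{Z}_\varepsilon=\mathcal{Z}_\varepsilon/\operatorname{GL}(2,\mathbb{R})$ and $\mathfrak{Z}_\varepsilon^+=\mathcal{Z}_\varepsilon/\operatorname{GL}^+(2,\mathbb{R})$, and the isotropy subgroups are $$\mathcal{G}^+(\Gamma):=\{T\in\operatorname{GL}^+(2,\mathbb{R}):T^*\Gamma=\Gamma\},\qquad \mathcal{G}(\Gamma):=\{T\in\operatorname{GL}(2,\mathbb{R}):T^*\Gamma=\Gamma\}.$$ For $\Gamma\in\mathcal{Z}_\varepsilon$, with $(\rho^{ij})$ the inverse matrix of $(\rho_{ij})$, set $\rho^3_{ij}:=\Gamma_{ik}{}^l\Gamma_{jl}{}^k$, $\psi_3:=\rho^{ij}\rho^3_{ij}$, $\Psi_3:=\det(\rho^3)/\det(\rho)$; these are $\operatorname{GL}(2,\mathbb{R})$-invariant, and $\Theta_\varepsilon:=(\psi_3,\Psi_3)$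 on $\mathcal{Z}_\varepsilon$ (and on $\mathfrak{Z}_\varepsilon$, $\mathfrak{Z}_\varepsilon^+$). Let $\text{dvol}:=|\det(\rho_{ij})|^{1/2}dx^1\wedge dx^2$ be the oriented volume form, extend $\rho$ to an inner product on tensors of all types, and define $$\chi(\Gamma):=\rho\left(\Gamma_{ab}{}^b\,\Gamma_{ij}{}^k\,\rho^3_{kl}\,\rho^{ij}\,dx^a\wedge dx^l,\ \text{dvol}\right),$$ which is $\operatorname{GL}^+(2,\mathbb{R})$-invariant. Consider the two curves in the plane, for $t>0$: $\sigma_+(t):=(4t^2+\frac1{t^2}+2,\,4t^4+4t^2+2)$ and $\sigma_-(t):=(-4t^2-\frac1{t^2}+2,\,4t^4-4t^2+2)$; $\sigma_-$ has a cusp at $(-2,1)$ when $t=\frac1{\sqrt2}$. They divide the plane into three open regions: $\mathfrak{O}_-$ lies in the second quadrant and is bounded on the right by $\sigma_-$; $\mathfrak{O}_+$ lies in the first quadrant and is bounded on the left by $\sigma_+$; $\mathfrak{O}_0$ lies in between, bounded on the left by $\sigma_-$ and on the right by $\sigma_+$. $\mathfrak{C}_\varepsilon$ is the closure of $\mathfrak{O}_\varepsilon$, and $\operatorname{bd}(\mathfrak{C}_\varepsilon)$ its boundary: $\operatorname{bd}(\mathfrak{C}_\pm)=\operatorname{range}(\sigma_\pm)$ and $\operatorname{bd}(\mathfrak{C}_0)=\operatorname{range}(\sigma_+)\cup\operatorname{range}(\sigma_-)$. *)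

theory Defs
  imports "HOL-Analysis.Analysis"
begin

text \<open>\<open>\<Gamma> $ i $ j $ k\<close> is the Christoffel symbol with lower indices \<open>i\<close>, \<open>j\<close> and upper index \<open>k\<close>;
  the six-dimensional parameter space is the linear subspace \<open>torsion_free\<close>.\<close>

type_synonym christoffel = "real^2^2^2"

definition torsion_free :: "christoffel set" where
  "torsion_free = {\<Gamma>. \<forall>i j k. \<Gamma> $ i $ j $ k = \<Gamma> $ j $ i $ k}"

definition ricci :: "christoffel \<Rightarrow> real^2^2" where
  "ricci \<Gamma> = vector
     [vector [\<Gamma>$1$2$2 * (\<Gamma>$1$1$1 - \<Gamma>$1$2$2) + \<Gamma>$1$1$2 * (\<Gamma>$2$2$2 - \<Gamma>$1$2$1),
              \<Gamma>$1$2$1 * \<Gamma>$1$2$2 - \<Gamma>$1$1$2 * \<Gamma>$2$2$1],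
      vector [\<Gamma>$1$2$1 * \<Gamma>$1$2$2 - \<Gamma>$1$1$2 * \<Gamma>$2$2$1,
              \<Gamma>$2$2$1 * (\<Gamma>$1$1$1 - \<Gamma>$1$2$2) + \<Gamma>$1$2$1 * (\<Gamma>$2$2$2 - \<Gamma>$1$2$1)]]"

definition positive_definite :: "real^2^2 \<Rightarrow> bool" where
  "positive_definite M \<longleftrightarrow> (\<forall>v. v \<noteq> 0 \<longrightarrow> v \<bullet> (M *v v) > 0)"

definition negative_definite :: "real^2^2 \<Rightarrow> bool" where
  "negative_definite M \<longleftrightarrow> (\<forall>v. v \<noteq> 0 \<longrightarrow> v \<bullet> (M *v v) < 0)"

text \<open>In dimension two, non-degenerate of signature \<open>(1,1)\<close>.\<close>

definition indefinite :: "real^2^2 \<Rightarrow> bool" where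
  "indefinite M \<longleftrightarrow> det M \<noteq> 0 \<and> (\<exists>v. v \<bullet> (M *v v) > 0) \<and> (\<exists>v. v \<bullet> (M *v v) < 0)"

datatype ricci_sign = Neg | Indef | Pos

fun Z :: "ricci_sign \<Rightarrow> christoffel set" where
  "Z Pos = {\<Gamma> \<in> torsion_free. positive_definite (ricci \<Gamma>)}"
| "Z Indef = {\<Gamma> \<in> torsion_free. indefinite (ricci \<Gamma>)}"
| "Z Neg = {\<Gamma> \<in> torsion_free. negative_definite (ricci \<Gamma>)}"

definition GL2 :: "(real^2^2) set" where
  "GL2 = {T. invertible T}"

definition GL2p :: "(real^2^2) set" where
  "GL2p = {T. det T > 0}"

text \<open>Row index = lower index: \<open>T $ i $ j\<close> is the coefficient with lower index \<open>i\<close> and upper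
  index \<open>j\<close>, so that the upper index of \<open>\<Gamma>\<close> is contracted with the row index of \<open>T\<close>.\<close>

definition pull :: "real^2^2 \<Rightarrow> christoffel \<Rightarrow> christoffel" where
  "pull T \<Gamma> = (\<chi> i j k. \<Sum>a\<in>UNIV. \<Sum>b\<in>UNIV. \<Sum>c\<in>UNIV.
     matrix_inv T $ i $ a * matrix_inv T $ j $ b * T $ c $ k * \<Gamma> $ a $ b $ c)"

definition isotropy :: "(real^2^2) set \<Rightarrow> christoffel \<Rightarrow> (real^2^2) set" where
  "isotropy G \<Gamma> = {T \<in> G. pull T \<Gamma> = \<Gamma>}"

definition orbit :: "(real^2^2) set \<Rightarrow> christoffel \<Rightarrow> christoffel set" where
  "orbit G \<Gamma> = (\<lambda>T. pull T \<Gamma>) ` G"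

definition moduli :: "(real^2^2) set \<Rightarrow> ricci_sign \<Rightarrow> christoffel set set" where
  "moduli G \<epsilon> = orbit G ` Z \<epsilon>"

definition moduli_top :: "(real^2^2) set \<Rightarrow> ricci_sign \<Rightarrow> christoffel set topology" where
  "moduli_top G \<epsilon> = topology (\<lambda>U. U \<subseteq> moduli G \<epsilon> \<and>
     openin (top_of_set (Z \<epsilon>)) {\<Gamma> \<in> Z \<epsilon>. orbit G \<Gamma> \<in> U})"

lemma openin_moduli_top:
  "openin (moduli_top G \<epsilon>) U \<longleftrightarrow>
     U \<subseteq> moduli G \<epsilon> \<and> openin (top_of_set (Z \<epsilon>)) {\<Gamma> \<in> Z \<epsilon>. orbit G \<Gamma> \<in> U}"
proof -
  let ?P = "\<lambda>U. U \<subseteq> moduli G \<epsilon> \<and> openin (top_of_set (Z \<epsilon>)) {\<Gamma> \<in> Z \<epsilon>. orbit G \<Gamma> \<in> U}"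
  have "istopology ?P"
    unfolding istopology_def
  proof (intro conjI allI impI)
    fix S T assume S: "?P S" and T: "?P T"
    have "{\<Gamma> \<in> Z \<epsilon>. orbit G \<Gamma> \<in> S \<inter> T} =
      {\<Gamma> \<in> Z \<epsilon>. orbit G \<Gamma> \<in> S} \<inter> {\<Gamma> \<in> Z \<epsilon>. orbit G \<Gamma> \<in> T}" by auto
    with S T show "openin (top_of_set (Z \<epsilon>)) {\<Gamma> \<in> Z \<epsilon>. orbit G \<Gamma> \<in> S \<inter> T}"
      by (simp add: openin_Int)
    from S show "S \<inter> T \<subseteq> moduli G \<epsilon>" by auto
  next
    fix K assume K: "\<forall>U\<in>K. ?P U"
    have "{\<Gamma> \<in> Z \<epsilon>. orbit G \<Gamma> \<in> \<Union>K} = (\<Union>U\<in>K. {\<Gamma> \<in> Z \<epsilon>. orbit G \<Gamma> \<in> U})" by auto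
    with K show "openin (top_of_set (Z \<epsilon>)) {\<Gamma> \<in> Z \<epsilon>. orbit G \<Gamma> \<in> \<Union>K}"
      by (metis (no_types, lifting) imageE openin_Union)
    from K show "\<Union>K \<subseteq> moduli G \<epsilon>" by auto
  qed
  then show ?thesis
    by (simp add: moduli_top_def topology_inverse')
qed

lemma topspace_moduli_top: "topspace (moduli_top G \<epsilon>) = moduli G \<epsilon>"
proof -
  have "{\<Gamma> \<in> Z \<epsilon>. orbit G \<Gamma> \<in> moduli G \<epsilon>} = Z \<epsilon>" by (auto simp: moduli_def)
  then have "openin (moduli_top G \<epsilon>) (moduli G \<epsilon>)"
    by (simp add: openin_moduli_top)
  then show ?thesis
    by (metis openin_moduli_top openin_subset openin_topspace subset_antisym)
qed

lemma quotient_map_orbit: "quotient_map (top_of_set (Z \<epsilon>)) (moduli_top G \<epsilon>) (orbit G)"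
  by (auto simp: quotient_map_def topspace_moduli_top openin_moduli_top moduli_def)

text \<open>The function on orbits induced by a function that is constant on each orbit.\<close>

definition induced :: "(christoffel \<Rightarrow> 'b) \<Rightarrow> christoffel set \<Rightarrow> 'b" where
  "induced f S = the_elem (f ` S)"

definition rho_inv :: "christoffel \<Rightarrow> real^2^2" where
  "rho_inv \<Gamma> = matrix_inv (ricci \<Gamma>)"

definition rho3 :: "christoffel \<Rightarrow> real^2^2" where
  "rho3 \<Gamma> = (\<chi> i j. \<Sum>k\<in>UNIV. \<Sum>l\<in>UNIV. \<Gamma> $ i $ k $ l * \<Gamma> $ j $ l $ k)"

definition psi3 :: "christoffel \<Rightarrow> real" where
  "psi3 \<Gamma> = (\<Sum>i\<in>UNIV. \<Sum>j\<in>UNIV. rho_inv \<Gamma> $ i $ j * rho3 \<Gamma> $ i $ j)"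

definition Psi3 :: "christoffel \<Rightarrow> real" where
  "Psi3 \<Gamma> = det (rho3 \<Gamma>) / det (ricci \<Gamma>)"

definition Theta :: "christoffel \<Rightarrow> real \<times> real" where
  "Theta \<Gamma> = (psi3 \<Gamma>, Psi3 \<Gamma>)"

text \<open>The inner product of \<open>dx\<^sup>a \<and> dx\<^sup>l\<close> and \<open>dx\<^sup>b \<and> dx\<^sup>c\<close> induced by \<open>\<rho>\<close>, in the usual (determinant)
  normalisation, for which \<open>dvol\<close> has norm-square \<open>\<plusminus>1\<close>.\<close>

definition wedge_inner :: "christoffel \<Rightarrow> 2 \<Rightarrow> 2 \<Rightarrow> 2 \<Rightarrow> 2 \<Rightarrow> real" where
  "wedge_inner \<Gamma> a l b c =
     rho_inv \<Gamma> $ a $ b * rho_inv \<Gamma> $ l $ c - rho_inv \<Gamma> $ a $ c * rho_inv \<Gamma> $ l $ b"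

definition chi_inv :: "christoffel \<Rightarrow> real" where
  "chi_inv \<Gamma> = (\<Sum>a\<in>UNIV. \<Sum>b\<in>UNIV. \<Sum>i\<in>UNIV. \<Sum>j\<in>UNIV. \<Sum>k\<in>UNIV. \<Sum>l\<in>UNIV.
     \<Gamma> $ a $ b $ b * \<Gamma> $ i $ j $ k * rho3 \<Gamma> $ k $ l * rho_inv \<Gamma> $ i $ j
       * (sqrt \<bar>det (ricci \<Gamma>)\<bar> * wedge_inner \<Gamma> a l 1 2))"

definition Theta_tilde :: "christoffel \<Rightarrow> real \<times> real \<times> real" where
  "Theta_tilde \<Gamma> = (psi3 \<Gamma>, Psi3 \<Gamma>, chi_inv \<Gamma>)"

definition sigma_plus :: "real \<Rightarrow> real \<times> real" where
  "sigma_plus t = (4 * t^2 + 1 / t^2 + 2, 4 * t^4 + 4 * t^2 + 2)"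

definition sigma_minus :: "real \<Rightarrow> real \<times> real" where
  "sigma_minus t = (- 4 * t^2 - 1 / t^2 + 2, 4 * t^4 - 4 * t^2 + 2)"

definition off_curves :: "(real \<times> real) set" where
  "off_curves = - (sigma_plus ` {0<..} \<union> sigma_minus ` {0<..})"

text \<open>The three regions are the connected components of the complement of the two curves; the
  outer two are singled out by the quadrant that contains them.\<close>

definition region_minus :: "(real \<times> real) set" where
  "region_minus = (THE C. C \<in> components off_curves \<and> C \<subseteq> {..<0} \<times> {0<..})"

definition region_plus :: "(real \<times> real) set" where
  "region_plus = (THE C. C \<in> components off_curves \<and> C \<subseteq> {0<..} \<times> {0<..})"

definition region_zero :: "(real \<times> real) set" where
  "region_zero = (THE C. C \<in> components off_curves \<and> C \<noteq> region_minus \<and> C \<noteq> region_plus)"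

fun region :: "ricci_sign \<Rightarrow> (real \<times> real) set" where
  "region Neg = region_minus"
| "region Indef = region_zero"
| "region Pos = region_plus"

definition closed_region :: "ricci_sign \<Rightarrow> (real \<times> real) set" where
  "closed_region \<epsilon> = closure (region \<epsilon>)"

abbreviation bd :: "ricci_sign \<Rightarrow> (real \<times> real) set" where
  "bd \<epsilon> \<equiv> frontier (closed_region \<epsilon>)"

end

theory Submission
  imports Defs
begin

text \<open>When \<open>\<rho>\<close> is nondegenerate, lowering the upper index of \<open>\<Gamma>\<close> with \<open>\<rho>\<close> gives a totally symmetric
  cubic form. Normalising \<open>\<rho>\<close> by \<open>GL\<^sup>+(2)\<close> to \<open>\<plusminus>2 I\<close> or to the hyperbolic plane leaves the rotations,
  respectively the boosts \<open>diag(l, 1/l)\<close>, acting on a cubic form whose weight components are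
  \<open>p, u\<close>, respectively \<open>p, q, u, v\<close>. The orbits are separated by \<open>x = \<plusminus>\<bar>p\<bar>\<^sup>2\<close> and \<open>p\<^sup>3 u\<close>,
  respectively by \<open>x = p q\<close>, \<open>p\<^sup>3 u\<close> and \<open>q\<^sup>3 v\<close>. In these terms \<open>\<psi>\<^sub>3 = 8 x - 2\<close>,
  \<open>\<Psi>\<^sub>3 = 8 x\<^sup>2 - 4 x + 1 - 4 s\<close> with \<open>s = 2 Re (p\<^sup>3 u)\<close> or \<open>p\<^sup>3 u + q\<^sup>3 v\<close>, while \<open>\<chi>\<close> is a multiple of
  \<open>Im (p\<^sup>3 u)\<close> or \<open>p\<^sup>3 u - q\<^sup>3 v\<close>; hence \<open>\<chi>\<^sup>2 = \<plusminus>64 (4 x\<^sup>3 (x - 1) - s\<^sup>2)\<close>, which is the fold. An orientation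
  reversing map changes the sign of \<open>\<chi>\<close>, so it can fix \<open>\<Gamma>\<close> only if \<open>\<chi> = 0\<close>, and then one does.\<close>

subsection \<open>Equivariance\<close>

text \<open>The sign ambiguity of \<open>chi_inv\<close> has one source. Scaling
  \<open>ricci\<close> to a standard form makes |p|^2 - |u|^2 (or p q - u v) a constant, so in the
  definite case |p|^2 and |u|^2 are |x| and |x - 1|. The modulus of p^3 u is then a function of x,
  and once its real part is known, its imaginary part is known up to sign. The factor x^3 (x - 1) is
  |p^3 u|^2; it vanishes at x = 0, the cusp, where p = 0 and rotations by cube roots of unity fix
  the normal form, and at x = 1, where u = 0. Separating orbits by invariants gives injectivity
  only. Continuity of the inverse is harder, because at p = 0 the isotropy of order three rules out
  a continuous section. The quotient property is therefore derived from sections that are continuous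
  at one prescribed point, and an injective quotient map is a homeomorphism onto its image. The
  regions are given as connected components picked out by a quadrant, so the sign conditions on an
  explicit polynomial have to be matched with components before any boundary can be
  computed.\<close>

lemma
  fixes A :: "real^'n^'n"
  assumes "invertible A"
  shows matrix_inv_right: "A ** matrix_inv A = mat 1"
    and matrix_inv_left: "matrix_inv A ** A = mat 1"
  using assms someI_ex[of "\<lambda>B. A ** B = mat 1 \<and> B ** A = mat 1"]
  by (auto simp: invertible_def matrix_inv_def)

lemma matrix_inv_eqI:
  fixes A B :: "real^'n^'n"
  assumes "A ** B = mat 1"
  shows "matrix_inv A = B"
proof -
  have "invertible A" using assms invertible_right_inverse by blast
  then have "matrix_inv A ** (A ** B) = B" by (simp add: matrix_mul_assoc matrix_inv_left)
  with assms show ?thesis by simp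
qed

lemma matrix_inv_mult:
  fixes S T :: "real^'n^'n"
  assumes "invertible S" "invertible T"
  shows "matrix_inv (S ** T) = matrix_inv T ** matrix_inv S"
proof (rule matrix_inv_eqI)
  have "(S ** T) ** (matrix_inv T ** matrix_inv S) = S ** (T ** matrix_inv T) ** matrix_inv S"
    by (simp add: matrix_mul_assoc)
  with assms show "(S ** T) ** (matrix_inv T ** matrix_inv S) = mat 1"
    by (simp add: matrix_inv_right)
qed

definition tr1 :: "christoffel \<Rightarrow> real^2" where
  "tr1 \<Gamma> = (\<chi> i. trace (\<Gamma> $ i))"

text \<open>Reads \<Gamma> as a pair of matrices: a change of coordinates conjugates each of them
  and mixes the pair through the first lower index. Traces and products then transform by cancelling
  \<open>T\<close> against \<open>matrix_inv T\<close>.\<close>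

lemma pull_nth:
  "pull T \<Gamma> $ i = (\<Sum>a\<in>UNIV. matrix_inv T $ i $ a *\<^sub>R (matrix_inv T ** \<Gamma> $ a ** T))"
  by (simp add: pull_def vec_eq_iff matrix_matrix_mult_def sum_2 algebra_simps)

lemma trace_sum: "trace (\<Sum>a\<in>A. c a *\<^sub>R M a) = (\<Sum>a\<in>A. c a * trace (M a :: real^'n^'n))"
  by (induction A rule: infinite_finite_induct) (auto simp: trace_def sum.distrib sum_distrib_left)

lemma trace_conj:
  fixes M S T :: "real^'n^'n"
  assumes "T ** S = mat 1"
  shows "trace (S ** M ** T) = trace M"
proof -
  have "trace (S ** M ** T) = trace (M ** T ** S)"
    by (metis matrix_mul_assoc trace_mul_sym)
  also have "M ** T ** S = M" by (metis assms matrix_mul_assoc matrix_mul_rid)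
  finally show ?thesis .
qed

lemma tr1_pull:
  assumes "T \<in> GL2"
  shows "tr1 (pull T \<Gamma>) = matrix_inv T *v tr1 \<Gamma>"
  using assms
  by (simp add: tr1_def pull_nth trace_sum trace_conj matrix_inv_right GL2_def vec_eq_iff
      matrix_vector_mult_def)

lemma trace_lincomb_mult:
  fixes A B C D :: "real^2^2"
  shows "trace ((a *\<^sub>R A + b *\<^sub>R B) ** (c *\<^sub>R C + d *\<^sub>R D)) =
    a * c * trace (A ** C) + a * d * trace (A ** D) + b * c * trace (B ** C) + b * d * trace (B ** D)"
  by (simp add: trace_def matrix_matrix_mult_def sum_2 algebra_simps)

lemma conj_lincomb:
  fixes A B S T :: "real^2^2"
  shows "S ** (a *\<^sub>R A + b *\<^sub>R B) ** T = a *\<^sub>R (S ** A ** T) + b *\<^sub>R (S ** B ** T)"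
  by (simp add: vec_eq_iff matrix_matrix_mult_def sum_2 algebra_simps)

lemma rho3_nth: "rho3 \<Gamma> $ i $ j = trace (\<Gamma> $ i ** \<Gamma> $ j)"
  by (simp add: rho3_def trace_def matrix_matrix_mult_def)

text \<open>\<open>rho3\<close> is the trace form of the two matrices, so conjugation drops out and
  only the mixing of the two free indices remains.\<close>

lemma rho3_pull:
  assumes "T \<in> GL2"
  shows "rho3 (pull T \<Gamma>) = matrix_inv T ** rho3 \<Gamma> ** transpose (matrix_inv T)"
proof -
  let ?S = "matrix_inv T"
  have TS: "T ** ?S = mat 1" using assms by (simp add: GL2_def matrix_inv_right)
  have *: "(?S ** A ** T) ** (?S ** B ** T) = ?S ** (A ** B) ** T" for A B
  proof -
    have "(?S ** A ** T) ** (?S ** B ** T) = ?S ** A ** (T ** ?S) ** B ** T"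
      by (simp add: matrix_mul_assoc)
    then show ?thesis by (simp add: TS matrix_mul_assoc)
  qed
  have **: "trace ((?S ** A ** T) ** (?S ** B ** T)) = trace (A ** B)" for A B
    by (simp only: * trace_conj[OF TS])
  have "rho3 (pull T \<Gamma>) $ i $ j = (\<Sum>a\<in>UNIV. \<Sum>b\<in>UNIV. ?S $ i $ a * ?S $ j $ b * rho3 \<Gamma> $ a $ b)" for i j
    unfolding rho3_nth pull_nth
    by (simp add: sum_2 trace_lincomb_mult ** algebra_simps)
  then show ?thesis
    by (simp add: vec_eq_iff matrix_matrix_mult_def transpose_def sum_2 algebra_simps)
qed

text \<open>The contraction of \<Gamma> with its own trace one-form. With constant Christoffel
  symbols the Ricci tensor has no derivative terms and is the difference of this tensor and
  \<open>rho3\<close>.\<close>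

definition curv :: "christoffel \<Rightarrow> real^2^2" where
  "curv \<Gamma> = (\<chi> i. \<Gamma> $ i *v tr1 \<Gamma>)"

lemma curv_pull:
  assumes "T \<in> GL2"
  shows "curv (pull T \<Gamma>) = matrix_inv T ** curv \<Gamma> ** transpose (matrix_inv T)"
proof -
  let ?S = "matrix_inv T"
  have TS: "T ** ?S = mat 1" using assms by (simp add: GL2_def matrix_inv_right)
  have *: "(?S ** A ** T) *v (?S *v w) = ?S *v (A *v w)" for A w
  proof -
    have "(?S ** A ** T) *v (?S *v w) = (?S ** A ** (T ** ?S)) *v w"
      by (simp add: matrix_mul_assoc matrix_vector_mul_assoc)
    then show ?thesis by (simp add: TS matrix_mul_assoc matrix_vector_mul_assoc)
  qed
  have "curv (pull T \<Gamma>) $ i = (\<Sum>a\<in>UNIV. ?S $ i $ a *\<^sub>R (?S *v (curv \<Gamma> $ a)))" for i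
    by (simp add: curv_def tr1_pull[OF assms] pull_nth sum_2 matrix_vector_mult_add_rdistrib
        scaleR_matrix_vector_assoc[symmetric] *)
  then show ?thesis
    by (simp add: vec_eq_iff matrix_matrix_mult_def matrix_vector_mult_def transpose_def sum_2 algebra_simps)
qed

lemma torsion_freeD: "\<Gamma> \<in> torsion_free \<Longrightarrow> \<Gamma> $ 2 $ 1 $ k = \<Gamma> $ 1 $ 2 $ k"
  by (simp add: torsion_free_def)

lemma torsion_free_iff: "\<Gamma> \<in> torsion_free \<longleftrightarrow> \<Gamma> $ 2 $ 1 = \<Gamma> $ 1 $ 2"
  by (auto simp: torsion_free_def forall_2 vec_eq_iff)

lemma ricci_nth [simp]:
  "ricci \<Gamma> $ 1 $ 1 = \<Gamma>$1$2$2 * (\<Gamma>$1$1$1 - \<Gamma>$1$2$2) + \<Gamma>$1$1$2 * (\<Gamma>$2$2$2 - \<Gamma>$1$2$1)"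
  "ricci \<Gamma> $ 1 $ 2 = \<Gamma>$1$2$1 * \<Gamma>$1$2$2 - \<Gamma>$1$1$2 * \<Gamma>$2$2$1"
  "ricci \<Gamma> $ 2 $ 1 = \<Gamma>$1$2$1 * \<Gamma>$1$2$2 - \<Gamma>$1$1$2 * \<Gamma>$2$2$1"
  "ricci \<Gamma> $ 2 $ 2 = \<Gamma>$2$2$1 * (\<Gamma>$1$1$1 - \<Gamma>$1$2$2) + \<Gamma>$1$2$1 * (\<Gamma>$2$2$2 - \<Gamma>$1$2$1)"
  by (simp_all add: ricci_def)

text \<open>Trades the coordinate formula for two terms with a visible transformation law, so that
  \<open>ricci_pull\<close> needs no expansion.\<close>

lemma ricci_eq:
  assumes "\<Gamma> \<in> torsion_free"
  shows "ricci \<Gamma> = curv \<Gamma> - rho3 \<Gamma>"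
  using torsion_freeD[OF assms]
  by (simp add: vec_eq_iff forall_2 curv_def rho3_def tr1_def trace_def matrix_vector_mult_def sum_2
      algebra_simps)

lemma torsion_free_pull [simp]: "\<Gamma> \<in> torsion_free \<Longrightarrow> pull T \<Gamma> \<in> torsion_free"
  by (simp add: torsion_free_iff pull_def vec_eq_iff sum_2 algebra_simps)

lemma matrix_diff_conj:
  fixes A B :: "real^2^2"
  shows "S ** (A - B) ** T = S ** A ** T - S ** B ** T"
  by (simp add: vec_eq_iff matrix_matrix_mult_def sum_2 algebra_simps)

lemma ricci_pull:
  assumes "T \<in> GL2" "\<Gamma> \<in> torsion_free"
  shows "ricci (pull T \<Gamma>) = matrix_inv T ** ricci \<Gamma> ** transpose (matrix_inv T)"
  using assms
  by (simp add: ricci_eq curv_pull rho3_pull matrix_diff_conj)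

lemma matrix_inv_conj:
  fixes T M :: "real^2^2"
  assumes "T \<in> GL2" "invertible M"
  shows "matrix_inv (matrix_inv T ** M ** transpose (matrix_inv T)) = transpose T ** matrix_inv M ** T"
proof (rule matrix_inv_eqI)
  let ?S = "matrix_inv T"
  have "(?S ** M ** transpose ?S) ** (transpose T ** matrix_inv M ** T)
      = ?S ** M ** (transpose ?S ** transpose T) ** matrix_inv M ** T"
    by (simp add: matrix_mul_assoc)
  also have "transpose ?S ** transpose T = mat 1"
    using assms by (simp add: GL2_def matrix_inv_right flip: matrix_transpose_mul)
  also have "?S ** M ** mat 1 ** matrix_inv M ** T = ?S ** (M ** matrix_inv M) ** T"
    by (simp add: matrix_mul_assoc)
  finally show "(?S ** M ** transpose ?S) ** (transpose T ** matrix_inv M ** T) = mat 1"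
    using assms by (simp add: GL2_def matrix_inv_right matrix_inv_left)
qed

lemma rho_inv_pull:
  assumes "T \<in> GL2" "\<Gamma> \<in> torsion_free" "det (ricci \<Gamma>) \<noteq> 0"
  shows "rho_inv (pull T \<Gamma>) = transpose T ** rho_inv \<Gamma> ** T"
  using assms by (simp add: rho_inv_def ricci_pull matrix_inv_conj invertible_det_nz)

text \<open>Each matrix is conjugated as \<open>matrix_inv T ** M ** T\<close>, so this is a right
  action: products of matrices are applied from left to right.\<close>

lemma pull_pull:
  assumes "S \<in> GL2" "T \<in> GL2"
  shows "pull T (pull S \<Gamma>) = pull (S ** T) \<Gamma>"
proof -
  have i: "matrix_inv (S ** T) = matrix_inv T ** matrix_inv S"
    using assms by (simp add: GL2_def matrix_inv_mult)
  have "pull T (pull S \<Gamma>) $ i = pull (S ** T) \<Gamma> $ i" for i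
  proof -
    have e: "matrix_inv (S ** T) $ i $ a =
        matrix_inv T $ i $ 1 * matrix_inv S $ 1 $ a + matrix_inv T $ i $ 2 * matrix_inv S $ 2 $ a" for a
      unfolding i by (simp add: matrix_matrix_mult_def sum_2)
    have m: "matrix_inv (S ** T) ** M ** (S ** T) =
        matrix_inv T ** (matrix_inv S ** M ** S) ** T" for M
      by (simp add: i matrix_mul_assoc)
    show ?thesis
      unfolding pull_nth sum_2 e m conj_lincomb by (simp add: algebra_simps)
  qed
  then show ?thesis by (simp add: vec_eq_iff)
qed

text \<open>With \<open>\<tau>\<close> the \<open>\<rho>\<close>-trace of \<open>\<Gamma>\<close> over its lower indices, \<open>\<chi>\<close> is up to a factor the
  determinant with rows \<open>tr1\<close> and \<open>\<rho>\<^sup>3 \<tau>\<close>.\<close>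

definition tau :: "christoffel \<Rightarrow> real^2" where
  "tau \<Gamma> = (\<Sum>i\<in>UNIV. (rho_inv \<Gamma> $ i) v* \<Gamma> $ i)"

definition cross2 :: "real^2 \<Rightarrow> real^2 \<Rightarrow> real" where
  "cross2 v w = v $ 1 * w $ 2 - v $ 2 * w $ 1"

lemma cross2_mult: "cross2 (S *v v) (S *v w) = det S * cross2 v w"
  by (simp add: cross2_def det_2 matrix_vector_mult_def sum_2 algebra_simps)

text \<open>In dimension two \<open>wedge_inner\<close> against the standard area form is zero or
  plus or minus \<open>det (rho_inv \<Gamma>)\<close>. The sixfold sum collapses to a determinant of
  two covectors, whose behaviour under \<open>pull\<close> is a matter of powers of
  \<open>det T\<close>.\<close>

lemma chi_inv_eq:
  "chi_inv \<Gamma> = sqrt \<bar>det (ricci \<Gamma>)\<bar> * det (rho_inv \<Gamma>) * cross2 (tr1 \<Gamma>) (transpose (rho3 \<Gamma>) *v tau \<Gamma>)"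
proof -
  define d r where "d = sqrt \<bar>det (ricci \<Gamma>)\<bar>" and "r = rho_inv \<Gamma>"
  define V where "V = transpose (rho3 \<Gamma>) *v tau \<Gamma>"
  have V: "V $ l = (\<Sum>i\<in>UNIV. \<Sum>j\<in>UNIV. \<Sum>k\<in>UNIV. \<Gamma> $ i $ j $ k * rho3 \<Gamma> $ k $ l * r $ i $ j)" for l
    by (simp add: V_def tau_def r_def matrix_vector_mult_def vector_matrix_mult_def transpose_def sum_2
        algebra_simps)
  have w: "wedge_inner \<Gamma> 1 1 1 2 = 0" "wedge_inner \<Gamma> 2 2 1 2 = 0"
    "wedge_inner \<Gamma> 1 2 1 2 = det r" "wedge_inner \<Gamma> 2 1 1 2 = - det r"
    by (simp_all add: wedge_inner_def det_2 r_def)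
  have "(\<Sum>i\<in>UNIV. \<Sum>j\<in>UNIV. \<Sum>k\<in>UNIV. \<Sum>l\<in>UNIV.
      c * \<Gamma> $ i $ j $ k * rho3 \<Gamma> $ k $ l * r $ i $ j * (d * h l)) = c * d * (V $ 1 * h 1 + V $ 2 * h 2)"
    for c and h :: "2 \<Rightarrow> real"
    unfolding V sum_2 by (simp only: algebra_simps)
  then have "chi_inv \<Gamma> = (\<Sum>a\<in>UNIV. \<Sum>b\<in>UNIV. \<Gamma> $ a $ b $ b * d *
      (V $ 1 * wedge_inner \<Gamma> a 1 1 2 + V $ 2 * wedge_inner \<Gamma> a 2 1 2))"
    by (simp add: chi_inv_def d_def r_def)
  also have "\<dots> = d * det r * cross2 (tr1 \<Gamma>) V"
    by (simp add: sum_2 w cross2_def tr1_def trace_def algebra_simps)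
  finally show ?thesis by (simp add: d_def r_def V_def)
qed

lemma rho3_sym: "transpose (rho3 \<Gamma>) = rho3 \<Gamma>"
  unfolding vec_eq_iff transpose_def rho3_nth vec_lambda_beta by (metis trace_mul_sym)

text \<open>Contracting with \<open>rho_inv\<close> uses up both lower indices; only the upper one
  is left, so \<open>tau\<close> is a vector, whereas \<open>tr1\<close> is a covector.\<close>

lemma tau_pull:
  assumes "T \<in> GL2" "\<Gamma> \<in> torsion_free" "det (ricci \<Gamma>) \<noteq> 0"
  shows "tau (pull T \<Gamma>) = transpose T *v tau \<Gamma>"
proof -
  let ?S = "matrix_inv T"
  have TS: "T ** ?S = mat 1" using assms by (simp add: GL2_def matrix_inv_right)
  let ?r = "transpose T ** rho_inv \<Gamma> ** T"
  have k: "transpose ?S ** (?r ** ?S) = rho_inv \<Gamma>"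
  proof -
    have "transpose ?S ** (?r ** ?S) = transpose (T ** ?S) ** rho_inv \<Gamma> ** (T ** ?S)"
      by (simp add: matrix_mul_assoc matrix_transpose_mul)
    then show ?thesis by (simp add: TS)
  qed
  have k': "?S $ 1 $ a *\<^sub>R (?r $ 1 v* ?S) + ?S $ 2 $ a *\<^sub>R (?r $ 2 v* ?S) = rho_inv \<Gamma> $ a" for a
  proof -
    have "?S $ 1 $ a *\<^sub>R (r $ 1 v* ?S) + ?S $ 2 $ a *\<^sub>R (r $ 2 v* ?S) = (transpose ?S ** (r ** ?S)) $ a" for r :: "real^2^2"
      by (simp add: vec_eq_iff matrix_matrix_mult_def vector_matrix_mult_def transpose_def sum_2
          algebra_simps)
    from this[of ?r] show ?thesis by (simp only: k)
  qed
  have "tau (pull T \<Gamma>) = (\<Sum>i\<in>UNIV. (?r $ i) v* pull T \<Gamma> $ i)"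
    using assms by (simp add: tau_def rho_inv_pull)
  also have "\<dots> = (\<Sum>a\<in>UNIV. (?S $ 1 $ a *\<^sub>R (?r $ 1 v* ?S) + ?S $ 2 $ a *\<^sub>R (?r $ 2 v* ?S)) v* \<Gamma> $ a v* T)"
  proof -
    define r where "r = ?r"
    have c: "x v* (a *\<^sub>R (?S ** M ** T) + b *\<^sub>R (?S ** N ** T)) =
        (a *\<^sub>R (x v* ?S)) v* M v* T + (b *\<^sub>R (x v* ?S)) v* N v* T" for x a b and M N :: "real^2^2"
      by (simp add: vec_eq_iff vector_matrix_mult_def matrix_matrix_mult_def sum_2 algebra_simps)
    have l: "(x + y) v* M v* T = x v* M v* T + y v* M v* T" for x y and M :: "real^2^2"
      by (simp add: vec_eq_iff vector_matrix_mult_def sum_2 algebra_simps)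
    show ?thesis
      unfolding r_def[symmetric] pull_nth sum_2 c l by (simp add: algebra_simps)
  qed
  also have "\<dots> = tau \<Gamma> v* T"
    unfolding k' tau_def
    by (simp add: vec_eq_iff vector_matrix_mult_def sum_2 algebra_simps)
  finally show ?thesis by simp
qed

section \<open>Transformation of the scalar invariants\<close>

lemma det_matrix_inv:
  fixes T :: "real^2^2"
  assumes "T \<in> GL2"
  shows "det (matrix_inv T) = 1 / det T"
proof -
  have "det T * det (matrix_inv T) = 1"
    using assms by (simp add: GL2_def matrix_inv_right flip: det_mul)
  then show ?thesis by (metis mult_eq_0_iff nonzero_mult_div_cancel_left zero_neq_one)
qed

lemma det_ricci_pull:
  assumes "T \<in> GL2" "\<Gamma> \<in> torsion_free"
  shows "det (ricci (pull T \<Gamma>)) = det (ricci \<Gamma>) / (det T)\<^sup>2"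
  using assms by (simp add: ricci_pull det_mul det_matrix_inv power2_eq_square)

lemma psi3_eq: "psi3 \<Gamma> = trace (rho_inv \<Gamma> ** rho3 \<Gamma>)"
proof -
  have "psi3 \<Gamma> = trace (rho_inv \<Gamma> ** transpose (rho3 \<Gamma>))"
    by (simp add: psi3_def trace_def matrix_matrix_mult_def transpose_def)
  then show ?thesis by (simp add: rho3_sym)
qed

lemma psi3_pull:
  assumes "T \<in> GL2" "\<Gamma> \<in> torsion_free" "det (ricci \<Gamma>) \<noteq> 0"
  shows "psi3 (pull T \<Gamma>) = psi3 \<Gamma>"
proof -
  let ?S = "matrix_inv T"
  have TS: "T ** ?S = mat 1" using assms by (simp add: GL2_def matrix_inv_right)
  have "rho_inv (pull T \<Gamma>) ** rho3 (pull T \<Gamma>) = transpose T ** rho_inv \<Gamma> ** (T ** ?S) ** rho3 \<Gamma> ** transpose ?S"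
    using assms by (simp add: rho_inv_pull rho3_pull matrix_mul_assoc)
  also have "\<dots> = transpose T ** (rho_inv \<Gamma> ** rho3 \<Gamma>) ** transpose ?S"
    by (simp add: TS matrix_mul_assoc)
  also have "trace \<dots> = trace (rho_inv \<Gamma> ** rho3 \<Gamma>)"
    by (rule trace_conj) (simp add: TS flip: matrix_transpose_mul)
  finally show ?thesis by (simp add: psi3_eq)
qed

lemma Psi3_pull:
  assumes "T \<in> GL2" "\<Gamma> \<in> torsion_free"
  shows "Psi3 (pull T \<Gamma>) = Psi3 \<Gamma>"
proof -
  have "det T \<noteq> 0" using assms by (simp add: GL2_def invertible_det_nz)
  then show ?thesis using assms by (simp add: Psi3_def rho3_pull ricci_pull det_mul det_matrix_inv)
qed

text \<open>The square root contributes \<open>1 / \<bar>det T\<bar>\<close>,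
  \<open>det (rho_inv \<Gamma>)\<close> contributes the square of \<open>det T\<close>, and the
  cross product of two covectors contributes \<open>1 / det T\<close>. Only the sign
  survives.\<close>

lemma chi_inv_pull:
  assumes "T \<in> GL2" "\<Gamma> \<in> torsion_free" "det (ricci \<Gamma>) \<noteq> 0"
  shows "chi_inv (pull T \<Gamma>) = sgn (det T) * chi_inv \<Gamma>"
proof -
  let ?S = "matrix_inv T"
  have nz: "det T \<noteq> 0" using assms by (simp add: GL2_def invertible_det_nz)
  have TS: "T ** ?S = mat 1" using assms by (simp add: GL2_def matrix_inv_right)
  have "rho3 (pull T \<Gamma>) *v tau (pull T \<Gamma>) = ?S *v (rho3 \<Gamma> *v (transpose (T ** ?S) *v tau \<Gamma>))"
    using assms
    by (simp add: rho3_pull tau_pull matrix_transpose_mul matrix_vector_mul_assoc matrix_mul_assoc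
        del: transpose_matrix_vector)
  then have r: "rho3 (pull T \<Gamma>) *v tau (pull T \<Gamma>) = ?S *v (rho3 \<Gamma> *v tau \<Gamma>)"
    by (simp add: TS)
  have "chi_inv (pull T \<Gamma>) = (sqrt \<bar>det (ricci \<Gamma>)\<bar> / \<bar>det T\<bar>) * (det (rho_inv \<Gamma>) * (det T)\<^sup>2) *
     (1 / det T * cross2 (tr1 \<Gamma>) (rho3 \<Gamma> *v tau \<Gamma>))"
    unfolding chi_inv_eq rho3_sym r
    using assms
    by (simp add: det_ricci_pull rho_inv_pull tr1_pull cross2_mult det_mul det_matrix_inv
        abs_divide real_sqrt_divide power2_eq_square mult_ac)
  also have "\<dots> = sgn (det T) * chi_inv \<Gamma>"
    using nz unfolding chi_inv_eq rho3_sym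
    by (simp add: field_simps power2_eq_square sgn_if)
  finally show ?thesis .
qed

subsection \<open>The two curves and the regions they bound\<close>

text \<open>The zero locus of \<open>disc\<close> is the union of the two curves, and \<open>\<chi>\<^sup>2 = \<plusminus> disc (\<psi>\<^sub>3, \<Psi>\<^sub>3)\<close>.\<close>

definition disc :: "real \<times> real \<Rightarrow> real" where
  "disc p = - 4 * (snd p)\<^sup>2 + ((fst p)\<^sup>2 + 4) * snd p - 2 * (fst p)\<^sup>2 - 4 * fst p - 4"

text \<open>Half the distance between the two branches of the zero locus of \<open>disc\<close> over
  \<open>a\<close>, in the coordinate \<open>y\<close> of \<open>fibre_coord\<close>. The
  \<open>max 0\<close> extends it continuously by zero over the gap between -2 and 6.\<close>

definition width :: "real \<Rightarrow> real" where
  "width a = sqrt (max 0 ((a + 2) ^ 3 * (a - 6))) / 4"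

text \<open>Completes the square: \<open>disc\<close> is quadratic in the second coordinate with
  midpoint (a^2 + 4) / 8, and \<open>y\<close> is twice the offset from it. What is left is (a +
  2)^3 (a - 6) / 16 - y^2; the triple root is the cusp, and 6 is the smallest abscissa on
  \<open>sigma_plus\<close>.\<close>

definition fibre_coord :: "real \<Rightarrow> real \<Rightarrow> real \<times> real" where
  "fibre_coord a y = (a, ((a\<^sup>2 + 4) / 4 + y) / 2)"

lemma disc_fibre_coord: "disc (fibre_coord a y) = (a + 2) ^ 3 * (a - 6) / 16 - y\<^sup>2"
  by (simp add: disc_def fibre_coord_def field_simps power2_eq_square power3_eq_cube)

lemma fst_fibre_coord [simp]: "fst (fibre_coord a y) = a"
  by (simp add: fibre_coord_def)

lemma fibre_coord_cases: obtains y where "p = fibre_coord (fst p) y"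
proof
  show "p = fibre_coord (fst p) (2 * snd p - ((fst p)\<^sup>2 + 4) / 4)"
    by (simp add: fibre_coord_def)
qed

lemma width_nonneg: "width a \<ge> 0"
  by (simp add: width_def)

lemma quartic_sign:
  fixes a :: real
  shows "a \<ge> 6 \<or> a \<le> -2 \<Longrightarrow> (a + 2) ^ 3 * (a - 6) \<ge> 0"
    and "a > 6 \<or> a < -2 \<Longrightarrow> (a + 2) ^ 3 * (a - 6) > 0"
    and "-2 < a \<and> a < 6 \<Longrightarrow> (a + 2) ^ 3 * (a - 6) < 0"
    and "-2 \<le> a \<and> a \<le> 6 \<Longrightarrow> (a + 2) ^ 3 * (a - 6) \<le> 0"
  by (auto simp: zero_le_mult_iff zero_less_mult_iff mult_less_0_iff mult_le_0_iff)

lemma width_sq: "(width a)\<^sup>2 = max 0 ((a + 2) ^ 3 * (a - 6)) / 16"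
  by (simp add: width_def power_divide)

lemma disc_eq_width:
  assumes "a \<ge> 6 \<or> a \<le> -2"
  shows "disc (fibre_coord a y) = (width a)\<^sup>2 - y\<^sup>2"
  using quartic_sign(1)[OF assms] by (simp add: disc_fibre_coord width_sq)

lemma disc_nonneg_imp: "disc p \<ge> 0 \<Longrightarrow> fst p \<ge> 6 \<or> fst p \<le> -2"
proof -
  assume d: "disc p \<ge> 0"
  obtain y where "p = fibre_coord (fst p) y" by (rule fibre_coord_cases)
  with d have "disc (fibre_coord (fst p) y) \<ge> 0" by metis
  then have "(fst p + 2) ^ 3 * (fst p - 6) \<ge> 0" by (simp add: disc_fibre_coord) (smt (verit) zero_le_power2)
  then show ?thesis using quartic_sign(3)[of "fst p"] by linarith
qed

lemma disc_pos_imp: "disc p > 0 \<Longrightarrow> fst p > 6 \<or> fst p < -2"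
proof -
  assume d: "disc p > 0"
  obtain y where "p = fibre_coord (fst p) y" by (rule fibre_coord_cases)
  with d have "disc (fibre_coord (fst p) y) > 0" by metis
  then have "(fst p + 2) ^ 3 * (fst p - 6) > 0" by (simp add: disc_fibre_coord) (smt (verit) zero_le_power2)
  then show ?thesis using quartic_sign(4)[of "fst p"] by linarith
qed

text \<open>Straightens an outer region: \<open>t\<close> is the fraction of the half-width, so
  connectedness and closure are inherited from a rectangle.\<close>

definition graph_band :: "real \<times> real \<Rightarrow> real \<times> real" where
  "graph_band = (\<lambda>(a, t). fibre_coord a (t * width a))"

lemma continuous_graph_band: "continuous_on S graph_band"
  unfolding graph_band_def fibre_coord_def width_def case_prod_unfold
  by (intro continuous_intros) auto

text \<open>For \<open>c = 1\<close> and \<open>c = -1\<close> and positive \<open>t\<close> this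
  sweeps out the points above and below the branches. As \<open>width\<close> is zero over the gap,
  \<open>a\<close> may range over the whole line, and both pieces meet the strip over the
  gap.\<close>

definition graph_shift :: "real \<Rightarrow> real \<times> real \<Rightarrow> real \<times> real" where
  "graph_shift c = (\<lambda>(a, t). fibre_coord a (c * (width a + t)))"

lemma continuous_graph_shift: "continuous_on S (graph_shift c)"
  unfolding graph_shift_def fibre_coord_def width_def case_prod_unfold
  by (intro continuous_intros) auto

lemma disc_graph_band:
  assumes "a \<ge> 6 \<or> a \<le> -2"
  shows "disc (graph_band (a, t)) = (1 - t\<^sup>2) * (width a)\<^sup>2"
  using assms by (simp add: graph_band_def disc_eq_width algebra_simps)

lemma band_open:
  assumes J: "J \<subseteq> {a. a > 6 \<or> a < -2}"
  shows "{p. disc p > 0 \<and> fst p \<in> J} = graph_band ` (J \<times> {-1<..<1})"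
proof (intro equalityI subsetI)
  fix p assume p: "p \<in> {p. disc p > 0 \<and> fst p \<in> J}"
  obtain y where y: "p = fibre_coord (fst p) y" by (rule fibre_coord_cases)
  let ?w = "width (fst p)"
  from p J have a: "fst p > 6 \<or> fst p < -2" by auto
  then have w: "?w > 0" using quartic_sign(2)[OF a] by (simp add: width_def)
  have "disc (fibre_coord (fst p) y) > 0" using p y by auto
  with a have "y\<^sup>2 < ?w\<^sup>2" by (subst (asm) disc_eq_width) auto
  then have "\<bar>y\<bar> < ?w" using w by (metis abs_of_pos power2_abs power_less_imp_less_base less_le)
  then have "y / ?w \<in> {-1<..<1}" using w by (auto simp: field_simps abs_less_iff)
  moreover have "p = graph_band (fst p, y / ?w)" using w y by (simp add: graph_band_def)
  ultimately show "p \<in> graph_band ` (J \<times> {-1<..<1})" using p by blast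
next
  fix p assume "p \<in> graph_band ` (J \<times> {-1<..<1})"
  then obtain a t where p: "p = graph_band (a, t)" "a \<in> J" "-1 < t" "t < 1" by auto
  then have a: "a > 6 \<or> a < -2" using J by auto
  have "t\<^sup>2 < 1" using p by (simp add: abs_square_less_1)
  moreover have "(width a)\<^sup>2 > 0" using quartic_sign(2)[OF a] by (simp add: width_sq)
  moreover have "disc p = (1 - t\<^sup>2) * (width a)\<^sup>2" using a p by (auto intro: disc_graph_band)
  ultimately have "disc p > 0" by simp
  then show "p \<in> {p. disc p > 0 \<and> fst p \<in> J}" using p by (simp add: graph_band_def)
qed

lemma band_closed_subset:
  "{p. disc p \<ge> 0 \<and> fst p \<in> J} \<subseteq> graph_band ` ((J \<inter> {a. a \<ge> 6 \<or> a \<le> -2}) \<times> {-1..1})"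
proof
  fix p assume p: "p \<in> {p. disc p \<ge> 0 \<and> fst p \<in> J}"
  obtain y where y: "p = fibre_coord (fst p) y" by (rule fibre_coord_cases)
  let ?w = "width (fst p)"
  from p have a: "fst p \<ge> 6 \<or> fst p \<le> -2" using disc_nonneg_imp by auto
  have "disc (fibre_coord (fst p) y) \<ge> 0" using p y by auto
  with a have "y\<^sup>2 \<le> ?w\<^sup>2" by (subst (asm) disc_eq_width) auto
  then have yw: "\<bar>y\<bar> \<le> ?w" using width_nonneg by (metis abs_of_nonneg abs_le_square_iff)
  \<comment> \<open>Over 6 and -2 the width is zero; then \<open>y = 0\<close> by \<open>yw\<close>,
    and division by zero yields the admissible parameter 0.\<close>
  have "y / ?w \<in> {-1..1}"
    using yw by (cases "?w = 0") (auto simp: field_simps abs_le_iff)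
  moreover have "p = graph_band (fst p, y / ?w)" using yw y by (auto simp add: graph_band_def)
  ultimately show "p \<in> graph_band ` ((J \<inter> {a. a \<ge> 6 \<or> a \<le> -2}) \<times> {-1..1})" using p a by blast
qed

lemma outer_eq:
  "{p. disc p < 0} = graph_shift 1 ` (UNIV \<times> {0<..}) \<union> graph_shift (-1) ` (UNIV \<times> {0<..}) \<union> {-2<..<6} \<times> UNIV"
proof (intro equalityI subsetI)
  fix p assume "p \<in> {p. disc p < 0}"
  then have d: "disc p < 0" by simp
  obtain y where y: "p = fibre_coord (fst p) y" by (rule fibre_coord_cases)
  let ?w = "width (fst p)"
  show "p \<in> graph_shift 1 ` (UNIV \<times> {0<..}) \<union> graph_shift (-1) ` (UNIV \<times> {0<..}) \<union> {-2<..<6} \<times> UNIV"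
  proof (cases "-2 < fst p \<and> fst p < 6")
    case True then show ?thesis by (cases p) auto
  next
    case False
    then have a: "fst p \<ge> 6 \<or> fst p \<le> -2" by auto
    have "disc (fibre_coord (fst p) y) < 0" using d y by auto
    with a have "?w\<^sup>2 < y\<^sup>2" by (subst (asm) disc_eq_width) auto
    then have "?w < \<bar>y\<bar>" by (metis abs_ge_zero power2_abs power_less_imp_less_base)
    then consider "y - ?w > 0" | "- y - ?w > 0" by linarith
    then show ?thesis
    proof cases
      case 1
      moreover have "p = graph_shift 1 (fst p, y - ?w)" using y by (simp add: graph_shift_def)
      ultimately show ?thesis by blast
    next
      case 2
      moreover have "p = graph_shift (-1) (fst p, - y - ?w)" using y by (simp add: graph_shift_def)
      ultimately show ?thesis by blast
    qed
  qed
next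
  fix p assume "p \<in> graph_shift 1 ` (UNIV \<times> {0<..}) \<union> graph_shift (-1) ` (UNIV \<times> {0<..}) \<union> {-2<..<6} \<times> UNIV"
  moreover have "disc (graph_shift c (a, t)) < 0" if "t > 0" "c = 1 \<or> c = -1" for c a t
  proof -
    have "(c * (width a + t))\<^sup>2 = (width a + t)\<^sup>2" using that by (auto simp: power2_eq_square)
    moreover have "(width a)\<^sup>2 < (width a + t)\<^sup>2"
      using that width_nonneg[of a] by (intro power_strict_mono) auto
    ultimately show ?thesis
      using width_sq[of a] by (simp add: graph_shift_def disc_fibre_coord)
  qed
  moreover have "disc (a, b) < 0" if "-2 < a" "a < 6" for a b
  proof -
    obtain y where "(a, b) = fibre_coord (fst (a, b)) y" by (rule fibre_coord_cases)
    then have "(a, b) = fibre_coord a y" by simp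
    then show ?thesis using quartic_sign(3)[of a] that by (simp add: disc_fibre_coord) (smt (verit) zero_le_power2)
  qed
  ultimately show "p \<in> {p. disc p < 0}" by auto
qed

lemma outer_closed_subset:
  "{p. disc p \<le> 0} \<subseteq> graph_shift 1 ` (UNIV \<times> {0..}) \<union> graph_shift (-1) ` (UNIV \<times> {0..}) \<union> {-2<..<6} \<times> UNIV"
proof
  fix p assume "p \<in> {p. disc p \<le> 0}"
  then have d: "disc p \<le> 0" by simp
  obtain y where y: "p = fibre_coord (fst p) y" by (rule fibre_coord_cases)
  let ?w = "width (fst p)"
  show "p \<in> graph_shift 1 ` (UNIV \<times> {0..}) \<union> graph_shift (-1) ` (UNIV \<times> {0..}) \<union> {-2<..<6} \<times> UNIV"
  proof (cases "-2 < fst p \<and> fst p < 6")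
    case True then show ?thesis by (cases p) auto
  next
    case False
    then have a: "fst p \<ge> 6 \<or> fst p \<le> -2" by auto
    have "disc (fibre_coord (fst p) y) \<le> 0" using d y by auto
    with a have "?w\<^sup>2 \<le> y\<^sup>2" by (subst (asm) disc_eq_width) auto
    then have "?w \<le> \<bar>y\<bar>" using width_nonneg by (metis abs_of_nonneg abs_le_square_iff)
    then consider "y - ?w \<ge> 0" | "- y - ?w \<ge> 0" by linarith
    then show ?thesis
    proof cases
      case 1
      moreover have "p = graph_shift 1 (fst p, y - ?w)" using y by (simp add: graph_shift_def)
      ultimately show ?thesis by blast
    next
      case 2
      moreover have "p = graph_shift (-1) (fst p, - y - ?w)" using y by (simp add: graph_shift_def)
      ultimately show ?thesis by blast
    qed
  qed
qed

lemma continuous_disc: "continuous_on S disc"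
  unfolding disc_def by (intro continuous_intros)

lemma connected_outer: "connected {p. disc p < 0}"
proof -
  have c: "connected (graph_shift c ` (UNIV \<times> {0<..}))" for c
    by (intro connected_continuous_image continuous_graph_shift connected_Times) auto
  have s: "connected ({-2<..<6} \<times> UNIV :: (real \<times> real) set)"
    by (intro connected_Times) auto
  \<comment> \<open>Abscissa 0 lies in the gap, so this point glues the upper or lower piece to the
    connecting strip.\<close>
  have i: "graph_shift c (0, 1) \<in> graph_shift c ` (UNIV \<times> {0<..}) \<inter> {-2<..<6} \<times> UNIV" for c
    by (auto simp: graph_shift_def fibre_coord_def intro!: image_eqI[of _ _ "(0, 1)"])
  have n: "graph_shift c ` (UNIV \<times> {0<..}) \<inter> {-2<..<6} \<times> UNIV \<noteq> {}" for c
    using i[of c] by (metis empty_iff)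
  have 1: "connected (graph_shift 1 ` (UNIV \<times> {0<..}) \<union> {-2<..<6} \<times> UNIV)"
    by (rule connected_Un[OF c s n])
  have "connected (graph_shift (-1) ` (UNIV \<times> {0<..}) \<union> (graph_shift 1 ` (UNIV \<times> {0<..}) \<union> {-2<..<6} \<times> UNIV))"
    by (rule connected_Un[OF c 1]) (use n[of "-1"] in \<open>simp add: Int_Un_distrib\<close>)
  then show ?thesis unfolding outer_eq by (simp add: Un_ac)
qed

text \<open>Explicit candidates for the three regions. The sign of the abscissa separates the outer
  two, since \<open>disc p > 0\<close> excludes abscissas from -2 to 6.\<close>

fun band :: "ricci_sign \<Rightarrow> (real \<times> real) set" where
  "band Neg = {p. disc p > 0 \<and> fst p < 0}"
| "band Indef = {p. disc p < 0}"
| "band Pos = {p. disc p > 0 \<and> fst p > 0}"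

fun closed_band :: "ricci_sign \<Rightarrow> (real \<times> real) set" where
  "closed_band Neg = {p. disc p \<ge> 0 \<and> fst p < 0}"
| "closed_band Indef = {p. disc p \<le> 0}"
| "closed_band Pos = {p. disc p \<ge> 0 \<and> fst p > 0}"

lemma band_graph:
  "band Pos = graph_band ` ({6<..} \<times> {-1<..<1})"
  "band Neg = graph_band ` ({..<-2} \<times> {-1<..<1})"
proof -
  have "band Pos = {p. disc p > 0 \<and> fst p \<in> {6<..}}" "band Neg = {p. disc p > 0 \<and> fst p \<in> {..<-2}}"
    by (auto dest: disc_pos_imp)
  then show "band Pos = graph_band ` ({6<..} \<times> {-1<..<1})"
    "band Neg = graph_band ` ({..<-2} \<times> {-1<..<1})"
    using band_open[of "{6<..}"] band_open[of "{..<-2}"] by auto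
qed

lemma connected_band: "connected (band \<epsilon>)"
proof (cases \<epsilon>)
  case Indef then show ?thesis using connected_outer by simp
qed (auto simp only: band_graph intro!: connected_continuous_image continuous_graph_band connected_Times
   connected_Ioi connected_Iio connected_Ioo)

lemma open_band: "open (band \<epsilon>)"
proof -
  have "open {p. disc p < 0}" "open {p. disc p > 0}" "open {p :: real \<times> real. fst p < 0}" "open {p :: real \<times> real. fst p > 0}"
    by (auto intro!: open_Collect_less continuous_intros continuous_disc)
  then show ?thesis by (cases \<epsilon>) (auto simp: open_Collect_conj)
qed

text \<open>Turns the strict condition on the abscissa into a closed one, from which closedness can
  be read off.\<close>

lemma closed_band_outer:
  "closed_band Pos = {p. disc p \<ge> 0 \<and> fst p \<ge> 6}"
  "closed_band Neg = {p. disc p \<ge> 0 \<and> fst p \<le> -2}"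
  by (auto dest: disc_nonneg_imp)

lemma closed_closed_band: "closed (closed_band \<epsilon>)"
proof -
  have "closed {p. disc p \<le> 0}" "closed {p. disc p \<ge> 0}" "closed {p :: real \<times> real. fst p \<le> -2}" "closed {p :: real \<times> real. fst p \<ge> 6}"
    by (auto intro!: closed_Collect_le continuous_intros continuous_disc)
  then show ?thesis by (cases \<epsilon>) (auto simp: closed_band_outer closed_Collect_conj simp del: closed_band.simps(1,3))
qed

lemma band_nonempty: "band \<epsilon> \<noteq> {}"
proof (cases \<epsilon>)
  case Indef
  have "disc (0, 0) < 0" by (simp add: disc_def)
  then show ?thesis using Indef by auto
next
  case Pos
  have "(7, 0) \<in> ({6<..} \<times> {-1<..<1} :: (real \<times> real) set)" by simp
  then show ?thesis unfolding Pos band_graph by blast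
next
  case Neg
  have "(-3, 0) \<in> ({..<-2} \<times> {-1<..<1} :: (real \<times> real) set)" by simp
  then show ?thesis unfolding Neg band_graph by blast
qed

text \<open>A continuous map sends the closure of a parameter set into the closure of its image.
  Boundary points, the cusp included, come from the closed parameter rectangles and
  half-planes.\<close>

lemma closure_band: "closure (band \<epsilon>) = closed_band \<epsilon>"
proof
  have "band \<epsilon> \<subseteq> closed_band \<epsilon>" by (cases \<epsilon>) auto
  then show "closure (band \<epsilon>) \<subseteq> closed_band \<epsilon>"
    by (simp add: closed_closed_band closure_minimal)
next
  have cl: "f ` closure S \<subseteq> closure (f ` S)" if "continuous_on (closure S) f" for f :: "real \<times> real \<Rightarrow> real \<times> real" and S
    using that closed_closure closure_subset by (rule image_closure_subset)
  show "closed_band \<epsilon> \<subseteq> closure (band \<epsilon>)"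
  proof (cases \<epsilon>)
    case Pos
    have "{6::real..} \<inter> {a. a \<ge> 6 \<or> a \<le> -2} = {6::real..}" by auto
    then have "closed_band Pos \<subseteq> graph_band ` closure ({6<..} \<times> {-1<..<1})"
      using band_closed_subset[of "{6..}"] by (simp add: closed_band_outer closure_Times del: closed_band.simps)
    also have "\<dots> \<subseteq> closure (band Pos)"
      unfolding band_graph by (intro cl continuous_graph_band)
    finally show ?thesis using Pos by simp
  next
    case Neg
    have "{..-2::real} \<inter> {a. a \<ge> 6 \<or> a \<le> -2} = {..-2::real}" by auto
    then have "closed_band Neg \<subseteq> graph_band ` closure ({..<-2} \<times> {-1<..<1})"
      using band_closed_subset[of "{..-2}"] by (simp add: closed_band_outer closure_Times del: closed_band.simps)
    also have "\<dots> \<subseteq> closure (band Neg)"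
      unfolding band_graph by (intro cl continuous_graph_band)
    finally show ?thesis using Neg by simp
  next
    case Indef
    have g: "graph_shift c ` (UNIV \<times> {0..}) \<subseteq> closure (graph_shift c ` (UNIV \<times> {0<..}))" for c
      using cl[of "UNIV \<times> {0<..}" "graph_shift c"] by (simp add: closure_Times continuous_graph_shift)
    have "closed_band Indef \<subseteq> closure (band Indef)"
      using outer_closed_subset g[of 1] g[of "-1"] closure_subset[of "{-2<..<6} \<times> (UNIV :: real set)"]
      unfolding closed_band.simps band.simps outer_eq closure_Un by blast
    then show ?thesis using Indef by simp
  qed
qed

text \<open>A zero of \<open>disc\<close> is a limit of points outside the set: for an outer band
  these come from \<open>band Indef\<close>, whose closure is all of \<open>disc p \<le> 0\<close>;
  for the middle one from the two outer bands, whose closures cover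
  \<open>disc p \<ge> 0\<close>.\<close>

lemma frontier_closed_band: "frontier (closed_band \<epsilon>) = {p \<in> closed_band \<epsilon>. disc p = 0}"
proof
  have "band \<epsilon> \<subseteq> interior (closed_band \<epsilon>)"
    by (rule interior_maximal) (auto simp: open_band intro: closure_band[THEN equalityD1, THEN subsetD] closure_subset[THEN subsetD])
  moreover have "frontier (closed_band \<epsilon>) = closed_band \<epsilon> - interior (closed_band \<epsilon>)"
    by (simp add: frontier_def closed_closed_band)
  ultimately show "frontier (closed_band \<epsilon>) \<subseteq> {p \<in> closed_band \<epsilon>. disc p = 0}"
    by (cases \<epsilon>) (force simp: subset_iff not_less)+
next
  have "{p. disc p \<ge> 0} = closed_band Pos \<union> closed_band Neg"
    by (auto dest: disc_nonneg_imp)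
  also have "\<dots> = closure (band Pos \<union> band Neg)" by (simp only: closure_Un closure_band)
  also have "\<dots> \<subseteq> closure (- closed_band Indef)" by (intro closure_mono) auto
  finally have 1: "{p. disc p \<ge> 0} \<subseteq> closure (- closed_band Indef)" .
  have "band Indef \<subseteq> - closed_band \<epsilon>" if "\<epsilon> \<noteq> Indef" using that by (cases \<epsilon>) auto
  then have 2: "{p. disc p \<le> 0} \<subseteq> closure (- closed_band \<epsilon>)" if "\<epsilon> \<noteq> Indef"
    using that by (metis closure_band closure_mono closed_band.simps(2))
  have "p \<in> closure (- closed_band \<epsilon>)" if "disc p = 0" for p
    using 1 2 that by (cases "\<epsilon> = Indef") auto
  then show "{p \<in> closed_band \<epsilon>. disc p = 0} \<subseteq> frontier (closed_band \<epsilon>)"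
    using closure_subset by (auto simp: frontier_closures)
qed

text \<open>Both curves together are \<open>r \<mapsto> (2 (r\<^sup>2 - r + 1) / (r - 1), r\<^sup>2 + 1)\<close>, with
  \<open>r = 1 + 2 t\<^sup>2\<close> on \<open>sigma_plus\<close> and \<open>r = 1 - 2 t\<^sup>2\<close> on \<open>sigma_minus\<close>.\<close>

lemma range_sigma: "sigma_plus ` {0<..} \<union> sigma_minus ` {0<..} = {p. disc p = 0}"
proof (intro equalityI subsetI)
  fix p assume "p \<in> sigma_plus ` {0<..} \<union> sigma_minus ` {0<..}"
  then obtain t where t: "t > 0" "p = sigma_plus t \<or> p = sigma_minus t" by auto
  have "1 / t\<^sup>2 * t\<^sup>2 = 1" using t by simp
  then have "disc (sigma_plus t) = 0 \<and> disc (sigma_minus t) = 0"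
    unfolding sigma_plus_def sigma_minus_def disc_def fst_conv snd_conv by algebra
  with t show "p \<in> {p. disc p = 0}" by auto
next
  fix p :: "real \<times> real" assume "p \<in> {p. disc p = 0}"
  then have d: "disc p = 0" by simp
  obtain a b where p: "p = (a, b)" by (cases p)
  \<comment> \<open>On the curve b = r^2 + 1 and (b - 2) a = 2 (r^3 + 1). The real cube root
    recovers \<open>r\<close> together with its sign, which b alone leaves open.\<close>
  define r where "r = root 3 (((b - 2) * a - 2) / 2)"
  have r3: "2 * r ^ 3 = (b - 2) * a - 2" by (simp add: r_def odd_real_root_pow)
  \<comment> \<open>The difference of the two sides is \<open>b - 2\<close> times
    \<open>disc (a, b)\<close>.\<close>
  have "((b - 2) * a - 2)\<^sup>2 = 4 * (b - 1) ^ 3" using d unfolding p disc_def fst_conv snd_conv by algebra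
  then have "(r\<^sup>2) ^ 3 = (b - 1) ^ 3" unfolding r3[symmetric]
    by (simp add: power_mult_distrib flip: power_mult)
  then have "r\<^sup>2 = b - 1" by (metis odd_numeral odd_real_root_power_cancel)
  then have b: "b = r\<^sup>2 + 1" by simp
  have "r\<^sup>2 - r + 1 = (r - 1/2)\<^sup>2 + 3/4" by (simp add: power2_eq_square algebra_simps)
  then have rp: "r\<^sup>2 - r + 1 > 0" by (simp add: add_nonneg_pos)
  \<comment> \<open>The cube relation carries the spurious factor \<open>r + 1\<close>; at
    \<open>r = -1\<close>, where b = 2, the value of \<open>a\<close> is read off
    \<open>disc\<close> itself.\<close>
  have e: "(r - 1) * a = 2 * (r\<^sup>2 - r + 1)"
  proof (cases "r = -1")
    case True
    then show ?thesis using d unfolding p disc_def b by simp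
  next
    case False
    have "(r + 1) * ((r - 1) * a - 2 * (r\<^sup>2 - r + 1)) = 0" using r3 unfolding b by algebra
    with False show ?thesis by auto
  qed
  with rp have r1: "r \<noteq> 1" by auto
  then have a: "a = 2 * (r\<^sup>2 - r + 1) / (r - 1)" using e by (simp add: field_simps)
  define t where "t = sqrt (\<bar>r - 1\<bar> / 2)"
  have t: "t > 0" "t\<^sup>2 = \<bar>r - 1\<bar> / 2" using r1 by (simp_all add: t_def)
  have t4: "t ^ 4 = (r - 1)\<^sup>2 / 4"
    using t(2) by (metis (no_types, lifting) power2_abs power_divide power2_eq_square mult_2 power_add numeral_Bit0 four_x_squared)
  show "p \<in> sigma_plus ` {0<..} \<union> sigma_minus ` {0<..}"
  proof (cases "r > 1")
    case True
    then have "p = sigma_plus t"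
      unfolding p sigma_plus_def t(2) t4 a b by (simp add: field_simps power2_eq_square)
    with t show ?thesis by auto
  next
    case False
    then have "p = sigma_minus t"
      using r1 unfolding p sigma_minus_def t(2) t4 a b by (simp add: field_simps power2_eq_square)
    with t show ?thesis by auto
  qed
qed

section \<open>Matching the components with the sign conditions\<close>

lemma UNIV_ricci_sign: "UNIV = {Pos, Neg, Indef}"
  using ricci_sign.exhaust by blast

lemma components_off_curves: "components off_curves = range band"
proof (rule components_open_unique)
  have "band \<epsilon> \<inter> band \<epsilon>' = {}" if "\<epsilon> \<noteq> \<epsilon>'" for \<epsilon> \<epsilon>'
    using that by (cases \<epsilon>; cases \<epsilon>'; force)
  then show "pairwise disjnt (range band)" unfolding pairwise_def disjnt_def by (metis imageE)
  have "\<Union> (range band) = band Pos \<union> band Neg \<union> band Indef"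
    by (simp add: UNIV_ricci_sign Un_ac del: band.simps)
  also have "\<dots> = off_curves"
  proof -
    have "p \<in> band Pos \<union> band Neg \<union> band Indef \<longleftrightarrow> disc p \<noteq> 0" for p
      using disc_pos_imp[of p] by (simp, linarith)
    then show ?thesis unfolding off_curves_def range_sigma by blast
  qed
  finally show "\<Union> (range band) = off_curves" .
qed (auto simp: open_band connected_band band_nonempty simp del: band.simps)

text \<open>Each definite description needs a unique candidate among the three components: a
  positive \<open>disc\<close> forces a positive ordinate, so each outer band fits its quadrant,
  while the middle one contains the origin and fits neither.\<close>

lemma region_eq: "region \<epsilon> = band \<epsilon>"
proof -
  have ex: "\<And>C. C \<in> components off_curves \<longleftrightarrow> C = band Pos \<or> C = band Neg \<or> C = band Indef"
    by (simp add: components_off_curves UNIV_ricci_sign del: band.simps)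
  have snd: "snd p > 0" if "disc p > 0" for p
  proof (rule ccontr)
    assume "\<not> snd p > 0"
    then have "((fst p)\<^sup>2 + 4) * snd p \<le> 0" by (intro mult_nonneg_nonpos) auto
    moreover have "2 * (fst p)\<^sup>2 + 4 * fst p + 4 = 2 * (fst p + 1)\<^sup>2 + 2" by (simp add: power2_eq_square algebra_simps)
    ultimately show False using that zero_le_power2[of "snd p"] zero_le_power2[of "fst p + 1"] unfolding disc_def by linarith
  qed
  have ind: "(0, 0) \<in> band Indef" by (simp add: disc_def)
  have dis: "band Pos \<noteq> band Neg" "band Pos \<noteq> band Indef" "band Neg \<noteq> band Indef"
    using band_nonempty[of Pos] band_nonempty[of Neg] by force+
  have p: "band Pos \<subseteq> {0<..} \<times> {0<..}" and n: "band Neg \<subseteq> {..<0} \<times> {0<..}"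
    using snd by (auto simp: subset_iff)
  have np: "\<not> band Pos \<subseteq> {..<0} \<times> {0<..}" "\<not> band Neg \<subseteq> {0<..} \<times> {0<..}"
    using band_nonempty[of Pos] band_nonempty[of Neg] p n by force+
  have ni: "\<not> band Indef \<subseteq> {..<0} \<times> {0<..}" "\<not> band Indef \<subseteq> {0<..} \<times> {0<..}"
    using ind by blast+
  have "region_plus = band Pos"
    unfolding region_plus_def ex by (rule the_equality) (use p np ni in blast)+
  moreover have "region_minus = band Neg"
    unfolding region_minus_def ex by (rule the_equality) (use n np ni in blast)+
  moreover have "region_zero = band Indef"
    unfolding region_zero_def ex calculation by (rule the_equality) (use dis in blast)+
  ultimately show ?thesis by (cases \<epsilon>) (simp_all del: band.simps)
qed

lemma bd_eq: "bd \<epsilon> = {p \<in> closed_band \<epsilon>. disc p = 0}"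
  by (simp add: closed_region_def region_eq closure_band frontier_closed_band)

subsection \<open>Normal forms, definite case\<close>

lemma GL2p_subset: "GL2p \<subseteq> GL2"
  by (auto simp: GL2p_def GL2_def invertible_det_nz)

lemma pull_eq_act:
  assumes "T ** S = mat 1"
  shows "pull T \<Gamma> = (\<chi> i j k. \<Sum>a\<in>UNIV. \<Sum>b\<in>UNIV. \<Sum>c\<in>UNIV. S $ i $ a * S $ j $ b * T $ c $ k * \<Gamma> $ a $ b $ c)"
  using matrix_inv_eqI[OF assms] by (simp add: pull_def)

lemma rho_inv_eqI: "ricci \<Gamma> ** B = mat 1 \<Longrightarrow> rho_inv \<Gamma> = B"
  by (simp add: rho_inv_def matrix_inv_eqI)

lemmas mat2_simps = vec_eq_iff forall_2 matrix_matrix_mult_def sum_2 mat_def transpose_def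

text \<open>The solutions of \<open>\<rho> = 2 (\<bar>p\<bar>\<^sup>2 - \<bar>u\<bar>\<^sup>2) I\<close>: the trace of \<open>\<Gamma>\<close> is \<open>4 p\<close>, the harmonic part of
  the associated cubic form is \<open>u\<close>, and a rotation by \<open>l\<close> multiplies them by \<open>l\<close> and \<open>l\<^sup>-\<^sup>3\<close>.\<close>

definition definite_nf :: "complex \<Rightarrow> complex \<Rightarrow> christoffel" where
  "definite_nf p u = vector
    [vector [vector [3 * Re p + Re u, Im p - Im u], vector [Im p - Im u, Re p - Re u]],
     vector [vector [Im p - Im u, Re p - Re u], vector [Re p - Re u, 3 * Im p + Im u]]]"

lemma definite_nf_nth [simp]:
  "definite_nf p u $ 1 $ 1 $ 1 = 3 * Re p + Re u"
  "definite_nf p u $ 1 $ 1 $ 2 = Im p - Im u"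
  "definite_nf p u $ 1 $ 2 $ 1 = Im p - Im u"
  "definite_nf p u $ 1 $ 2 $ 2 = Re p - Re u"
  "definite_nf p u $ 2 $ 1 $ 1 = Im p - Im u"
  "definite_nf p u $ 2 $ 1 $ 2 = Re p - Re u"
  "definite_nf p u $ 2 $ 2 $ 1 = Re p - Re u"
  "definite_nf p u $ 2 $ 2 $ 2 = 3 * Im p + Im u"
  by (simp_all add: definite_nf_def)

lemma definite_nf_inject: "definite_nf p u = definite_nf p' u' \<longleftrightarrow> p = p' \<and> u = u'"
  by (auto simp: vec_eq_iff[where 'b = "2"] forall_2 complex_eq_iff)

lemma torsion_free_definite_nf: "definite_nf p u \<in> torsion_free"
  by (simp add: torsion_free_iff vec_eq_iff forall_2)

lemma ricci_definite_nf: "ricci (definite_nf p u) = mat (2 * ((cmod p)\<^sup>2 - (cmod u)\<^sup>2))"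
  unfolding cmod_power2 by (simp add: vec_eq_iff forall_2 mat_def algebra_simps power2_eq_square)

text \<open>Cross-multiplying the two diagonal equations writes \<open>(b' - b) * k\<close> and
  \<open>(g - g') * k\<close> as multiples of the vanishing off-diagonal entry. As \<open>k\<close>
  is nonzero, \<Gamma> is symmetric in all three indices.\<close>

lemma definite_nf_exists:
  assumes "\<Gamma> \<in> torsion_free" "ricci \<Gamma> = mat k" "k \<noteq> 0"
  obtains p u where "\<Gamma> = definite_nf p u"
proof
  define a b b' g' g d where "a = \<Gamma>$1$1$1" "b = \<Gamma>$1$1$2" "b' = \<Gamma>$1$2$1" "g' = \<Gamma>$1$2$2" "g = \<Gamma>$2$2$1" "d = \<Gamma>$2$2$2"
  note defs = this
  have r: "g' * (a - g') + b * (d - b') = k" "b' * g' - b * g = 0" "g * (a - g') + b' * (d - b') = k"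
    using assms(2) unfolding defs by (simp_all add: vec_eq_iff forall_2 mat_def)
  have "b' * k - b * k = b' * (g' * (a - g') + b * (d - b')) - b * (g * (a - g') + b' * (d - b'))"
    by (simp only: r)
  also have "\<dots> = (b' * g' - b * g) * (a - g')" by algebra
  finally have "b' * k - b * k = 0" by (simp only: r mult_zero_left)
  moreover have "g * k - g' * k = g * (g' * (a - g') + b * (d - b')) - g' * (g * (a - g') + b' * (d - b'))"
    by (simp only: r)
  then have "g * k - g' * k = - (b' * g' - b * g) * (d - b')" by algebra
  then have "g * k - g' * k = 0" by (simp only: r minus_zero mult_zero_left)
  ultimately have "b' = b" "g' = g" using assms by auto
  \<comment> \<open>Solves \<open>a = 3 Re p + Re u\<close>, \<open>g = Re p - Re u\<close> and the
    analogous pair \<open>d\<close>, \<open>b\<close> for the imaginary parts.\<close>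
  then show "\<Gamma> = definite_nf (Complex ((a + g) / 4) ((b + d) / 4)) (Complex ((a - 3 * g) / 4) ((d - 3 * b) / 4))"
    using torsion_freeD[OF assms(1)] unfolding defs
    by (simp add: vec_eq_iff[where 'b = "2"] forall_2 field_simps)
qed

lemma rho_inv_definite_nf:
  assumes "e * e = 1" "(cmod p)\<^sup>2 - (cmod u)\<^sup>2 = e"
  shows "rho_inv (definite_nf p u) = mat (e / 2)"
  by (rule rho_inv_eqI) (use assms in \<open>simp add: ricci_definite_nf mat2_simps\<close>)

lemma rho3_definite_nf:
  "rho3 (definite_nf p u) $ 1 $ 1 = (3 * Re p + Re u)\<^sup>2 + 2 * (Im p - Im u)\<^sup>2 + (Re p - Re u)\<^sup>2"
  "rho3 (definite_nf p u) $ 1 $ 2 = (Im p - Im u) * (3 * Re p + Re u) + 2 * (Im p - Im u) * (Re p - Re u) + (Re p - Re u) * (3 * Im p + Im u)"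
  "rho3 (definite_nf p u) $ 2 $ 1 = (Im p - Im u) * (3 * Re p + Re u) + 2 * (Im p - Im u) * (Re p - Re u) + (Re p - Re u) * (3 * Im p + Im u)"
  "rho3 (definite_nf p u) $ 2 $ 2 = (Im p - Im u)\<^sup>2 + 2 * (Re p - Re u)\<^sup>2 + (3 * Im p + Im u)\<^sup>2"
  by (simp_all add: rho3_def sum_2 power2_eq_square)

text \<open>The factor \<open>e\<close>, which is 1 or -1, lets one computation serve both definite
  signs.\<close>

lemma invariants_definite_nf:
  assumes e: "e * e = 1" and pu: "(cmod p)\<^sup>2 - (cmod u)\<^sup>2 = e"
  defines "x \<equiv> e * (cmod p)\<^sup>2"
  shows "psi3 (definite_nf p u) = 8 * x - 2"
    and "Psi3 (definite_nf p u) = 8 * x\<^sup>2 - 4 * x + 1 - 8 * Re (p ^ 3 * u)"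
    and "chi_inv (definite_nf p u) = - 16 * e * Im (p ^ 3 * u)"
proof -
  have u2: "(Re u)\<^sup>2 + (Im u)\<^sup>2 = (Re p)\<^sup>2 + (Im p)\<^sup>2 - e" using pu by (simp add: cmod_power2)
  have r: "ricci (definite_nf p u) = mat (2 * e)" by (simp add: ricci_definite_nf pu)
  show "psi3 (definite_nf p u) = 8 * x - 2"
    unfolding psi3_def rho_inv_definite_nf[OF e pu] sum_2 rho3_definite_nf x_def cmod_power2
    using u2 e by (simp add: mat_def) algebra
  have d: "det (ricci (definite_nf p u)) = 4" using e by (simp add: r det_2 mat_def)
  have R: "Re (p ^ 3 * u) = ((Re p)^3 - 3 * Re p * (Im p)\<^sup>2) * Re u - (3 * (Re p)\<^sup>2 * Im p - (Im p)^3) * Im u"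
    by (simp add: power3_eq_cube power2_eq_square algebra_simps)
  define X U where "X = (cmod p)\<^sup>2" and "U = (cmod u)\<^sup>2"
  \<comment> \<open>The determinant is a quartic invariant under rotations and reflections, which
    explains why only \<open>X\<close>, \<open>U\<close> and the real part of p^3 u occur.\<close>
  have "det (rho3 (definite_nf p u)) = 4 * (5 * X\<^sup>2 + 2 * X * U + U\<^sup>2 - 8 * Re (p ^ 3 * u))"
    unfolding det_2 rho3_definite_nf X_def U_def cmod_power2 R by algebra
  moreover have "U = X - e" using pu by (simp add: X_def U_def)
  ultimately have "Psi3 (definite_nf p u) = 5 * X\<^sup>2 + 2 * X * (X - e) + (X - e)\<^sup>2 - 8 * Re (p ^ 3 * u)"
    unfolding Psi3_def d by simp
  moreover have "x = e * X" by (simp add: x_def X_def)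
  ultimately show "Psi3 (definite_nf p u) = 8 * x\<^sup>2 - 4 * x + 1 - 8 * Re (p ^ 3 * u)"
    using e by algebra
  have i: "Im (p ^ 3 * u) = ((Re p)^3 - 3 * Re p * (Im p)\<^sup>2) * Im u + (3 * (Re p)\<^sup>2 * Im p - (Im p)^3) * Re u"
    by (simp add: power3_eq_cube power2_eq_square algebra_simps)
  have t: "tr1 (definite_nf p u) $ 1 = 4 * Re p" "tr1 (definite_nf p u) $ 2 = 4 * Im p"
    by (simp_all add: tr1_def trace_def sum_2)
  have ta: "tau (definite_nf p u) $ 1 = 2 * e * Re p" "tau (definite_nf p u) $ 2 = 2 * e * Im p"
    by (simp_all add: tau_def rho_inv_definite_nf[OF e pu] vector_matrix_mult_def sum_2 mat_def field_simps)
  have dm: "det (mat (e / 2) :: real^2^2) = 1 / 4" using e by (simp add: det_2 mat_def)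
  show "chi_inv (definite_nf p u) = - 16 * e * Im (p ^ 3 * u)"
    unfolding chi_inv_eq rho3_sym rho_inv_definite_nf[OF e pu] d dm cross2_def matrix_vector_mult_def
      vec_lambda_beta sum_2 t ta rho3_definite_nf i
    by (simp add: algebra_simps power2_eq_square power3_eq_cube)
qed

definition rot :: "complex \<Rightarrow> real^2^2" where
  "rot l = vector [vector [Re l, Im l], vector [- Im l, Re l]]"

lemma rot_nth [simp]:
  "rot l $ 1 $ 1 = Re l" "rot l $ 1 $ 2 = Im l" "rot l $ 2 $ 1 = - Im l" "rot l $ 2 $ 2 = Re l"
  by (simp_all add: rot_def)

lemma det_rot: "det (rot l) = (cmod l)\<^sup>2"
  unfolding cmod_power2 by (simp add: det_2 power2_eq_square)

lemma rot_in_GL2p: "cmod l = 1 \<Longrightarrow> rot l \<in> GL2p"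
  by (simp add: GL2p_def det_rot)

lemma rot_cnj: "cmod l = 1 \<Longrightarrow> rot l ** rot (cnj l) = mat 1"
  using cmod_power2[of l] by (simp add: mat2_simps power2_eq_square)

lemma pull_rot:
  assumes "cmod l = 1"
  shows "pull (rot l) (definite_nf p u) = definite_nf (l * p) (cnj l ^ 3 * u)"
proof -
  have l: "Re l * Re l + Im l * Im l = 1" using cmod_power2[of l] assms by (simp add: power2_eq_square)
  show ?thesis
    unfolding pull_eq_act[OF rot_cnj[OF assms]]
    using l by (simp add: vec_eq_iff[where 'b = "2"] forall_2 sum_2 power3_eq_cube, intro conjI; algebra)
qed

text \<open>Preserving a nonzero multiple of the identity makes \<open>T\<close> orthogonal, and a
  positive determinant makes it a rotation.\<close>

lemma definite_isotropy_rot: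
  assumes T: "T \<in> GL2p" and k: "k \<noteq> 0" and "ricci \<Gamma> = mat k" "ricci (pull T \<Gamma>) = mat k" "\<Gamma> \<in> torsion_free"
  obtains l where "cmod l = 1" "T = rot l"
proof -
  let ?S = "matrix_inv T"
  have G: "T \<in> GL2" using T GL2p_subset by auto
  then have TS: "T ** ?S = mat 1" by (simp add: GL2_def matrix_inv_right)
  have "?S ** mat k ** transpose ?S = mat k" using assms G by (metis ricci_pull)
  then have "T ** ?S ** mat k ** transpose (T ** ?S) = T ** mat k ** transpose T"
    by (simp add: matrix_transpose_mul) (metis matrix_mul_assoc)
  then have "T ** mat k ** transpose T = mat k" by (simp add: TS)
  moreover have "(T ** mat k ** transpose T) $ i $ j = k * (T$i$1 * T$j$1 + T$i$2 * T$j$2)" for i j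
    by (simp add: matrix_matrix_mult_def sum_2 mat_def transpose_def algebra_simps)
  ultimately have e: "k * (T$i$1 * T$j$1 + T$i$2 * T$j$2) = mat k $ i $ j" for i j
    by metis
  have o: "T$1$1 * T$1$1 + T$1$2 * T$1$2 = 1" "T$1$1 * T$2$1 + T$1$2 * T$2$2 = 0"
    "T$2$1 * T$2$1 + T$2$2 * T$2$2 = 1"
    using k e[of 1 1] e[of 1 2] e[of 2 2] by (simp_all add: mat_def)
  define D where "D = T$1$1 * T$2$2 - T$1$2 * T$2$1"
  have "D * D = 1" unfolding D_def using o by algebra
  moreover have "D > 0" using T by (simp add: GL2p_def det_2 D_def)
  ultimately have "D = 1" by (simp add: square_eq_1_iff)
  then have "T$2$2 = T$1$1" "T$2$1 = - T$1$2" unfolding D_def using o by algebra+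
  then have "T = rot (Complex (T$1$1) (T$1$2))" by (simp add: vec_eq_iff forall_2)
  moreover have "cmod (Complex (T$1$1) (T$1$2)) = 1" using o(1) by (simp add: cmod_def power2_eq_square)
  ultimately show ?thesis using that by blast
qed

subsection \<open>Normal forms, indefinite case\<close>

text \<open>For nonzero \<open>c\<close>, the Gram matrix of an indefinite form in a basis of null
  vectors.\<close>

definition anti_diag :: "real \<Rightarrow> real^2^2" where
  "anti_diag c = vector [vector [0, c], vector [c, 0]]"

lemma anti_diag_nth [simp]:
  "anti_diag c $ 1 $ 1 = 0" "anti_diag c $ 1 $ 2 = c" "anti_diag c $ 2 $ 1 = c" "anti_diag c $ 2 $ 2 = 0"
  by (simp_all add: anti_diag_def)

text \<open>The solutions of \<open>\<rho>\<^sub>1\<^sub>1 = \<rho>\<^sub>2\<^sub>2 = 0\<close>, \<open>\<rho>\<^sub>1\<^sub>2 = p q - u v \<noteq> 0\<close>; the boosts act on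
  \<open>p\<close>, \<open>q\<close>, \<open>u\<close>, \<open>v\<close> with weights \<open>1\<close>, \<open>-1\<close>, \<open>-3\<close>, \<open>3\<close>.\<close>

definition indefinite_nf :: "real \<Rightarrow> real \<Rightarrow> real \<Rightarrow> real \<Rightarrow> christoffel" where
  "indefinite_nf p q u v = vector
    [vector [vector [q, u], vector [p, q]], vector [vector [p, q], vector [v, p]]]"

lemma indefinite_nf_nth [simp]:
  "indefinite_nf p q u v $ 1 $ 1 $ 1 = q"
  "indefinite_nf p q u v $ 1 $ 1 $ 2 = u"
  "indefinite_nf p q u v $ 1 $ 2 $ 1 = p"
  "indefinite_nf p q u v $ 1 $ 2 $ 2 = q"
  "indefinite_nf p q u v $ 2 $ 1 $ 1 = p"
  "indefinite_nf p q u v $ 2 $ 1 $ 2 = q"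
  "indefinite_nf p q u v $ 2 $ 2 $ 1 = v"
  "indefinite_nf p q u v $ 2 $ 2 $ 2 = p"
  by (simp_all add: indefinite_nf_def)

lemma indefinite_nf_inject:
  "indefinite_nf p q u v = indefinite_nf p' q' u' v' \<longleftrightarrow> p = p' \<and> q = q' \<and> u = u' \<and> v = v'"
  by (auto simp: vec_eq_iff[where 'b = "2"] forall_2)

lemma torsion_free_indefinite_nf: "indefinite_nf p q u v \<in> torsion_free"
  by (simp add: torsion_free_iff vec_eq_iff forall_2)

lemma ricci_indefinite_nf: "ricci (indefinite_nf p q u v) = anti_diag (p * q - u * v)"
  by (simp add: vec_eq_iff forall_2)

text \<open>The two diagonal equations are a homogeneous linear system for \<open>a - q\<close> and
  \<open>d - p\<close> whose determinant is the off-diagonal entry \<open>c\<close>; hence both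
  unknowns vanish.\<close>

lemma indefinite_nf_exists:
  assumes "\<Gamma> \<in> torsion_free" "ricci \<Gamma> = anti_diag c" "c \<noteq> 0"
  obtains p q u v where "\<Gamma> = indefinite_nf p q u v"
proof
  define a u p q v d where "a = \<Gamma>$1$1$1" "u = \<Gamma>$1$1$2" "p = \<Gamma>$1$2$1" "q = \<Gamma>$1$2$2" "v = \<Gamma>$2$2$1" "d = \<Gamma>$2$2$2"
  note defs = this
  have r: "q * (a - q) + u * (d - p) = 0" "p * q - u * v = c" "v * (a - q) + p * (d - p) = 0"
    using assms(2) unfolding defs by (simp_all add: vec_eq_iff forall_2)
  have "(p * q - u * v) * (a - q) = 0" using r(1,3) by algebra
  moreover have "(p * q - u * v) * (d - p) = 0" using r(1,3) by algebra
  ultimately have "a = q" "d = p" using assms r(2) by auto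
  then show "\<Gamma> = indefinite_nf p q u v"
    using torsion_freeD[OF assms(1)] unfolding defs
    by (simp add: vec_eq_iff[where 'b = "2"] forall_2)
qed

lemma rho_inv_indefinite_nf:
  assumes "p * q - u * v = 1"
  shows "rho_inv (indefinite_nf p q u v) = anti_diag 1"
  by (rule rho_inv_eqI) (use assms in \<open>simp add: ricci_indefinite_nf mat2_simps\<close>)

lemma rho3_indefinite_nf:
  "rho3 (indefinite_nf p q u v) $ 1 $ 1 = 2 * q\<^sup>2 + 2 * u * p"
  "rho3 (indefinite_nf p q u v) $ 1 $ 2 = 3 * p * q + u * v"
  "rho3 (indefinite_nf p q u v) $ 2 $ 1 = 3 * p * q + u * v"
  "rho3 (indefinite_nf p q u v) $ 2 $ 2 = 2 * p\<^sup>2 + 2 * v * q"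
  by (simp_all add: rho3_def sum_2 power2_eq_square)

text \<open>Parallel to the definite case, with \<open>q\<close> and \<open>v\<close> in the roles
  of the conjugates of \<open>p\<close> and \<open>u\<close>.\<close>

lemma invariants_indefinite_nf:
  assumes c: "p * q - u * v = 1"
  defines "x \<equiv> p * q"
  shows "psi3 (indefinite_nf p q u v) = 8 * x - 2"
    and "Psi3 (indefinite_nf p q u v) = 8 * x\<^sup>2 - 4 * x + 1 - 4 * (p ^ 3 * u + q ^ 3 * v)"
    and "chi_inv (indefinite_nf p q u v) = 8 * (p ^ 3 * u - q ^ 3 * v)"
proof -
  have r: "ricci (indefinite_nf p q u v) = anti_diag 1" by (simp add: ricci_indefinite_nf c)
  show "psi3 (indefinite_nf p q u v) = 8 * x - 2"
    unfolding psi3_def rho_inv_indefinite_nf[OF c] sum_2 rho3_indefinite_nf x_def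
    using c by simp
  have d: "det (ricci (indefinite_nf p q u v)) = - 1" by (simp add: r det_2)
  show "Psi3 (indefinite_nf p q u v) = 8 * x\<^sup>2 - 4 * x + 1 - 4 * (p ^ 3 * u + q ^ 3 * v)"
  proof -
    have "det (rho3 (indefinite_nf p q u v)) =
        4 * (x\<^sup>2 + x * (u * v) + p ^ 3 * u + q ^ 3 * v) - (3 * x + u * v)\<^sup>2"
      unfolding det_2 rho3_indefinite_nf x_def by algebra
    moreover have "u * v = x - 1" using c by (simp add: x_def)
    ultimately have "det (rho3 (indefinite_nf p q u v)) =
        4 * (x\<^sup>2 + x * (x - 1) + p ^ 3 * u + q ^ 3 * v) - (3 * x + (x - 1))\<^sup>2" by simp
    then show ?thesis
      unfolding Psi3_def d by (simp add: power2_eq_square algebra_simps)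
  qed
  have t: "tr1 (indefinite_nf p q u v) $ 1 = 2 * q" "tr1 (indefinite_nf p q u v) $ 2 = 2 * p"
    by (simp_all add: tr1_def trace_def sum_2)
  have ta: "tau (indefinite_nf p q u v) $ 1 = 2 * p" "tau (indefinite_nf p q u v) $ 2 = 2 * q"
    by (simp_all add: tau_def rho_inv_indefinite_nf[OF c] vector_matrix_mult_def sum_2)
  have dm: "det (anti_diag 1) = - 1" by (simp add: det_2)
  show "chi_inv (indefinite_nf p q u v) = 8 * (p ^ 3 * u - q ^ 3 * v)"
    unfolding chi_inv_eq rho3_sym rho_inv_indefinite_nf[OF c] d dm cross2_def matrix_vector_mult_def
      vec_lambda_beta sum_2 t ta rho3_indefinite_nf
    by (simp add: algebra_simps power2_eq_square power3_eq_cube)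
qed

definition boost :: "real \<Rightarrow> real^2^2" where
  "boost l = vector [vector [l, 0], vector [0, 1 / l]]"

lemma boost_nth [simp]:
  "boost l $ 1 $ 1 = l" "boost l $ 1 $ 2 = 0" "boost l $ 2 $ 1 = 0" "boost l $ 2 $ 2 = 1 / l"
  by (simp_all add: boost_def)

lemma boost_in_GL2p: "l \<noteq> 0 \<Longrightarrow> boost l \<in> GL2p"
  by (simp add: GL2p_def det_2)

lemma pull_boost:
  assumes "l \<noteq> 0"
  shows "pull (boost l) (indefinite_nf p q u v) = indefinite_nf (l * p) (q / l) (u / l ^ 3) (l ^ 3 * v)"
proof -
  have "boost l ** boost (1 / l) = mat 1" using assms by (simp add: mat2_simps)
  from pull_eq_act[OF this] show ?thesis
    using assms by (simp add: vec_eq_iff[where 'b = "2"] forall_2 sum_2 power3_eq_cube)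
qed

text \<open>Such a \<open>T\<close> either preserves or swaps the two null lines; the swap has
  negative determinant.\<close>

lemma indefinite_isotropy_boost:
  assumes T: "T \<in> GL2p" and k: "k \<noteq> 0" and "ricci \<Gamma> = anti_diag k" "ricci (pull T \<Gamma>) = anti_diag k" "\<Gamma> \<in> torsion_free"
  obtains l where "l \<noteq> 0" "T = boost l"
proof -
  let ?S = "matrix_inv T"
  have G: "T \<in> GL2" using T GL2p_subset by auto
  then have TS: "T ** ?S = mat 1" by (simp add: GL2_def matrix_inv_right)
  have "?S ** anti_diag k ** transpose ?S = anti_diag k" using assms G by (metis ricci_pull)
  then have "T ** ?S ** anti_diag k ** transpose (T ** ?S) = T ** anti_diag k ** transpose T"
    by (simp add: matrix_transpose_mul) (metis matrix_mul_assoc)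
  then have "T ** anti_diag k ** transpose T = anti_diag k" by (simp add: TS)
  moreover have "(T ** anti_diag k ** transpose T) $ i $ j = k * (T$i$1 * T$j$2 + T$i$2 * T$j$1)" for i j
    by (simp add: matrix_matrix_mult_def sum_2 transpose_def algebra_simps)
  ultimately have e: "k * (T$i$1 * T$j$2 + T$i$2 * T$j$1) = anti_diag k $ i $ j" for i j
    by metis
  have o: "T$1$1 = 0 \<or> T$1$2 = 0" "T$1$1 * T$2$2 + T$1$2 * T$2$1 = 1" "T$2$1 = 0 \<or> T$2$2 = 0"
    using k e[of 1 1] e[of 1 2] e[of 2 2] by auto
  have D: "T$1$1 * T$2$2 - T$1$2 * T$2$1 > 0" using T by (simp add: GL2p_def det_2)
  have 0: "T$1$2 = 0" "T$1$1 \<noteq> 0" "T$2$1 = 0" using o D by auto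
  then have "T = boost (T$1$1)" using o by (simp add: vec_eq_iff forall_2 field_simps)
  then show ?thesis using that 0 by blast
qed

subsection \<open>Reduction to normal form\<close>

lemma reduce_form:
  assumes "A ** M ** transpose A = ricci \<Gamma>" "A \<in> GL2p" "\<Gamma> \<in> torsion_free"
  shows "ricci (pull A \<Gamma>) = M"
proof -
  have G: "A \<in> GL2" using assms GL2p_subset by auto
  then have TS: "matrix_inv A ** A = mat 1" by (simp add: GL2_def matrix_inv_left)
  have "ricci (pull A \<Gamma>) = (matrix_inv A ** A) ** M ** transpose (matrix_inv A ** A)"
    using assms G by (simp add: ricci_pull matrix_transpose_mul matrix_mul_assoc flip: assms(1))
  then show ?thesis by (simp add: TS)
qed

text \<open>\<open>A\<close> is the lower triangular Cholesky factor of half of \<open>M\<close>.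
  The scale 2 is the one that makes |p|^2 - |u|^2 equal to 1 or -1 in the normal form.\<close>

lemma gram_schmidt_2:
  fixes M :: "real^2^2"
  assumes "M$1$1 > 0" "det M > 0" "M$2$1 = M$1$2"
  obtains A where "A \<in> GL2p" "A ** mat 2 ** transpose A = M"
proof
  define E F G where "E = M$1$1" "F = M$1$2" "G = M$2$2"
  have E: "E > 0" and D: "E * G - F * F > 0" using assms by (auto simp: E_F_G_def det_2)
  define A :: "real^2^2" where "A = vector [vector [sqrt (E / 2), 0], vector [F / sqrt (2 * E), sqrt ((E * G - F * F) / (2 * E))]]"
  have A: "A$1$1 = sqrt (E / 2)" "A$1$2 = 0" "A$2$1 = F / sqrt (2 * E)" "A$2$2 = sqrt ((E * G - F * F) / (2 * E))"
    by (simp_all add: A_def)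
  show "A \<in> GL2p" using E D by (simp add: GL2p_def det_2 A)
  have 1: "2 * (A$1$1 * A$1$1) = E" using E by (simp add: A)
  have "A$1$1 * A$2$1 = F / 2" unfolding A using E by (simp add: real_sqrt_divide real_sqrt_mult field_simps)
  then have 2: "2 * (A$1$1 * A$2$1) = F" by simp
  have "A$2$1 * A$2$1 = F * F / (2 * E)" using E by (simp add: A)
  moreover have "A$2$2 * A$2$2 = (E * G - F * F) / (2 * E)" using E D by (simp add: A)
  ultimately have "2 * (A$2$1 * A$2$1 + A$2$2 * A$2$2) = 2 * (F * F / (2 * E) + (E * G - F * F) / (2 * E))"
    by simp
  also have "\<dots> = G" using E by (simp add: field_simps)
  finally have 3: "2 * (A$2$1 * A$2$1 + A$2$2 * A$2$2) = G" .
  show "A ** mat 2 ** transpose A = M"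
    using 1 2 3 A(2) assms(3) by (simp add: mat2_simps E_F_G_def algebra_simps)
qed

text \<open>Factors the quadratic form into real linear forms, E x^2 + 2 F x y + G y^2 = 2 (a x + c
  y) (b x + d y), with the factors ordered to make the determinant positive.\<close>

lemma null_basis_2:
  fixes M :: "real^2^2"
  assumes "det M < 0" "M$2$1 = M$1$2"
  obtains A where "A \<in> GL2p" "A ** anti_diag 1 ** transpose A = M"
proof -
  note basis = that
  define E F G where "E = M$1$1" "F = M$1$2" "G = M$2$2"
  define D where "D = sqrt (F * F - E * G)"
  have FEG: "F * F - E * G > 0" using assms by (auto simp: E_F_G_def det_2)
  then have D: "D > 0" "D * D = F * F - E * G" by (simp_all add: D_def)
  have *: thesis if "2 * (a * b) = E" "a * d + b * c = F" "2 * (c * d) = G" "a * d - b * c > 0" for a b c d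
  proof (rule basis[of "vector [vector [a, b], vector [c, d]]"])
    show "vector [vector [a, b], vector [c, d]] \<in> GL2p" using that by (simp add: GL2p_def det_2)
    show "vector [vector [a, b], vector [c, d]] ** anti_diag 1 ** transpose (vector [vector [a, b], vector [c, d]]) = M"
      using that assms(2) by (simp add: mat2_simps E_F_G_def algebra_simps)
  qed
  consider "E \<noteq> 0" | "E = 0" "F > 0" | "E = 0" "F < 0" using FEG by fastforce
  then show thesis
  proof cases
    case 1
    \<comment> \<open>The factors come from the quadratic formula and give determinant
      \<open>D\<close>. The terms after \<open>of\<close> instantiate \<open>a\<close>,
      \<open>b\<close>, \<open>d\<close>, \<open>c\<close> in this order.\<close>
    have "(F - D) / E * (F + D) = G" using 1 D by (simp add: field_simps)
    with 1 D show ?thesis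
      by (intro *[of 1 "E / 2" "(F + D) / 2" "(F - D) / E"]) (auto simp: field_simps)
  next
    case 2 then show ?thesis by (intro *[of 1 0 F "G / (2 * F)"]) auto
  next
    case 3 then show ?thesis by (intro *[of 0 1 "G / (2 * F)" F]) auto
  qed
qed

section \<open>Definiteness, and the sets \<open>Z\<close> under \<open>pull\<close>\<close>

lemma quadratic_form_2: "v \<bullet> (M *v v) = M$1$1 * (v$1)\<^sup>2 + (M$1$2 + M$2$1) * (v$1 * v$2) + M$2$2 * (v$2)\<^sup>2"
  for M :: "real^2^2"
  by (simp add: inner_vec_def sum_2 matrix_vector_mult_def power2_eq_square algebra_simps)

lemma positive_definite_2:
  assumes "positive_definite M" "M$2$1 = M$1$2"
  shows "M$1$1 > 0" "det M > 0"
proof -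
  show E: "M$1$1 > 0"
    using assms(1)[unfolded positive_definite_def, rule_format, of "vector [1, 0]"]
    by (simp add: quadratic_form_2 vec_eq_iff forall_2)
  \<comment> \<open>This vector is \<open>M\<close>-orthogonal to the first basis vector, and the
    form takes the value \<open>M$1$1 * det M\<close> on it.\<close>
  have "vector [- M$1$2, M$1$1] \<noteq> (0 :: real^2)" using E by (auto simp: vec_eq_iff forall_2)
  then have "M$1$1 * det M > 0"
    using assms(1)[unfolded positive_definite_def, rule_format, of "vector [- M$1$2, M$1$1]"] assms(2)
    by (simp add: quadratic_form_2 det_2 power2_eq_square algebra_simps)
  with E show "det M > 0" by (simp add: zero_less_mult_iff)
qed

text \<open>With a positive determinant, completing the square shows that \<open>M$1$1\<close> times
  the form is a sum of squares, so the form could not take both signs.\<close>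

lemma indefinite_2:
  assumes "indefinite M" "M$2$1 = M$1$2"
  shows "det M < 0"
proof (rule ccontr)
  assume "\<not> det M < 0"
  with assms have D: "det M > 0" by (auto simp: indefinite_def)
  have sq: "M$1$1 * (v \<bullet> (M *v v)) \<ge> 0" for v
  proof -
    have "M$1$1 * (v \<bullet> (M *v v)) = (M$1$1 * v$1 + M$1$2 * v$2)\<^sup>2 + det M * (v$2)\<^sup>2"
      using assms(2) unfolding quadratic_form_2 det_2 by (simp add: power2_eq_square algebra_simps)
    with D show ?thesis by simp
  qed
  have "M$1$1 \<noteq> 0" using D assms(2) by (auto simp: det_2 mult_less_0_iff)
  obtain v w where "v \<bullet> (M *v v) > 0" "w \<bullet> (M *v w) < 0" using assms by (auto simp: indefinite_def)
  with sq[of v] sq[of w] \<open>M$1$1 \<noteq> 0\<close> show False by (auto simp: zero_le_mult_iff)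
qed

lemma negative_definite_iff_uminus: "negative_definite M \<longleftrightarrow> positive_definite (- M)"
proof -
  have "v \<bullet> ((- M) *v v) = - (v \<bullet> (M *v v))" for v by (simp add: quadratic_form_2 algebra_simps)
  then show ?thesis by (simp add: positive_definite_def negative_definite_def)
qed

lemma Z_torsion_free: "\<Gamma> \<in> Z \<epsilon> \<Longrightarrow> \<Gamma> \<in> torsion_free"
  by (cases \<epsilon>) auto

lemma Z_det_nonzero: "\<Gamma> \<in> Z \<epsilon> \<Longrightarrow> det (ricci \<Gamma>) \<noteq> 0"
proof (cases \<epsilon>)
  case Neg
  assume "\<Gamma> \<in> Z \<epsilon>"
  then have "positive_definite (- ricci \<Gamma>)" using Neg by (simp add: negative_definite_iff_uminus)
  moreover have "det (- ricci \<Gamma>) = det (ricci \<Gamma>)" by (simp add: det_2 del: ricci_nth)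
  ultimately show ?thesis using positive_definite_2(2)[of "- ricci \<Gamma>"] by simp
next
  case Pos
  assume "\<Gamma> \<in> Z \<epsilon>"
  with Pos positive_definite_2(2)[of "ricci \<Gamma>"] show ?thesis by simp
qed (auto simp: indefinite_def)

lemma Z_pull:
  assumes "T \<in> GL2" "\<Gamma> \<in> Z \<epsilon>"
  shows "pull T \<Gamma> \<in> Z \<epsilon>"
proof -
  let ?S = "matrix_inv T"
  have tf: "\<Gamma> \<in> torsion_free" using assms Z_torsion_free by auto
  have TS: "T ** ?S = mat 1" "?S ** T = mat 1" using assms by (simp_all add: GL2_def matrix_inv_right matrix_inv_left)
  have q: "v \<bullet> (ricci (pull T \<Gamma>) *v v) = (transpose ?S *v v) \<bullet> (ricci \<Gamma> *v (transpose ?S *v v))" for v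
    by (simp only: ricci_pull[OF assms(1) tf] dot_lmul_matrix[symmetric] matrix_vector_mul_assoc[symmetric]
        transpose_matrix_vector)
  have TS': "transpose T *v (transpose ?S *v v) = v" "transpose ?S *v (transpose T *v v) = v" for v
    by (simp_all only: matrix_vector_mul_assoc matrix_transpose_mul[symmetric] TS transpose_mat matrix_vector_mul_lid)
  then have nz: "transpose ?S *v v \<noteq> 0" if "v \<noteq> 0" for v
    using that by (metis matrix_vector_mult_0_right)
  show ?thesis
  proof (cases \<epsilon>)
    case Indef
    have "det (ricci (pull T \<Gamma>)) \<noteq> 0"
      using assms Z_det_nonzero by (auto simp: det_ricci_pull[OF assms(1) tf] GL2_def invertible_det_nz)
    moreover have "(\<exists>v. P (v \<bullet> (ricci (pull T \<Gamma>) *v v))) \<longleftrightarrow> (\<exists>v. P (v \<bullet> (ricci \<Gamma> *v v)))" for P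
      unfolding q by (metis TS'(2))
    from this[of "\<lambda>x. x > 0"] this[of "\<lambda>x. x < 0"] calculation show ?thesis
      using assms Indef tf by (simp add: indefinite_def)
  qed (use assms tf nz in \<open>auto simp: positive_definite_def negative_definite_def q\<close>)
qed

fun sign_of :: "ricci_sign \<Rightarrow> real" where
  "sign_of Pos = 1" | "sign_of Neg = - 1" | "sign_of Indef = 0"

lemma definite_nf_in_Z:
  assumes "\<epsilon> \<noteq> Indef" "(cmod p)\<^sup>2 - (cmod u)\<^sup>2 = sign_of \<epsilon>"
  shows "definite_nf p u \<in> Z \<epsilon>"
proof -
  have "(v$1)\<^sup>2 + (v$2)\<^sup>2 > 0" if "v \<noteq> 0" for v :: "real^2"
    using that by (auto simp: vec_eq_iff forall_2 sum_power2_gt_zero_iff)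
  then have "positive_definite (mat 2)" "negative_definite (mat (-2) :: real^2^2)"
    by (fastforce simp: positive_definite_def negative_definite_def quadratic_form_2 mat_def)+
  then show ?thesis
    using assms by (cases \<epsilon>) (auto simp: torsion_free_definite_nf ricci_definite_nf)
qed

lemma indefinite_nf_in_Z:
  assumes "p * q - u * v = 1"
  shows "indefinite_nf p q u v \<in> Z Indef"
proof -
  have "\<exists>v. v \<bullet> (anti_diag 1 *v v) > 0" "\<exists>v. v \<bullet> (anti_diag 1 *v v) < 0"
    by (rule exI[of _ "vector [1, 1]"] exI[of _ "vector [1, -1]"]; simp add: quadratic_form_2)+
  then show ?thesis
    by (simp add: torsion_free_indefinite_nf ricci_indefinite_nf assms indefinite_def det_2)
qed

lemma definite_reduction:
  assumes "\<epsilon> \<noteq> Indef" "\<Gamma> \<in> Z \<epsilon>"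
  obtains T p u where "T \<in> GL2p" "pull T \<Gamma> = definite_nf p u" "(cmod p)\<^sup>2 - (cmod u)\<^sup>2 = sign_of \<epsilon>"
proof -
  have tf: "\<Gamma> \<in> torsion_free" using assms Z_torsion_free by auto
  have e: "sign_of \<epsilon> * sign_of \<epsilon> = 1" using assms by (cases \<epsilon>) auto
  \<comment> \<open>Multiplying by the sign lets one Cholesky factorisation handle both definite
    cases.\<close>
  have "positive_definite (sign_of \<epsilon> *\<^sub>R ricci \<Gamma>)"
    using assms by (cases \<epsilon>) (auto simp: negative_definite_iff_uminus)
  from positive_definite_2[OF this] obtain A where A: "A \<in> GL2p" "A ** mat 2 ** transpose A = sign_of \<epsilon> *\<^sub>R ricci \<Gamma>"
    using gram_schmidt_2[of "sign_of \<epsilon> *\<^sub>R ricci \<Gamma>"] by auto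
  have "A ** mat (2 * sign_of \<epsilon>) ** transpose A = sign_of \<epsilon> *\<^sub>R (A ** mat 2 ** transpose A)"
    by (simp add: mat2_simps algebra_simps)
  also have "\<dots> = ricci \<Gamma>" using e by (simp add: A)
  finally have r: "ricci (pull A \<Gamma>) = mat (2 * sign_of \<epsilon>)"
    using A tf by (intro reduce_form)
  moreover have "2 * sign_of \<epsilon> \<noteq> 0" using e by auto
  ultimately obtain p u where pu: "pull A \<Gamma> = definite_nf p u"
    using tf definite_nf_exists torsion_free_pull by metis
  have "(cmod p)\<^sup>2 - (cmod u)\<^sup>2 = sign_of \<epsilon>"
    using r unfolding pu ricci_definite_nf by (simp add: vec_eq_iff forall_2 mat_def)
  with that A pu show ?thesis by blast
qed

lemma indefinite_reduction:
  assumes "\<Gamma> \<in> Z Indef"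
  obtains T p q u v where "T \<in> GL2p" "pull T \<Gamma> = indefinite_nf p q u v" "p * q - u * v = 1"
proof -
  have tf: "\<Gamma> \<in> torsion_free" using assms Z_torsion_free by auto
  obtain A where A: "A \<in> GL2p" "A ** anti_diag 1 ** transpose A = ricci \<Gamma>"
    using null_basis_2[of "ricci \<Gamma>"] indefinite_2[of "ricci \<Gamma>"] assms by auto
  then have r: "ricci (pull A \<Gamma>) = anti_diag 1"
    using tf by (intro reduce_form)
  then obtain p q u v where pu: "pull A \<Gamma> = indefinite_nf p q u v"
    using tf indefinite_nf_exists[of "pull A \<Gamma>" 1] torsion_free_pull by (metis zero_neq_one)
  have "p * q - u * v = 1"
    using r unfolding pu ricci_indefinite_nf by (simp add: vec_eq_iff forall_2)
  with that A pu show ?thesis by blast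
qed

text \<open>Openness of \<open>V\<close> is checked one point \<open>y0\<close> at a time: the open
  preimage contains \<open>s y0\<close>, hence \<open>s y\<close> for \<open>y\<close> near
  \<open>y0\<close>, and \<open>F (s y) = y\<close> then puts \<open>y\<close> into
  \<open>V\<close>. So \<open>s\<close> may depend on \<open>y0\<close> and be discontinuous
  everywhere else.\<close>

lemma quotient_map_local_sections:
  fixes F :: "'a::topological_space \<Rightarrow> 'b::topological_space"
  assumes "continuous_on A F" "F ` A = B"
    and sections: "\<And>y0. y0 \<in> B \<Longrightarrow> \<exists>s U. open U \<and> y0 \<in> U \<and> (\<forall>y\<in>B \<inter> U. s y \<in> A \<and> F (s y) = y) \<and>
       (s \<longlongrightarrow> s y0) (at y0 within B)"
  shows "quotient_map (top_of_set A) (top_of_set B) F"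
  unfolding quotient_map_def
proof (intro conjI allI impI)
  show "F ` topspace (top_of_set A) = topspace (top_of_set B)" using assms by simp
next
  fix V assume "V \<subseteq> topspace (top_of_set B)"
  then have VB: "V \<subseteq> B" by simp
  show "openin (top_of_set A) {x \<in> topspace (top_of_set A). F x \<in> V} = openin (top_of_set B) V"
  proof
    assume "openin (top_of_set A) {x \<in> topspace (top_of_set A). F x \<in> V}"
    then obtain W where W: "open W" "{x \<in> A. F x \<in> V} = A \<inter> W" by (auto simp: openin_open)
    show "openin (top_of_set B) V"
    proof (rule openin_subopen[THEN iffD2], intro ballI)
      fix y0 assume y0: "y0 \<in> V"
      then have "y0 \<in> B" using VB by blast
      from sections[OF this] obtain s U where s: "open U" "y0 \<in> U" "\<forall>y\<in>B \<inter> U. s y \<in> A \<and> F (s y) = y"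
        "(s \<longlongrightarrow> s y0) (at y0 within B)"
        by blast
      have W0: "s y0 \<in> W" using s(2,3) \<open>y0 \<in> B\<close> y0 W(2) by auto
      from topological_tendstoD[OF s(4) W(1) W0]
      obtain S where S: "open S" "y0 \<in> S" "\<And>y. y \<in> S \<Longrightarrow> y \<noteq> y0 \<Longrightarrow> y \<in> B \<Longrightarrow> s y \<in> W"
        by (auto simp: eventually_at_topological)
      have "y \<in> V" if "y \<in> B" "y \<in> S" "y \<in> U" for y
      proof -
        have "s y \<in> W" using S(3)[of y] W0 that by blast
        moreover have e: "s y \<in> A" "F (s y) = y" using s(3) that by auto
        ultimately have "s y \<in> {x \<in> A. F x \<in> V}" using W(2) by blast
        with e show ?thesis by simp
      qed
      then show "\<exists>T. openin (top_of_set B) T \<and> y0 \<in> T \<and> T \<subseteq> V"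
        using S s y0 VB by (intro exI[of _ "B \<inter> (S \<inter> U)"]) (auto simp: openin_open_Int)
    qed
  next
    assume V: "openin (top_of_set B) V"
    have "openin (top_of_set A) (A \<inter> F -` V)"
      using assms(1) _ V by (rule continuous_openin_preimage) (use assms(2) in auto)
    moreover have "{x \<in> topspace (top_of_set A). F x \<in> V} = A \<inter> F -` V" by auto
    ultimately show "openin (top_of_set A) {x \<in> topspace (top_of_set A). F x \<in> V}" by metis
  qed
qed

subsection \<open>The image of the moduli space\<close>

text \<open>In the indefinite case the real number p^3 u - q^3 v replaces the imaginary number 2 i
  Im (p^3 u), whose square is negative; hence the change of sign.\<close>

fun chi_sign :: "ricci_sign \<Rightarrow> real" where
  "chi_sign Indef = - 1" | "chi_sign Neg = 1" | "chi_sign Pos = 1"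

definition target :: "ricci_sign \<Rightarrow> (real \<times> real \<times> real) set" where
  "target \<epsilon> = {(a, b, c). (a, b) \<in> closed_band \<epsilon> \<and> c\<^sup>2 = chi_sign \<epsilon> * disc (a, b)}"

text \<open>Together with \<open>s_of\<close> this solves psi3 = 8 x - 2 and Psi3 = 8 x^2 - 4 x + 1
  - 4 s for x and s.\<close>

definition x_of :: "real \<times> real \<times> real \<Rightarrow> real" where
  "x_of y = (fst y + 2) / 8"

definition s_of :: "real \<times> real \<times> real \<Rightarrow> real" where
  "s_of y = (8 * (x_of y)\<^sup>2 - 4 * x_of y + 1 - fst (snd y)) / 4"

abbreviation c_of :: "real \<times> real \<times> real \<Rightarrow> real" where
  "c_of y \<equiv> snd (snd y)"

lemma eq_xsc: "y = (8 * x_of y - 2, 8 * (x_of y)\<^sup>2 - 4 * x_of y + 1 - 4 * s_of y, c_of y)"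
  by (simp add: x_of_def s_of_def prod_eq_iff field_simps)

lemma disc_xs: "disc (8 * x - 2, 8 * x\<^sup>2 - 4 * x + 1 - 4 * s) = 64 * (4 * x ^ 3 * (x - 1) - s\<^sup>2)"
  unfolding disc_def fst_conv snd_conv by algebra

text \<open>Where \<open>disc\<close> is nonnegative the abscissa is at least 6 or at most -2, that
  is, x is at least 1 or at most 0. Membership in the middle closed band already follows from the
  equation, since the left side is a square.\<close>

lemma target_iff:
  "y \<in> target Indef \<longleftrightarrow> (c_of y)\<^sup>2 = 64 * ((s_of y)\<^sup>2 - 4 * (x_of y) ^ 3 * (x_of y - 1))"
  "y \<in> target Pos \<longleftrightarrow> (c_of y)\<^sup>2 = 64 * (4 * (x_of y) ^ 3 * (x_of y - 1) - (s_of y)\<^sup>2) \<and> x_of y \<ge> 1"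
  "y \<in> target Neg \<longleftrightarrow> (c_of y)\<^sup>2 = 64 * (4 * (x_of y) ^ 3 * (x_of y - 1) - (s_of y)\<^sup>2) \<and> x_of y \<le> 0"
proof -
  obtain a b c where y: "y = (a, b, c)" by (cases y)
  have e: "a = 8 * x_of y - 2" "b = 8 * (x_of y)\<^sup>2 - 4 * x_of y + 1 - 4 * s_of y" "c = c_of y"
    using eq_xsc[of y] y by simp_all
  have d: "disc (a, b) = 64 * (4 * (x_of y) ^ 3 * (x_of y - 1) - (s_of y)\<^sup>2)"
    unfolding e by (rule disc_xs)
  have "y \<in> target \<epsilon> \<longleftrightarrow> (c_of y)\<^sup>2 = chi_sign \<epsilon> * disc (a, b) \<and> (a, b) \<in> closed_band \<epsilon>" for \<epsilon>
    using e(3) by (auto simp: target_def y)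
  moreover have "c\<^sup>2 = - disc (a, b) \<Longrightarrow> disc (a, b) \<le> 0" "c\<^sup>2 = disc (a, b) \<Longrightarrow> disc (a, b) \<ge> 0"
    using zero_le_power2[of c] by linarith+
  moreover have "disc (a, b) \<ge> 0 \<Longrightarrow> a > 0 \<longleftrightarrow> x_of y \<ge> 1" "disc (a, b) \<ge> 0 \<Longrightarrow> a < 0 \<longleftrightarrow> x_of y \<le> 0"
    using disc_nonneg_imp[of "(a, b)"] e(1) by auto
  ultimately show
    "y \<in> target Indef \<longleftrightarrow> (c_of y)\<^sup>2 = 64 * ((s_of y)\<^sup>2 - 4 * (x_of y) ^ 3 * (x_of y - 1))"
    "y \<in> target Pos \<longleftrightarrow> (c_of y)\<^sup>2 = 64 * (4 * (x_of y) ^ 3 * (x_of y - 1) - (s_of y)\<^sup>2) \<and> x_of y \<ge> 1"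
    "y \<in> target Neg \<longleftrightarrow> (c_of y)\<^sup>2 = 64 * (4 * (x_of y) ^ 3 * (x_of y - 1) - (s_of y)\<^sup>2) \<and> x_of y \<le> 0"
    using d e(3) by (auto simp: algebra_simps)
qed

lemma sign_of_sq: "\<epsilon> \<noteq> Indef \<Longrightarrow> sign_of \<epsilon> * sign_of \<epsilon> = 1"
  by (cases \<epsilon>) auto

text \<open>The absolute values express x \<ge> 1 and x \<le> 0 uniformly in the sign, in the form
  in which they become |p|^2 and |u|^2.\<close>

lemma target_definite_iff:
  assumes "\<epsilon> \<noteq> Indef"
  shows "y \<in> target \<epsilon> \<longleftrightarrow> (c_of y)\<^sup>2 = 64 * (4 * (x_of y) ^ 3 * (x_of y - 1) - (s_of y)\<^sup>2) \<and>
    \<bar>x_of y\<bar> = sign_of \<epsilon> * x_of y \<and> \<bar>x_of y - 1\<bar> = sign_of \<epsilon> * (x_of y - 1)"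
  using assms by (cases \<epsilon>) (auto simp: target_iff)

lemma Theta_tilde_definite_nf:
  assumes "\<epsilon> \<noteq> Indef" "(cmod p)\<^sup>2 - (cmod u)\<^sup>2 = sign_of \<epsilon>"
  defines "y \<equiv> Theta_tilde (definite_nf p u)"
  shows "x_of y = sign_of \<epsilon> * (cmod p)\<^sup>2" "s_of y = 2 * Re (p ^ 3 * u)" "c_of y = - 16 * sign_of \<epsilon> * Im (p ^ 3 * u)"
  using invariants_definite_nf[OF sign_of_sq[OF assms(1)] assms(2)]
  by (simp_all add: y_def Theta_tilde_def x_of_def s_of_def field_simps power2_eq_square)

lemma Theta_tilde_indefinite_nf:
  assumes "p * q - u * v = 1"
  defines "y \<equiv> Theta_tilde (indefinite_nf p q u v)"
  shows "x_of y = p * q" "s_of y = p ^ 3 * u + q ^ 3 * v" "c_of y = 8 * (p ^ 3 * u - q ^ 3 * v)"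
  using invariants_indefinite_nf[OF assms(1)]
  by (simp_all add: y_def Theta_tilde_def x_of_def s_of_def field_simps power2_eq_square)

lemma definite_nf_target:
  assumes "\<epsilon> \<noteq> Indef" "(cmod p)\<^sup>2 - (cmod u)\<^sup>2 = sign_of \<epsilon>"
  shows "Theta_tilde (definite_nf p u) \<in> target \<epsilon>"
proof -
  let ?e = "sign_of \<epsilon>"
  note inv = Theta_tilde_definite_nf[OF assms]
  have e: "?e * ?e = 1" by (rule sign_of_sq[OF assms(1)])
  have x1: "x_of (Theta_tilde (definite_nf p u)) - 1 = ?e * (cmod u)\<^sup>2"
    unfolding inv using e assms(2) by algebra
  define X U where "X = (cmod p)\<^sup>2" "U = (cmod u)\<^sup>2"
  have "(Re (p ^ 3 * u))\<^sup>2 + (Im (p ^ 3 * u))\<^sup>2 = X ^ 3 * U"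
    unfolding cmod_power2[symmetric] X_U_def by (simp add: norm_mult norm_power power_mult_distrib flip: power_mult)
  then have "(- 16 * ?e * Im (p ^ 3 * u))\<^sup>2 = 64 * (4 * (?e * X) ^ 3 * (?e * U) - (2 * Re (p ^ 3 * u))\<^sup>2)"
    using e by algebra
  moreover have "\<bar>?e\<bar> = 1" using e by (metis abs_1 abs_mult_self_eq abs_of_nonneg abs_ge_zero power2_eq_1_iff power2_eq_square abs_minus_cancel)
  ultimately show ?thesis
    unfolding target_definite_iff[OF assms(1)] x1 unfolding inv X_U_def
    using e by (simp add: abs_mult flip: mult.assoc)
qed

text \<open>The numbers p^3 u and q^3 v have sum s and product x^3 (x - 1), so the square of their
  difference is s^2 - 4 x^3 (x - 1).\<close>

lemma indefinite_nf_target: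
  assumes "p * q - u * v = 1"
  shows "Theta_tilde (indefinite_nf p q u v) \<in> target Indef"
proof -
  have "u * v = p * q - 1" using assms by simp
  then have "(8 * (p ^ 3 * u - q ^ 3 * v))\<^sup>2 = 64 * ((p ^ 3 * u + q ^ 3 * v)\<^sup>2 - 4 * (p * q) ^ 3 * (p * q - 1))"
    by algebra
  then show ?thesis unfolding target_iff Theta_tilde_indefinite_nf[OF assms] .
qed

lemma Theta_tilde_pull:
  assumes "T \<in> GL2p" "\<Gamma> \<in> Z \<epsilon>"
  shows "Theta_tilde (pull T \<Gamma>) = Theta_tilde \<Gamma>"
proof -
  have "T \<in> GL2" "\<Gamma> \<in> torsion_free" "det (ricci \<Gamma>) \<noteq> 0" "det T > 0"
    using assms GL2p_subset Z_torsion_free Z_det_nonzero by (auto simp: GL2p_def)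
  then show ?thesis by (simp add: Theta_tilde_def psi3_pull Psi3_pull chi_inv_pull)
qed

lemma Theta_pull:
  assumes "T \<in> GL2" "\<Gamma> \<in> Z \<epsilon>"
  shows "Theta (pull T \<Gamma>) = Theta \<Gamma>"
  using assms Z_torsion_free Z_det_nonzero by (simp add: Theta_def psi3_pull Psi3_pull)

lemma Theta_tilde_in_target:
  assumes "\<Gamma> \<in> Z \<epsilon>"
  shows "Theta_tilde \<Gamma> \<in> target \<epsilon>"
proof (cases "\<epsilon> = Indef")
  case True
  with assms obtain T p q u v where "T \<in> GL2p" "pull T \<Gamma> = indefinite_nf p q u v" "p * q - u * v = 1"
    by (metis indefinite_reduction)
  then show ?thesis using indefinite_nf_target Theta_tilde_pull assms True by metis
next
  case False
  with assms obtain T p u where "T \<in> GL2p" "pull T \<Gamma> = definite_nf p u" "(cmod p)\<^sup>2 - (cmod u)\<^sup>2 = sign_of \<epsilon>"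
    by (metis definite_reduction)
  then show ?thesis using definite_nf_target Theta_tilde_pull assms False by metis
qed

section \<open>Group laws of the action\<close>

lemma mult_in_GL2p: "S \<in> GL2p \<Longrightarrow> T \<in> GL2p \<Longrightarrow> S ** T \<in> GL2p"
  by (simp add: GL2p_def det_mul)

lemma matrix_inv_in_GL2p: "T \<in> GL2p \<Longrightarrow> matrix_inv T \<in> GL2p"
  using det_matrix_inv[of T] GL2p_subset by (auto simp: GL2p_def)

lemma mult_in_GL2: "S \<in> GL2 \<Longrightarrow> T \<in> GL2 \<Longrightarrow> S ** T \<in> GL2"
  for S T :: "real^2^2"
  by (simp add: GL2_def invertible_det_nz det_mul)

lemma matrix_inv_in_GL2: "T \<in> GL2 \<Longrightarrow> matrix_inv T \<in> GL2"
  for T :: "real^2^2"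
  using det_matrix_inv[of T] by (auto simp: GL2_def invertible_det_nz)

lemma pull_mat_1: "pull (mat 1) \<Gamma> = \<Gamma>"
  unfolding pull_eq_act[OF matrix_mul_lid[of "mat 1"]]
  by (simp add: vec_eq_iff[where 'b = "2"] forall_2 sum_2 mat_def)

lemma pull_matrix_inv:
  assumes "T \<in> GL2"
  shows "pull (matrix_inv T) (pull T \<Gamma>) = \<Gamma>"
proof -
  have "pull (matrix_inv T) (pull T \<Gamma>) = pull (T ** matrix_inv T) \<Gamma>"
    by (intro pull_pull assms matrix_inv_in_GL2)
  with assms show ?thesis by (simp add: GL2_def matrix_inv_right pull_mat_1)
qed

subsection \<open>Separation of orbits and isotropy groups\<close>

text \<open>\<open>Arg\<close> jumps along the negative axis, but the modulus is the real cube root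
  of \<open>cmod z\<close>; this makes the function continuous at 0.\<close>

definition ccbrt :: "complex \<Rightarrow> complex" where
  "ccbrt z = complex_of_real (root 3 (cmod z)) * cis (Arg z / 3)"

lemma ccbrt_cube: "ccbrt z ^ 3 = z"
proof -
  have "complex_of_real (root 3 (cmod z)) ^ 3 = complex_of_real (cmod z)"
    by (simp add: odd_real_root_pow flip: of_real_power)
  moreover have "cis (Arg z / 3) ^ 3 = cis (Arg z)" by (simp add: Complex.DeMoivre)
  ultimately show ?thesis using rcis_cmod_Arg[of z] by (simp add: ccbrt_def power_mult_distrib rcis_def)
qed

lemma cmod_ccbrt: "cmod (ccbrt z) = root 3 (cmod z)"
  by (simp add: ccbrt_def norm_mult)

lemma tendsto_ccbrt_zero:
  assumes "(f \<longlongrightarrow> 0) F"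
  shows "((\<lambda>y. ccbrt (f y)) \<longlongrightarrow> 0) F"
proof (rule tendsto_norm_zero_cancel)
  have "((\<lambda>y. root 3 (cmod (f y))) \<longlongrightarrow> root 3 (cmod 0)) F"
    by (intro tendsto_intros assms)
  then show "((\<lambda>y. cmod (ccbrt (f y))) \<longlongrightarrow> 0) F" by (simp add: cmod_ccbrt)
qed

lemma unit_cnj: "cmod l = 1 \<Longrightarrow> cnj l * l = 1"
  by (metis complex_norm_square mult.commute of_real_1 power_one)

text \<open>If \<open>p\<close> is nonzero, \<open>l\<close> must be \<open>p' / p\<close>, and
  equality of p^3 u determines what happens to \<open>u\<close>. If \<open>p = 0\<close>, then
  \<open>u\<close> is nonzero and only a cube root of \<open>u' / u\<close> has to be found; the
  conjugate appears because \<open>u\<close> has weight -3.\<close>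

lemma definite_nf_separation:
  assumes \<epsilon>: "\<epsilon> \<noteq> Indef" and pu: "(cmod p)\<^sup>2 - (cmod u)\<^sup>2 = sign_of \<epsilon>" "(cmod p')\<^sup>2 - (cmod u')\<^sup>2 = sign_of \<epsilon>"
    and eq: "Theta_tilde (definite_nf p u) = Theta_tilde (definite_nf p' u')"
  obtains l where "cmod l = 1" "pull (rot l) (definite_nf p u) = definite_nf p' u'"
proof -
  have e: "sign_of \<epsilon> \<noteq> 0" using \<epsilon> by (cases \<epsilon>) auto
  note i = Theta_tilde_definite_nf[OF \<epsilon> pu(1)] and i' = Theta_tilde_definite_nf[OF \<epsilon> pu(2)]
  have "(cmod p)\<^sup>2 = (cmod p')\<^sup>2" using i(1) i'(1) eq e by simp
  then have P: "cmod p = cmod p'" by simp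
  have "(cmod u)\<^sup>2 = (cmod u')\<^sup>2" using pu unfolding P by linarith
  then have U: "cmod u = cmod u'" by simp
  have c: "p ^ 3 * u = p' ^ 3 * u'" using i(2,3) i'(2,3) eq e by (simp add: complex_eq_iff)
  obtain l where l: "cmod l = 1" "l * p = p'" "cnj l ^ 3 * u = u'"
  proof (cases "p = 0")
    case True
    then have "u \<noteq> 0" using pu e by auto
    define m where "m = ccbrt (u' / u)"
    show ?thesis
    proof (rule that[of "cnj m"])
      have "u' \<noteq> 0" using U \<open>u \<noteq> 0\<close> by auto
      then show "cmod (cnj m) = 1" using U \<open>u \<noteq> 0\<close> by (simp add: m_def cmod_ccbrt norm_divide)
      show "cnj m * p = p'" using True P by simp
      show "cnj (cnj m) ^ 3 * u = u'" using \<open>u \<noteq> 0\<close> by (simp add: m_def ccbrt_cube)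
    qed
  next
    case False
    define l where "l = p' / p"
    have p': "p' \<noteq> 0" using P False by auto
    then have n: "cmod l = 1" using P by (simp add: l_def norm_divide)
    have lp: "l * p = p'" using False by (simp add: l_def)
    have p: "cnj l * p' = p" using unit_cnj[OF n] lp by (metis mult.assoc mult_1)
    have "p' ^ 3 * (cnj l ^ 3 * u) = (cnj l * p') ^ 3 * u" by (simp add: power_mult_distrib)
    also have "\<dots> = p' ^ 3 * u'" by (simp add: p c)
    finally have "cnj l ^ 3 * u = u'" using p' by simp
    with n lp show ?thesis by (rule that)
  qed
  then show ?thesis using that pull_rot[OF l(1)] by metis
qed

lemma real_cube_eq_1: "l ^ 3 = 1 \<longleftrightarrow> l = (1::real)"
  by (metis odd_numeral odd_real_root_power_cancel one_power2 power_one)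

text \<open>The sum s and the difference \<open>chi_inv\<close> give p^3 u and q^3 v separately. The
  factor \<open>l\<close>, possibly negative, is read off whichever of \<open>p\<close> and
  \<open>q\<close> is nonzero, and is a cube root of \<open>v' / v\<close> if both vanish; u v = p q
  - 1 supplies the missing component.\<close>

lemma indefinite_nf_separation:
  assumes pu: "p * q - u * v = 1" "p' * q' - u' * v' = 1"
    and eq: "Theta_tilde (indefinite_nf p q u v) = Theta_tilde (indefinite_nf p' q' u' v')"
  obtains l where "l \<noteq> 0" "pull (boost l) (indefinite_nf p q u v) = indefinite_nf p' q' u' v'"
proof -
  note i = Theta_tilde_indefinite_nf[OF pu(1)] and i' = Theta_tilde_indefinite_nf[OF pu(2)]
  have X: "p * q = p' * q'" using i(1) i'(1) eq by simp
  then have W: "u * v = u' * v'" using pu by simp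
  have P: "p ^ 3 * u = p' ^ 3 * u'" and Q: "q ^ 3 * v = q' ^ 3 * v'"
    using i(2,3) i'(2,3) eq by auto
  \<comment> \<open>Here u v = -1, so a vanishing p^3 u or q^3 v can only come from a vanishing
    \<open>p\<close> or \<open>q\<close>.\<close>
  have uv: "u \<noteq> 0 \<and> v \<noteq> 0 \<and> u' \<noteq> 0 \<and> v' \<noteq> 0" if "p * q = 0"
    using pu X W that by auto
  have p0: "p = 0 \<longleftrightarrow> p' = 0"
    using uv X P by (cases "p = 0"; cases "p' = 0") auto
  have q0: "q = 0 \<longleftrightarrow> q' = 0"
    using uv X Q by (cases "q = 0"; cases "q' = 0") auto
  obtain l where l: "l \<noteq> 0" "l * p = p'" "l * q' = q" "l ^ 3 * u' = u" "l ^ 3 * v = v'"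
  proof -
    consider "p \<noteq> 0" | "p = 0" "q \<noteq> 0" | "p = 0" "q = 0" by blast
    then show ?thesis
    proof cases
      case 1
      define l where "l = p' / p"
      have l: "l \<noteq> 0" "p' = l * p" using 1 p0 by (auto simp: l_def)
      have lq: "l * q' = q" using X 1 unfolding l by simp
      have lu: "l ^ 3 * u' = u" using P 1 unfolding l by (simp add: power_mult_distrib)
      have "l ^ 3 * v = v'"
      proof (cases "q' = 0")
        case True
        then have "u' \<noteq> 0" using pu by auto
        then show ?thesis using W unfolding lu[symmetric] by simp
      next
        case False
        then show ?thesis using Q unfolding lq[symmetric] by (simp add: power_mult_distrib)
      qed
      with l lq lu show ?thesis using that by simp
    next
      case 2
      define l where "l = q / q'"
      have l: "l \<noteq> 0" "q = l * q'" "q' \<noteq> 0" using 2 q0 by (auto simp: l_def)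
      have "l ^ 3 * v = v'" using Q l by (simp add: power_mult_distrib)
      moreover have "v \<noteq> 0" using pu 2 by auto
      ultimately have "l ^ 3 * u' = u" using W by auto
      with \<open>l ^ 3 * v = v'\<close> l 2 p0 show ?thesis by (intro that[of l]) auto
    next
      case 3
      then have v: "v \<noteq> 0" "v' \<noteq> 0" using pu p0 by auto
      define l where "l = root 3 (v' / v)"
      have l: "l ^ 3 * v = v'" "l \<noteq> 0" using v by (auto simp: l_def odd_real_root_pow)
      then have "l ^ 3 * u' = u" using W v by auto
      with l 3 p0 q0 show ?thesis by (intro that[of l]) auto
    qed
  qed
  have "pull (boost l) (indefinite_nf p q u v) = indefinite_nf p' q' u' v'"
    using l unfolding pull_boost[OF l(1)] indefinite_nf_inject by (auto simp: field_simps)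
  with l(1) show ?thesis by (rule that)
qed

lemma Theta_tilde_separates:
  assumes "\<Gamma> \<in> Z \<epsilon>" "\<Gamma>' \<in> Z \<epsilon>" "Theta_tilde \<Gamma> = Theta_tilde \<Gamma>'"
  obtains T where "T \<in> GL2p" "pull T \<Gamma> = \<Gamma>'"
proof -
  note witness = that
  have *: thesis if A: "A \<in> GL2p" "B \<in> GL2p" "S \<in> GL2p" "pull S (pull A \<Gamma>) = pull B \<Gamma>'" for A B S
  proof (rule witness)
    \<comment> \<open>In the right action: to the normal form by \<open>A\<close>, across by
      \<open>S\<close>, back by the inverse of \<open>B\<close>.\<close>
    show "A ** S ** matrix_inv B \<in> GL2p"
      using A by (intro mult_in_GL2p matrix_inv_in_GL2p)
    have G: "A \<in> GL2" "B \<in> GL2" "S \<in> GL2" "matrix_inv B \<in> GL2" "A ** S \<in> GL2"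
      using A GL2p_subset matrix_inv_in_GL2 mult_in_GL2 by blast+
    have "pull (A ** S ** matrix_inv B) \<Gamma> = pull (matrix_inv B) (pull B \<Gamma>')"
      using G A(4) by (simp add: flip: pull_pull)
    then show "pull (A ** S ** matrix_inv B) \<Gamma> = \<Gamma>'"
      using G by (simp add: pull_matrix_inv)
  qed
  show thesis
  proof (cases "\<epsilon> = Indef")
    case True
    obtain A p q u v where A: "A \<in> GL2p" "pull A \<Gamma> = indefinite_nf p q u v" "p * q - u * v = 1"
      using assms(1) True by (metis indefinite_reduction)
    obtain B p' q' u' v' where B: "B \<in> GL2p" "pull B \<Gamma>' = indefinite_nf p' q' u' v'" "p' * q' - u' * v' = 1"
      using assms(2) True by (metis indefinite_reduction)
    have "Theta_tilde (indefinite_nf p q u v) = Theta_tilde (indefinite_nf p' q' u' v')"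
      using A B assms Theta_tilde_pull by metis
    from indefinite_nf_separation[OF A(3) B(3) this] show thesis
      using * A B boost_in_GL2p by metis
  next
    case False
    obtain A p u where A: "A \<in> GL2p" "pull A \<Gamma> = definite_nf p u" "(cmod p)\<^sup>2 - (cmod u)\<^sup>2 = sign_of \<epsilon>"
      using assms(1) False by (metis definite_reduction)
    obtain B p' u' where B: "B \<in> GL2p" "pull B \<Gamma>' = definite_nf p' u'" "(cmod p')\<^sup>2 - (cmod u')\<^sup>2 = sign_of \<epsilon>"
      using assms(2) False by (metis definite_reduction)
    have "Theta_tilde (definite_nf p u) = Theta_tilde (definite_nf p' u')"
      using A B assms Theta_tilde_pull by metis
    from definite_nf_separation[OF False A(3) B(3) this] show thesis
      using * A B rot_in_GL2p by metis
  qed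
qed

section \<open>Orders of the isotropy groups\<close>

lemma card_isotropy_pull:
  assumes S: "S \<in> GL2p"
  shows "card (isotropy GL2p (pull S \<Gamma>)) = card (isotropy GL2p \<Gamma>)"
proof -
  let ?I = "matrix_inv S"
  have G: "S \<in> GL2" "?I \<in> GL2" using S GL2p_subset matrix_inv_in_GL2 by auto
  have I: "?I ** S = mat 1" "S ** ?I = mat 1" using G by (simp_all add: GL2_def matrix_inv_right matrix_inv_left)
  have "bij_betw (\<lambda>T. ?I ** T ** S) (isotropy GL2p \<Gamma>) (isotropy GL2p (pull S \<Gamma>))"
  proof (rule bij_betw_byWitness[where f' = "\<lambda>T. S ** T ** ?I"])
    show "\<forall>T\<in>isotropy GL2p \<Gamma>. S ** (?I ** T ** S) ** ?I = T"
      by (metis I(2) matrix_mul_assoc matrix_mul_lid matrix_mul_rid)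
    show "\<forall>T\<in>isotropy GL2p (pull S \<Gamma>). ?I ** (S ** T ** ?I) ** S = T"
      by (metis I(1) matrix_mul_assoc matrix_mul_lid matrix_mul_rid)
    show "(\<lambda>T. ?I ** T ** S) ` isotropy GL2p \<Gamma> \<subseteq> isotropy GL2p (pull S \<Gamma>)"
    proof (intro image_subsetI)
      fix T assume T: "T \<in> isotropy GL2p \<Gamma>"
      then have "T \<in> GL2p" "T \<in> GL2" "pull T \<Gamma> = \<Gamma>" using GL2p_subset by (auto simp: isotropy_def)
      moreover have "?I ** T \<in> GL2" using G calculation by (intro mult_in_GL2)
      ultimately show "?I ** T ** S \<in> isotropy GL2p (pull S \<Gamma>)"
        using G S by (simp add: isotropy_def mult_in_GL2p matrix_inv_in_GL2p pull_matrix_inv flip: pull_pull)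
    qed
    show "(\<lambda>T. S ** T ** ?I) ` isotropy GL2p (pull S \<Gamma>) \<subseteq> isotropy GL2p \<Gamma>"
    proof (intro image_subsetI)
      fix T assume T: "T \<in> isotropy GL2p (pull S \<Gamma>)"
      then have "T \<in> GL2p" "T \<in> GL2" "pull T (pull S \<Gamma>) = pull S \<Gamma>" using GL2p_subset by (auto simp: isotropy_def)
      moreover have "S ** T \<in> GL2" using G calculation by (intro mult_in_GL2)
      ultimately show "S ** T ** ?I \<in> isotropy GL2p \<Gamma>"
        using G S by (simp add: isotropy_def mult_in_GL2p matrix_inv_in_GL2p pull_matrix_inv flip: pull_pull)
    qed
  qed
  then show ?thesis by (metis bij_betw_same_card)
qed

lemma isotropy_definite_nf:
  assumes "(cmod p)\<^sup>2 - (cmod u)\<^sup>2 = e" "e \<noteq> 0"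
  shows "isotropy GL2p (definite_nf p u) = rot ` {l. cmod l = 1 \<and> l * p = p \<and> cnj l ^ 3 * u = u}"
proof (intro equalityI subsetI)
  fix T assume T: "T \<in> isotropy GL2p (definite_nf p u)"
  then have "T \<in> GL2p" "pull T (definite_nf p u) = definite_nf p u" by (auto simp: isotropy_def)
  moreover from this obtain l where "cmod l = 1" "T = rot l"
    using definite_isotropy_rot[of T "2 * e" "definite_nf p u"] assms
    by (auto simp: ricci_definite_nf torsion_free_definite_nf)
  ultimately show "T \<in> rot ` {l. cmod l = 1 \<and> l * p = p \<and> cnj l ^ 3 * u = u}"
    by (auto simp: pull_rot definite_nf_inject)
qed (auto simp: isotropy_def rot_in_GL2p pull_rot definite_nf_inject)

lemma inj_rot: "inj rot"
proof (rule injI)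
  fix l m assume "rot l = rot m"
  then have "rot l $ 1 $ 1 = rot m $ 1 $ 1" "rot l $ 1 $ 2 = rot m $ 1 $ 2" by auto
  then show "l = m" by (simp add: complex_eq_iff)
qed

text \<open>If \<open>p\<close> is nonzero, \<open>l * p = p\<close> leaves only
  \<open>l = 1\<close>. If \<open>p = 0\<close>, then \<open>u\<close> is nonzero and
  \<open>l\<close> ranges over the three cube roots of unity.\<close>

lemma card_isotropy_definite_nf:
  assumes pu: "(cmod p)\<^sup>2 - (cmod u)\<^sup>2 = e" "e \<noteq> 0"
  shows "card (isotropy GL2p (definite_nf p u)) = (if p = 0 then 3 else 1)"
proof -
  have "card (isotropy GL2p (definite_nf p u)) = card {l. cmod l = 1 \<and> l * p = p \<and> cnj l ^ 3 * u = u}"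
    unfolding isotropy_definite_nf[OF pu] by (rule card_image) (rule inj_on_subset[OF inj_rot subset_UNIV])
  also have "\<dots> = (if p = 0 then 3 else 1)"
  proof (cases "p = 0")
    case True
    with pu have "u \<noteq> 0" by auto
    moreover have "cnj l ^ 3 = 1 \<longleftrightarrow> l ^ 3 = 1" for l by (simp flip: complex_cnj_power)
    moreover have "l ^ 3 = 1 \<Longrightarrow> cmod l = 1" for l :: complex
      by (auto dest: power_eq_1_iff)
    ultimately have "{l. cmod l = 1 \<and> l * p = p \<and> cnj l ^ 3 * u = u} = {l. l ^ 3 = 1}"
      using True by auto
    then show ?thesis using True card_roots_unity_eq[of 3] by simp
  next
    case False
    then have "{l. cmod l = 1 \<and> l * p = p \<and> cnj l ^ 3 * u = u} = {1}" by auto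
    then show ?thesis using False by simp
  qed
  finally show ?thesis .
qed

text \<open>The cubic symmetry seen at \<open>p = 0\<close> in the definite case has no counterpart
  here, because 1 has only one real cube root.\<close>

lemma isotropy_indefinite_nf:
  assumes pu: "p * q - u * v = 1"
  shows "isotropy GL2p (indefinite_nf p q u v) = {mat 1}"
proof (intro equalityI subsetI)
  fix T assume T: "T \<in> isotropy GL2p (indefinite_nf p q u v)"
  then have fx: "T \<in> GL2p" "pull T (indefinite_nf p q u v) = indefinite_nf p q u v" by (auto simp: isotropy_def)
  then obtain l where l: "l \<noteq> 0" "T = boost l"
    using indefinite_isotropy_boost[of T 1 "indefinite_nf p q u v"] assms
    by (auto simp: ricci_indefinite_nf torsion_free_indefinite_nf)
  with fx have "l * p = p" "q / l = q" "l ^ 3 * v = v" by (auto simp: pull_boost indefinite_nf_inject)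
  then have "p \<noteq> 0 \<or> q \<noteq> 0 \<Longrightarrow> l = 1" "v \<noteq> 0 \<Longrightarrow> l ^ 3 = 1" using l by (auto simp: field_simps)
  moreover have "p \<noteq> 0 \<or> v \<noteq> 0" using pu by auto
  ultimately have "l = 1" by (metis real_cube_eq_1)
  then show "T \<in> {mat 1}" using l by (simp add: vec_eq_iff forall_2 mat_def)
next
  show "T \<in> isotropy GL2p (indefinite_nf p q u v)" if "T \<in> {mat 1}" for T
    using that by (simp add: isotropy_def pull_mat_1 GL2p_def)
qed

lemma card_isotropy_GL2p:
  assumes "\<Gamma> \<in> Z \<epsilon>"
  shows "card (isotropy GL2p \<Gamma>) = (if \<epsilon> = Neg \<and> Theta \<Gamma> = (-2, 1) then 3 else 1)"
proof (cases "\<epsilon> = Indef")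
  case True
  then obtain A p q u v where A: "A \<in> GL2p" "pull A \<Gamma> = indefinite_nf p q u v" "p * q - u * v = 1"
    using assms by (metis indefinite_reduction)
  show ?thesis
    using card_isotropy_pull[OF A(1), of \<Gamma>] True by (simp add: A(2) isotropy_indefinite_nf[OF A(3)])
next
  case False
  obtain A p u where A: "A \<in> GL2p" "pull A \<Gamma> = definite_nf p u" "(cmod p)\<^sup>2 - (cmod u)\<^sup>2 = sign_of \<epsilon>"
    using assms False by (metis definite_reduction)
  have e: "sign_of \<epsilon> \<noteq> 0" using False by (cases \<epsilon>) auto
  have th: "Theta_tilde \<Gamma> = Theta_tilde (definite_nf p u)" using A assms Theta_tilde_pull by metis
  \<comment> \<open>The first coordinate 8 x - 2 equals -2 exactly when x = 0, and then the second
    one is 1. For \<open>Pos\<close> this cannot occur, since |p|^2 is at least 1.\<close>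
  have "Theta \<Gamma> = (-2, 1) \<longleftrightarrow> p = 0"
  proof -
    have "Theta \<Gamma> = Theta (definite_nf p u)" using th by (simp add: Theta_def Theta_tilde_def)
    with invariants_definite_nf[OF sign_of_sq[OF False] A(3)] e show ?thesis
      by (auto simp: Theta_def)
  qed
  moreover have "p \<noteq> 0" if "\<epsilon> = Pos" using A(3) that by (auto simp: power2_eq_square) (smt (verit) zero_le_square)
  ultimately show ?thesis
    using card_isotropy_definite_nf[OF A(3) e] card_isotropy_pull[OF A(1), of \<Gamma>] A(2) False
    by (cases \<epsilon>) auto
qed

lemma isotropy_GL2p_subset: "isotropy GL2p \<Gamma> \<subseteq> isotropy GL2 \<Gamma>"
  using GL2p_subset by (auto simp: isotropy_def)

text \<open>If \<open>chi_inv\<close> vanishes, the reflected copy \<open>pull R \<Gamma>\<close>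
  has the same \<open>Theta_tilde\<close>, so some \<open>T\<close> in \<open>GL2p\<close> carries
  it back. Then \<open>R ** T\<close> reverses orientation and fixes \<Gamma>, and its coset doubles
  the group.\<close>

lemma card_isotropy_GL2:
  assumes Z: "\<Gamma> \<in> Z \<epsilon>"
  shows "card (isotropy GL2 \<Gamma>) = (if chi_inv \<Gamma> = 0 then 2 else 1) * card (isotropy GL2p \<Gamma>)"
proof (cases "chi_inv \<Gamma> = 0")
  case False
  have "isotropy GL2 \<Gamma> \<subseteq> isotropy GL2p \<Gamma>"
  proof
    fix T assume "T \<in> isotropy GL2 \<Gamma>"
    then have T: "T \<in> GL2" "pull T \<Gamma> = \<Gamma>" by (auto simp: isotropy_def)
    then have "sgn (det T) * chi_inv \<Gamma> = chi_inv \<Gamma>" using Z Z_torsion_free Z_det_nonzero chi_inv_pull by metis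
    with False T show "T \<in> isotropy GL2p \<Gamma>"
      by (auto simp: isotropy_def GL2p_def sgn_if split: if_splits)
  qed
  with isotropy_GL2p_subset False show ?thesis by (metis subset_antisym mult_1)
next
  case True
  define R :: "real^2^2" where "R = vector [vector [1, 0], vector [0, -1]]"
  have detR: "det R = -1" by (simp add: R_def det_2)
  then have R: "R \<in> GL2" by (simp add: GL2_def invertible_det_nz)
  have Z': "pull R \<Gamma> \<in> Z \<epsilon>" using R Z by (rule Z_pull)
  have "Theta_tilde (pull R \<Gamma>) = Theta_tilde \<Gamma>"
    using R Z Z_torsion_free Z_det_nonzero True
    by (simp add: Theta_tilde_def psi3_pull Psi3_pull chi_inv_pull)
  from Theta_tilde_separates[OF Z' Z this] obtain T where T: "T \<in> GL2p" "pull T (pull R \<Gamma>) = \<Gamma>" .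
  define g where "g = R ** T"
  have T2: "T \<in> GL2" using T GL2p_subset by auto
  have g: "g \<in> GL2" "det g < 0" "pull g \<Gamma> = \<Gamma>"
    using T T2 R detR by (auto simp: g_def mult_in_GL2 det_mul GL2p_def simp flip: pull_pull)
  have gi: "matrix_inv g ** g = mat 1" "g ** matrix_inv g = mat 1"
    using g by (simp_all add: GL2_def matrix_inv_right matrix_inv_left)
  let ?P = "isotropy GL2p \<Gamma>" and ?f = "\<lambda>S. S ** g"
  have "isotropy GL2 \<Gamma> = ?P \<union> ?f ` ?P"
  proof (intro equalityI subsetI)
    fix S assume "S \<in> isotropy GL2 \<Gamma>"
    then have S: "S \<in> GL2" "pull S \<Gamma> = \<Gamma>" by (auto simp: isotropy_def)
    show "S \<in> ?P \<union> ?f ` ?P"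
    proof (cases "det S > 0")
      case True then show ?thesis using S by (auto simp: isotropy_def GL2p_def)
    next
      case False
      then have dS: "det S < 0" using S by (simp add: GL2_def invertible_det_nz)
      have "pull (matrix_inv g) \<Gamma> = \<Gamma>" using g pull_matrix_inv by metis
      then have "pull (S ** matrix_inv g) \<Gamma> = \<Gamma>"
        using S g matrix_inv_in_GL2 by (simp flip: pull_pull)
      moreover have "det (S ** matrix_inv g) > 0"
        using dS g by (simp add: det_mul det_matrix_inv divide_neg_neg)
      moreover have "S = (S ** matrix_inv g) ** g"
        by (metis gi(1) matrix_mul_assoc matrix_mul_rid)
      ultimately show ?thesis by (auto simp: isotropy_def GL2p_def)
    qed
  next
    fix S assume "S \<in> ?P \<union> ?f ` ?P"
    then show "S \<in> isotropy GL2 \<Gamma>"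
      using g GL2p_subset by (auto simp: isotropy_def mult_in_GL2 subset_iff simp flip: pull_pull)
  qed
  moreover have "?P \<inter> ?f ` ?P = {}"
    using g by (auto simp: isotropy_def GL2p_def det_mul) (metis mult_pos_neg not_less_iff_gr_or_eq)
  moreover have "inj_on ?f ?P" by (rule inj_onI) (metis gi(2) matrix_mul_assoc matrix_mul_rid)
  \<comment> \<open>\<open>card\<close> is 0 on infinite sets, so a nonzero cardinality proves
    finiteness.\<close>
  moreover have "finite ?P"
    using card_isotropy_GL2p[OF Z] by (metis card.infinite zero_neq_numeral zero_neq_one)
  ultimately show ?thesis using True by (simp add: card_Un_disjoint card_image)
qed

subsection \<open>Local sections and the fold\<close>

lemma tendsto_definite_nf:
  assumes "(p \<longlongrightarrow> p0) F" "(u \<longlongrightarrow> u0) F"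
  shows "((\<lambda>y. definite_nf (p y) (u y)) \<longlongrightarrow> definite_nf p0 u0) F"
proof (intro vec_tendstoI)
  fix i j k :: 2
  show "((\<lambda>y. definite_nf (p y) (u y) $ i $ j $ k) \<longlongrightarrow> definite_nf p0 u0 $ i $ j $ k) F"
    using exhaust_2[of i] exhaust_2[of j] exhaust_2[of k]
    by (elim disjE) (auto intro!: tendsto_intros assms)
qed

lemma tendsto_indefinite_nf:
  assumes "(p \<longlongrightarrow> p0) F" "(q \<longlongrightarrow> q0) F" "(u \<longlongrightarrow> u0) F" "(v \<longlongrightarrow> v0) F"
  shows "((\<lambda>y. indefinite_nf (p y) (q y) (u y) (v y)) \<longlongrightarrow> indefinite_nf p0 q0 u0 v0) F"
proof (intro vec_tendstoI)
  fix i j k :: 2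
  show "((\<lambda>y. indefinite_nf (p y) (q y) (u y) (v y) $ i $ j $ k) \<longlongrightarrow> indefinite_nf p0 q0 u0 v0 $ i $ j $ k) F"
    using exhaust_2[of i] exhaust_2[of j] exhaust_2[of k]
    by (elim disjE) (auto intro!: tendsto_intros assms)
qed

lemma xsc_eqI:
  assumes "x_of y = x_of y'" "s_of y = s_of y'" "c_of y = c_of y'"
  shows "y = y'"
  using eq_xsc[of y] eq_xsc[of y'] assms by simp

lemma tendsto_xs:
  "(x_of \<longlongrightarrow> x_of y0) (at y0 within B)" "(s_of \<longlongrightarrow> s_of y0) (at y0 within B)"
  "(c_of \<longlongrightarrow> c_of y0) (at y0 within B)"
  unfolding x_of_def[abs_def] s_of_def[abs_def] by (auto intro!: tendsto_eq_intros)

text \<open>The value of p^3 u prescribed by \<open>y\<close>, from s = 2 Re (p^3 u) and the formula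
  for \<open>chi_inv\<close>; the sign is its own inverse.\<close>

definition P_of :: "ricci_sign \<Rightarrow> real \<times> real \<times> real \<Rightarrow> complex" where
  "P_of \<epsilon> y = Complex (s_of y / 2) (- sign_of \<epsilon> * c_of y / 16)"

lemma P_of_sq:
  assumes "\<epsilon> \<noteq> Indef" "y \<in> target \<epsilon>"
  shows "(cmod (P_of \<epsilon> y))\<^sup>2 = \<bar>x_of y\<bar> ^ 3 * \<bar>x_of y - 1\<bar>"
proof -
  have e: "sign_of \<epsilon> * sign_of \<epsilon> = 1" by (rule sign_of_sq[OF assms(1)])
  have t: "(c_of y)\<^sup>2 = 64 * (4 * (x_of y) ^ 3 * (x_of y - 1) - (s_of y)\<^sup>2)"
    "\<bar>x_of y\<bar> = sign_of \<epsilon> * x_of y" "\<bar>x_of y - 1\<bar> = sign_of \<epsilon> * (x_of y - 1)"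
    using assms target_definite_iff by auto
  have "(cmod (P_of \<epsilon> y))\<^sup>2 = (s_of y)\<^sup>2 / 4 + (sign_of \<epsilon> * sign_of \<epsilon>) * (c_of y)\<^sup>2 / 256"
    unfolding cmod_power2 P_of_def by (simp add: power2_eq_square)
  also have "\<dots> = (x_of y) ^ 3 * (x_of y - 1)"
    unfolding t(1) e by (simp add: field_simps)
  also have "\<dots> = (sign_of \<epsilon> * x_of y) ^ 3 * (sign_of \<epsilon> * (x_of y - 1))"
    using e by algebra
  finally show ?thesis unfolding t .
qed

lemma definite_section:
  assumes \<epsilon>: "\<epsilon> \<noteq> Indef" and y: "y \<in> target \<epsilon>"
    and pu: "(cmod p)\<^sup>2 = \<bar>x_of y\<bar>" "(cmod u)\<^sup>2 = \<bar>x_of y - 1\<bar>" "p ^ 3 * u = P_of \<epsilon> y"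
  shows "definite_nf p u \<in> Z \<epsilon>" "Theta_tilde (definite_nf p u) = y"
proof -
  have e: "sign_of \<epsilon> * sign_of \<epsilon> = 1" by (rule sign_of_sq[OF \<epsilon>])
  have t: "\<bar>x_of y\<bar> = sign_of \<epsilon> * x_of y" "\<bar>x_of y - 1\<bar> = sign_of \<epsilon> * (x_of y - 1)"
    using \<epsilon> y target_definite_iff by auto
  have d: "(cmod p)\<^sup>2 - (cmod u)\<^sup>2 = sign_of \<epsilon>"
    unfolding pu t by (simp add: algebra_simps)
  then show "definite_nf p u \<in> Z \<epsilon>" by (rule definite_nf_in_Z[OF \<epsilon>])
  show "Theta_tilde (definite_nf p u) = y"
  proof (rule xsc_eqI)
    show "x_of (Theta_tilde (definite_nf p u)) = x_of y"
      unfolding Theta_tilde_definite_nf[OF \<epsilon> d] pu t using e by (simp flip: mult.assoc)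
    show "s_of (Theta_tilde (definite_nf p u)) = s_of y"
      unfolding Theta_tilde_definite_nf[OF \<epsilon> d] pu by (simp add: P_of_def)
    have "c_of (Theta_tilde (definite_nf p u)) = (sign_of \<epsilon> * sign_of \<epsilon>) * c_of y"
      unfolding Theta_tilde_definite_nf[OF \<epsilon> d] pu by (simp add: P_of_def)
    then show "c_of (Theta_tilde (definite_nf p u)) = c_of y" by (simp add: e)
  qed
qed

text \<open>Near the cusp \<open>p = 0\<close> there is no continuous section; the discontinuous cube root below is
  continuous at \<open>0\<close>, which suffices for \<open>quotient_map_local_sections\<close>.\<close>

lemma definite_local_section:
  assumes \<epsilon>: "\<epsilon> \<noteq> Indef" and y0: "y0 \<in> target \<epsilon>"
  shows "\<exists>s U. open U \<and> y0 \<in> U \<and> (\<forall>y\<in>target \<epsilon> \<inter> U. s y \<in> Z \<epsilon> \<and> Theta_tilde (s y) = y) \<and>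
    (s \<longlongrightarrow> s y0) (at y0 within target \<epsilon>)"
proof -
  have oU: "open {y. x_of y \<noteq> c}" for c
    unfolding x_of_def by (intro open_Collect_neq continuous_intros) auto
  have tP: "(P_of \<epsilon> \<longlongrightarrow> P_of \<epsilon> y0) (at y0 within target \<epsilon>)"
    unfolding P_of_def[abs_def] by (intro tendsto_intros tendsto_xs) auto
  show ?thesis
  proof (cases "x_of y0 = 0")
    case False
    \<comment> \<open>Away from x = 0 a rotation can make \<open>p\<close> positive;
      \<open>u\<close> is then forced by division.\<close>
    define p where "p = (\<lambda>y. complex_of_real (sqrt \<bar>x_of y\<bar>))"
    define u where "u = (\<lambda>y. P_of \<epsilon> y / p y ^ 3)"
    have "definite_nf (p y) (u y) \<in> Z \<epsilon> \<and> Theta_tilde (definite_nf (p y) (u y)) = y"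
      if y: "y \<in> target \<epsilon>" "x_of y \<noteq> 0" for y
    proof -
      have p: "(cmod (p y))\<^sup>2 = \<bar>x_of y\<bar>" "p y \<noteq> 0" using y by (simp_all add: p_def)
      have "((cmod (p y)) ^ 3)\<^sup>2 = \<bar>x_of y\<bar> ^ 3"
        unfolding p(1)[symmetric] by (simp flip: power_mult)
      then have "(cmod (u y))\<^sup>2 = \<bar>x_of y - 1\<bar>"
        using P_of_sq[OF \<epsilon> y(1)] y(2) by (simp add: u_def norm_divide norm_power power_divide)
      moreover have "p y ^ 3 * u y = P_of \<epsilon> y" using p by (simp add: u_def)
      ultimately show ?thesis using definite_section[OF \<epsilon> y(1) p(1)] by blast
    qed
    moreover have tp: "(p \<longlongrightarrow> p y0) (at y0 within target \<epsilon>)"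
      unfolding p_def by (intro tendsto_intros tendsto_xs)
    moreover have "(u \<longlongrightarrow> u y0) (at y0 within target \<epsilon>)"
      unfolding u_def by (intro tendsto_intros tp tP) (use False in \<open>simp add: p_def\<close>)
    ultimately show ?thesis
      using False oU[of 0]
      by (intro exI[of _ "\<lambda>y. definite_nf (p y) (u y)"] exI[of _ "{y. x_of y \<noteq> 0}"])
        (auto intro!: tendsto_definite_nf)
  next
    case True
    \<comment> \<open>Near x = 0 it is \<open>u\<close> that stays nonzero and is made positive;
      \<open>p\<close> becomes a cube root.\<close>
    define u where "u = (\<lambda>y. complex_of_real (sqrt \<bar>x_of y - 1\<bar>))"
    define p where "p = (\<lambda>y. ccbrt (P_of \<epsilon> y / u y))"
    have "definite_nf (p y) (u y) \<in> Z \<epsilon> \<and> Theta_tilde (definite_nf (p y) (u y)) = y"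
      if y: "y \<in> target \<epsilon>" "x_of y \<noteq> 1" for y
    proof -
      have u: "(cmod (u y))\<^sup>2 = \<bar>x_of y - 1\<bar>" "u y \<noteq> 0" using y by (simp_all add: u_def)
      have pu: "p y ^ 3 * u y = P_of \<epsilon> y" using u by (simp add: p_def ccbrt_cube)
      then have "(cmod (p y) ^ 3 * cmod (u y))\<^sup>2 = \<bar>x_of y\<bar> ^ 3 * \<bar>x_of y - 1\<bar>"
        using P_of_sq[OF \<epsilon> y(1)] by (simp flip: norm_mult norm_power)
      then have "((cmod (p y)) ^ 3)\<^sup>2 = \<bar>x_of y\<bar> ^ 3"
        using y(2) by (simp add: power_mult_distrib u(1))
      then have "((cmod (p y))\<^sup>2) ^ 3 = \<bar>x_of y\<bar> ^ 3"
        by (simp flip: power_mult add: mult.commute)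
      then have "(cmod (p y))\<^sup>2 = \<bar>x_of y\<bar>"
        by (metis abs_ge_zero power_eq_iff_eq_base zero_le_power2 zero_less_numeral)
      then show ?thesis using definite_section[OF \<epsilon> y(1) _ u(1) pu] by blast
    qed
    moreover have tu: "(u \<longlongrightarrow> u y0) (at y0 within target \<epsilon>)"
      unfolding u_def by (intro tendsto_intros tendsto_xs)
    moreover have "(p \<longlongrightarrow> p y0) (at y0 within target \<epsilon>)"
    proof -
      have P0: "P_of \<epsilon> y0 = 0" using P_of_sq[OF \<epsilon> y0] True by simp
      then have "((\<lambda>y. P_of \<epsilon> y / u y) \<longlongrightarrow> 0 / u y0) (at y0 within target \<epsilon>)"
        using tP by (intro tendsto_intros tu) (use True in \<open>simp_all add: u_def\<close>)
      then have "(p \<longlongrightarrow> 0) (at y0 within target \<epsilon>)"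
        unfolding p_def by (intro tendsto_ccbrt_zero) simp
      moreover have "p y0 = 0" using P0 by (simp add: p_def ccbrt_def)
      ultimately show ?thesis by simp
    qed
    ultimately show ?thesis
      using True oU[of 1]
      by (intro exI[of _ "\<lambda>y. definite_nf (p y) (u y)"] exI[of _ "{y. x_of y \<noteq> 1}"])
        (auto intro!: tendsto_definite_nf)
  qed
qed

lemma indefinite_section:
  assumes y: "y \<in> target Indef"
    and pu: "p * q = x_of y" "u * v = x_of y - 1"
      "p ^ 3 * u = (s_of y + c_of y / 8) / 2" "q ^ 3 * v = (s_of y - c_of y / 8) / 2"
  shows "indefinite_nf p q u v \<in> Z Indef" "Theta_tilde (indefinite_nf p q u v) = y"
proof -
  have d: "p * q - u * v = 1" using pu by simp
  then show "indefinite_nf p q u v \<in> Z Indef" by (rule indefinite_nf_in_Z)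
  show "Theta_tilde (indefinite_nf p q u v) = y"
    by (rule xsc_eqI; unfold Theta_tilde_indefinite_nf[OF d] pu) (simp_all add: field_simps)
qed

text \<open>A boost can achieve \<open>p = 1\<close> when x is nonzero, and near x = 0 the choice
  \<open>v = 1\<close>, \<open>u = x - 1\<close> is made. Real cube roots are continuous, so the
  cusp problem does not arise.\<close>

lemma indefinite_local_section:
  assumes y0: "y0 \<in> target Indef"
  shows "\<exists>s U. open U \<and> y0 \<in> U \<and> (\<forall>y\<in>target Indef \<inter> U. s y \<in> Z Indef \<and> Theta_tilde (s y) = y) \<and>
    (s \<longlongrightarrow> s y0) (at y0 within target Indef)"
proof -
  have oU: "open {y. x_of y \<noteq> c}" for c
    unfolding x_of_def by (intro open_Collect_neq continuous_intros) auto
  \<comment> \<open>The values of p^3 u and q^3 v, recovered from their sum and difference.\<close>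
  define P Q where "P = (\<lambda>y. (s_of y + c_of y / 8) / 2)" and "Q = (\<lambda>y. (s_of y - c_of y / 8) / 2)"
  have tPQ: "(P \<longlongrightarrow> P y0) (at y0 within target Indef)" "(Q \<longlongrightarrow> Q y0) (at y0 within target Indef)"
    unfolding P_def Q_def by (intro tendsto_intros tendsto_xs; simp)+
  have PQ: "P y * Q y = (x_of y) ^ 3 * (x_of y - 1)" if "y \<in> target Indef" for y
  proof -
    have "P y * Q y = ((s_of y)\<^sup>2 - (c_of y)\<^sup>2 / 64) / 4"
      unfolding P_def Q_def by (simp add: field_simps power2_eq_square)
    with that show ?thesis unfolding target_iff by (simp add: field_simps)
  qed
  show ?thesis
  proof (cases "x_of y0 = 0")
    case False
    have "indefinite_nf 1 (x_of y) (P y) (Q y / x_of y ^ 3) \<in> Z Indef \<and>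
        Theta_tilde (indefinite_nf 1 (x_of y) (P y) (Q y / x_of y ^ 3)) = y"
      if y: "y \<in> target Indef" "x_of y \<noteq> 0" for y
      using indefinite_section[OF y(1), of 1 "x_of y" "P y" "Q y / x_of y ^ 3"] PQ[OF y(1)] y(2)
      by (simp add: P_def Q_def)
    then show ?thesis
      using False oU[of 0]
      by (intro exI[of _ "\<lambda>y. indefinite_nf 1 (x_of y) (P y) (Q y / x_of y ^ 3)"] exI[of _ "{y. x_of y \<noteq> 0}"])
        (auto intro!: tendsto_indefinite_nf tendsto_intros tendsto_xs tPQ)
  next
    case True
    let ?p = "\<lambda>y. root 3 (P y / (x_of y - 1))" and ?q = "\<lambda>y. root 3 (Q y)"
    have "indefinite_nf (?p y) (?q y) (x_of y - 1) 1 \<in> Z Indef \<and>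
        Theta_tilde (indefinite_nf (?p y) (?q y) (x_of y - 1) 1) = y"
      if y: "y \<in> target Indef" "x_of y \<noteq> 1" for y
    proof -
      have "?p y * ?q y = root 3 (x_of y ^ 3)"
        using PQ[OF y(1)] y(2) by (simp flip: real_root_mult)
      then have "?p y * ?q y = x_of y" by (simp add: odd_real_root_power_cancel)
      moreover have "?p y ^ 3 * (x_of y - 1) = P y" "?q y ^ 3 * 1 = Q y"
        using y(2) by (simp_all add: odd_real_root_pow)
      ultimately show ?thesis
        using indefinite_section[OF y(1), of "?p y" "?q y" "x_of y - 1" 1] unfolding P_def Q_def by simp
    qed
    moreover have "((\<lambda>y. indefinite_nf (?p y) (?q y) (x_of y - 1) 1) \<longlongrightarrow>
        indefinite_nf (?p y0) (?q y0) (x_of y0 - 1) 1) (at y0 within target Indef)"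
      by (intro tendsto_indefinite_nf tendsto_intros tendsto_xs tPQ) (simp add: True)
    ultimately show ?thesis
      using True oU[of 1]
      by (intro exI[of _ "\<lambda>y. indefinite_nf (?p y) (?q y) (x_of y - 1) 1"] exI[of _ "{y. x_of y \<noteq> 1}"])
        (simp del: Z.simps)
  qed
qed

lemma Theta_tilde_local_section:
  assumes "y0 \<in> target \<epsilon>"
  shows "\<exists>s U. open U \<and> y0 \<in> U \<and> (\<forall>y\<in>target \<epsilon> \<inter> U. s y \<in> Z \<epsilon> \<and> Theta_tilde (s y) = y) \<and>
    (s \<longlongrightarrow> s y0) (at y0 within target \<epsilon>)"
  using assms definite_local_section indefinite_local_section by (cases "\<epsilon> = Indef") auto

lemma Theta_tilde_image: "Theta_tilde ` Z \<epsilon> = target \<epsilon>"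
proof (intro equalityI subsetI)
  fix y assume y: "y \<in> target \<epsilon>"
  from Theta_tilde_local_section[OF y] obtain s U where
    "y \<in> U" "\<forall>y\<in>target \<epsilon> \<inter> U. s y \<in> Z \<epsilon> \<and> Theta_tilde (s y) = y" by blast
  with y have "s y \<in> Z \<epsilon>" "Theta_tilde (s y) = y" by auto
  then show "y \<in> Theta_tilde ` Z \<epsilon>" by (metis imageI)
qed (auto simp: Theta_tilde_in_target)

section \<open>Continuity of the invariants\<close>

text \<open>\<open>matrix_inv\<close> is defined by choice; the cofactor formula is what makes
  continuity of \<open>rho_inv\<close> provable.\<close>

lemma matrix_inv_2:
  fixes M :: "real^2^2"
  assumes "det M \<noteq> 0"
  shows "matrix_inv M $ 1 $ 1 = M$2$2 / det M" "matrix_inv M $ 1 $ 2 = - M$1$2 / det M"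
    "matrix_inv M $ 2 $ 1 = - M$2$1 / det M" "matrix_inv M $ 2 $ 2 = M$1$1 / det M"
proof -
  define d where "d = 1 / det M"
  have d: "(M$1$1 * M$2$2 - M$1$2 * M$2$1) * d = 1" using assms by (simp add: d_def flip: det_2)
  define B :: "real^2^2" where "B = vector [vector [M$2$2 * d, - M$1$2 * d], vector [- M$2$1 * d, M$1$1 * d]]"
  have "M ** B = mat 1"
    using d by (simp add: mat2_simps B_def algebra_simps)
  then have "matrix_inv M = B" by (rule matrix_inv_eqI)
  then show "matrix_inv M $ 1 $ 1 = M$2$2 / det M" "matrix_inv M $ 1 $ 2 = - M$1$2 / det M"
    "matrix_inv M $ 2 $ 1 = - M$2$1 / det M" "matrix_inv M $ 2 $ 2 = M$1$1 / det M"
    by (simp_all add: B_def d_def)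
qed

lemma continuous_ricci: "continuous_on S (\<lambda>\<Gamma>. ricci \<Gamma> $ i $ j)"
  using exhaust_2[of i] exhaust_2[of j] by (elim disjE) (auto intro!: continuous_intros)

lemma continuous_det_ricci: "continuous_on S (\<lambda>\<Gamma>. det (ricci \<Gamma>))"
  unfolding det_2 by (intro continuous_intros continuous_ricci)

lemma continuous_rho_inv: "continuous_on (Z \<epsilon>) (\<lambda>\<Gamma>. rho_inv \<Gamma> $ i $ j)"
proof -
  have "\<forall>\<Gamma>\<in>Z \<epsilon>. det (ricci \<Gamma>) \<noteq> 0" using Z_det_nonzero by blast
  then have q: "continuous_on (Z \<epsilon>) (\<lambda>\<Gamma>. ricci \<Gamma> $ k $ l / det (ricci \<Gamma>))"
    "continuous_on (Z \<epsilon>) (\<lambda>\<Gamma>. - (ricci \<Gamma> $ k $ l / det (ricci \<Gamma>)))" for k l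
    by (intro continuous_intros continuous_ricci continuous_det_ricci; blast)+
  show ?thesis
    unfolding rho_inv_def using exhaust_2[of i] exhaust_2[of j]
    by (elim disjE; simp only:; subst continuous_on_cong[OF refl])
      (auto simp: matrix_inv_2 Z_det_nonzero simp del: ricci_nth intro: q)
qed

lemma continuous_christoffel: "continuous_on S (\<lambda>\<Gamma> :: christoffel. \<Gamma> $ i $ j $ k)"
  by (intro continuous_intros)

lemma continuous_rho3: "continuous_on S (\<lambda>\<Gamma>. rho3 \<Gamma> $ i $ j)"
  unfolding rho3_def vec_lambda_beta
  by (intro continuous_on_sum continuous_on_mult continuous_christoffel)

lemma continuous_Theta_tilde: "continuous_on (Z \<epsilon>) Theta_tilde"
proof -
  have nz: "\<forall>\<Gamma>\<in>Z \<epsilon>. det (ricci \<Gamma>) \<noteq> 0" using Z_det_nonzero by blast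
  have "continuous_on (Z \<epsilon>) psi3"
    unfolding psi3_def[abs_def]
    by (intro continuous_on_sum continuous_on_mult continuous_rho_inv continuous_rho3)
  moreover have "continuous_on (Z \<epsilon>) Psi3"
    unfolding Psi3_def[abs_def] det_2[of "rho3 _"] using nz
    by (intro continuous_on_divide continuous_on_diff continuous_on_mult continuous_rho3 continuous_det_ricci)
  moreover have "continuous_on (Z \<epsilon>) (\<lambda>\<Gamma>. sqrt \<bar>det (ricci \<Gamma>)\<bar>)"
    by (intro continuous_on_real_sqrt continuous_on_rabs continuous_det_ricci)
  then have "continuous_on (Z \<epsilon>) chi_inv"
    unfolding chi_inv_def[abs_def] wedge_inner_def
    by (intro continuous_on_sum continuous_on_mult continuous_on_diff continuous_rho_inv continuous_rho3
        continuous_christoffel)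
  ultimately show ?thesis
    unfolding Theta_tilde_def[abs_def] by (intro continuous_on_Pair)
qed

lemma quotient_map_Theta_tilde:
  "quotient_map (top_of_set (Z \<epsilon>)) (top_of_set (target \<epsilon>)) Theta_tilde"
  by (intro quotient_map_local_sections continuous_Theta_tilde Theta_tilde_image Theta_tilde_local_section)

section \<open>Passage to the moduli spaces\<close>

lemma mat_1_in_GL2p: "mat 1 \<in> GL2p"
  by (simp add: GL2p_def)

lemma induced_orbit:
  assumes "\<And>T. T \<in> G \<Longrightarrow> f (pull T \<Gamma>) = f \<Gamma>" "mat 1 \<in> G"
  shows "induced f (orbit G \<Gamma>) = f \<Gamma>"
proof -
  have "\<Gamma> \<in> orbit G \<Gamma>" using assms(2) pull_mat_1 unfolding orbit_def by (metis imageI)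
  moreover have "f \<Delta> = f \<Gamma>" if "\<Delta> \<in> orbit G \<Gamma>" for \<Delta> using that assms(1) by (auto simp: orbit_def)
  ultimately have "f ` orbit G \<Gamma> = {f \<Gamma>}" by blast
  then show ?thesis by (simp add: induced_def)
qed

lemma induced_Theta_tilde: "\<Gamma> \<in> Z \<epsilon> \<Longrightarrow> induced Theta_tilde (orbit GL2p \<Gamma>) = Theta_tilde \<Gamma>"
  using Theta_tilde_pull mat_1_in_GL2p by (intro induced_orbit) auto

lemma induced_Theta: "\<Gamma> \<in> Z \<epsilon> \<Longrightarrow> G \<in> {GL2, GL2p} \<Longrightarrow> induced Theta (orbit G \<Gamma>) = Theta \<Gamma>"
  using Theta_pull mat_1_in_GL2p GL2p_subset by (intro induced_orbit) blast+

lemma induced_chi_inv: "\<Gamma> \<in> Z \<epsilon> \<Longrightarrow> induced chi_inv (orbit GL2p \<Gamma>) = chi_inv \<Gamma>"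
  using Theta_tilde_pull mat_1_in_GL2p
  by (intro induced_orbit) (auto simp: Theta_tilde_def)

lemma orbit_pull:
  assumes "T \<in> GL2p"
  shows "orbit GL2p (pull T \<Gamma>) = orbit GL2p \<Gamma>"
proof -
  have *: "orbit GL2p (pull T \<Gamma>) \<subseteq> orbit GL2p \<Gamma>" if "T \<in> GL2p" for T \<Gamma>
  proof -
    have "pull S (pull T \<Gamma>) = pull (T ** S) \<Gamma>" "T ** S \<in> GL2p" if "S \<in> GL2p" for S
      using \<open>T \<in> GL2p\<close> that GL2p_subset by (auto intro: pull_pull mult_in_GL2p)
    then show ?thesis unfolding orbit_def by (metis imageI image_subsetI)
  qed
  have "orbit GL2p (pull (matrix_inv T) (pull T \<Gamma>)) \<subseteq> orbit GL2p (pull T \<Gamma>)"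
    by (intro * matrix_inv_in_GL2p assms)
  moreover have "pull (matrix_inv T) (pull T \<Gamma>) = \<Gamma>"
    using assms GL2p_subset by (intro pull_matrix_inv) auto
  ultimately show ?thesis using *[OF assms] by auto
qed

lemma bij_betw_induced_Theta_tilde:
  "bij_betw (induced Theta_tilde) (moduli GL2p \<epsilon>) (target \<epsilon>)"
proof -
  have "inj_on (induced Theta_tilde) (moduli GL2p \<epsilon>)"
  proof (rule inj_onI)
    fix a b assume "a \<in> moduli GL2p \<epsilon>" "b \<in> moduli GL2p \<epsilon>"
      and eq: "induced Theta_tilde a = induced Theta_tilde b"
    then obtain \<Gamma> \<Gamma>' where G: "\<Gamma> \<in> Z \<epsilon>" "\<Gamma>' \<in> Z \<epsilon>" "a = orbit GL2p \<Gamma>" "b = orbit GL2p \<Gamma>'"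
      by (auto simp: moduli_def)
    with eq have "Theta_tilde \<Gamma> = Theta_tilde \<Gamma>'" by (simp add: induced_Theta_tilde)
    with G show "a = b" using Theta_tilde_separates orbit_pull by metis
  qed
  moreover have "induced Theta_tilde ` moduli GL2p \<epsilon> = target \<epsilon>"
    unfolding moduli_def image_image Theta_tilde_image[symmetric]
    by (intro image_cong refl induced_Theta_tilde)
  ultimately show ?thesis by (simp add: bij_betw_def)
qed

text \<open>\<open>Theta_tilde\<close> is a quotient map onto \<open>target\<close> that factors
  through the quotient map \<open>orbit GL2p\<close>, so the induced map is a quotient map as well;
  being injective, it is a homeomorphism onto \<open>target\<close>.\<close>

lemma embedding_Theta_tilde: "embedding_map (moduli_top GL2p \<epsilon>) euclidean (induced Theta_tilde)"
proof -
  have "quotient_map (top_of_set (Z \<epsilon>)) (top_of_set (target \<epsilon>)) (induced Theta_tilde \<circ> orbit GL2p)"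
    using quotient_map_Theta_tilde by (rule quotient_map_eq) (simp add: induced_Theta_tilde)
  then have "quotient_map (moduli_top GL2p \<epsilon>) (top_of_set (target \<epsilon>)) (induced Theta_tilde)"
    using quotient_map_compose_eq[OF quotient_map_orbit] by blast
  then show ?thesis
    using bij_betw_induced_Theta_tilde[of \<epsilon>]
    by (simp add: embedding_map_def homeomorphic_map_def topspace_moduli_top bij_betw_def)
qed

lemma Theta_Theta_tilde: "Theta \<Gamma> = (\<lambda>(x, y, z). (x, y)) (Theta_tilde \<Gamma>)"
  by (simp add: Theta_def Theta_tilde_def)

lemma target_fibre: "q \<in> closed_band \<epsilon> \<Longrightarrow> \<exists>c. (fst q, snd q, c) \<in> target \<epsilon>"
proof -
  assume q: "q \<in> closed_band \<epsilon>"
  then have "chi_sign \<epsilon> * disc q \<ge> 0" by (cases \<epsilon>) auto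
  with q have "(fst q, snd q, sqrt (chi_sign \<epsilon> * disc q)) \<in> target \<epsilon>"
    by (simp add: target_def)
  then show ?thesis by blast
qed

lemma Theta_image: "Theta ` Z \<epsilon> = closed_band \<epsilon>"
proof -
  have "Theta ` Z \<epsilon> = (\<lambda>(x, y, z). (x, y)) ` target \<epsilon>"
    unfolding Theta_tilde_image[symmetric] image_image by (simp add: Theta_Theta_tilde)
  also have "\<dots> = closed_band \<epsilon>"
  proof (intro equalityI subsetI)
    fix q assume "q \<in> closed_band \<epsilon>"
    then obtain c where "(fst q, snd q, c) \<in> target \<epsilon>" using target_fibre by blast
    then have "(\<lambda>(x, y, z). (x, y)) (fst q, snd q, c) \<in> (\<lambda>(x, y, z). (x, y)) ` target \<epsilon>" by (rule imageI)
    then show "q \<in> (\<lambda>(x, y, z). (x, y)) ` target \<epsilon>" by simp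
  qed (auto simp: target_def)
  finally show ?thesis .
qed

lemma image_induced_Theta: "G \<in> {GL2, GL2p} \<Longrightarrow> induced Theta ` moduli G \<epsilon> = closed_band \<epsilon>"
  unfolding moduli_def image_image Theta_image[symmetric]
  by (intro image_cong refl induced_Theta)

lemma chi_inv_sq: "\<Gamma> \<in> Z \<epsilon> \<Longrightarrow> (chi_inv \<Gamma>)\<^sup>2 = chi_sign \<epsilon> * disc (Theta \<Gamma>)"
  using Theta_tilde_in_target[of \<Gamma> \<epsilon>] by (simp add: target_def Theta_tilde_def Theta_def)

lemma chi_inv_eq_0_iff: "\<Gamma> \<in> Z \<epsilon> \<Longrightarrow> chi_inv \<Gamma> = 0 \<longleftrightarrow> Theta \<Gamma> \<in> bd \<epsilon>"
proof -
  assume Z: "\<Gamma> \<in> Z \<epsilon>"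
  have "chi_sign \<epsilon> \<noteq> 0" by (cases \<epsilon>) auto
  with chi_inv_sq[OF Z] have "chi_inv \<Gamma> = 0 \<longleftrightarrow> disc (Theta \<Gamma>) = 0" by (metis mult_eq_0_iff power_zero_numeral zero_eq_power2)
  with Z show ?thesis unfolding bd_eq using Theta_image by blast
qed

lemma card_square_roots: "card {c::real. c\<^sup>2 = d} = (if d = 0 then 1 else if d > 0 then 2 else 0)"
proof -
  have "{c::real. c\<^sup>2 = d} = (if d < 0 then {} else {sqrt d, - sqrt d})"
    by (auto simp: real_sqrt_unique)
  then show ?thesis by auto
qed

text \<open>The bijection with \<open>target\<close> turns the fibre into a vertical line, that is,
  into the real square roots of \<open>chi_sign \<epsilon> * disc q\<close>, which is nonnegative on
  the closed band.\<close>

lemma card_Theta_fibre: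
  assumes "q \<in> closed_band \<epsilon>"
  shows "card {p \<in> moduli GL2p \<epsilon>. induced Theta p = q} = (if disc q = 0 then 1 else 2)"
proof -
  let ?F = "{p \<in> moduli GL2p \<epsilon>. induced Theta p = q}"
  have pr: "induced Theta p = (\<lambda>(x, y, z). (x, y)) (induced Theta_tilde p)" if "p \<in> moduli GL2p \<epsilon>" for p
    using that by (auto simp: moduli_def induced_Theta_tilde induced_Theta Theta_Theta_tilde)
  note bij = bij_betw_induced_Theta_tilde[of \<epsilon>]
  have "card ?F = card (induced Theta_tilde ` ?F)"
    by (intro card_image[symmetric] inj_on_subset[OF bij_betw_imp_inj_on[OF bij]]) simp
  also have "induced Theta_tilde ` ?F = {y \<in> target \<epsilon>. (\<lambda>(x, y, z). (x, y)) y = q}"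
  proof (intro equalityI subsetI)
    fix y assume "y \<in> induced Theta_tilde ` ?F"
    then obtain p where "p \<in> moduli GL2p \<epsilon>" "induced Theta p = q" "y = induced Theta_tilde p" by blast
    with pr[of p] bij_betwE[OF bij] show "y \<in> {y \<in> target \<epsilon>. (\<lambda>(x, y, z). (x, y)) y = q}" by simp
  next
    fix y assume "y \<in> {y \<in> target \<epsilon>. (\<lambda>(x, y, z). (x, y)) y = q}"
    moreover from this obtain p where p: "p \<in> moduli GL2p \<epsilon>" "y = induced Theta_tilde p"
      using bij_betw_imp_surj_on[OF bij] by blast
    ultimately have "p \<in> ?F" using pr[of p] by simp
    with p show "y \<in> induced Theta_tilde ` ?F" by blast
  qed
  also have "\<dots> = (\<lambda>c. (fst q, snd q, c)) ` {c. c\<^sup>2 = chi_sign \<epsilon> * disc q}"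
    using assms by (auto simp: target_def)
  also have "card \<dots> = card {c. c\<^sup>2 = chi_sign \<epsilon> * disc q}"
    by (intro card_image inj_onI) simp
  also have "\<dots> = (if disc q = 0 then 1 else 2)"
    using assms unfolding card_square_roots by (cases \<epsilon>) auto
  finally show ?thesis .
qed

text \<open>Ensures that a value off the boundary is not the cusp, so that isotropy of order three
  is excluded there.\<close>

lemma Theta_cusp: "(-2, 1) \<in> bd Neg"
  by (simp add: bd_eq disc_def)

theorem theorem1p6:
  shows
   "(\<forall>\<Gamma>\<in>Z Pos.
       card (isotropy GL2p \<Gamma>) = 1 \<and>
       (Theta \<Gamma> \<in> bd Pos \<longrightarrow> card (isotropy GL2 \<Gamma>) = 2) \<and>
       (Theta \<Gamma> \<notin> bd Pos \<longrightarrow> card (isotropy GL2 \<Gamma>) = 1)) \<and>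
    (\<forall>\<Gamma>\<in>Z Neg.
       (Theta \<Gamma> = (-2, 1) \<longrightarrow>
          card (isotropy GL2p \<Gamma>) = 3 \<and> card (isotropy GL2 \<Gamma>) = 6) \<and>
       (Theta \<Gamma> \<in> bd Neg - {(-2, 1)} \<longrightarrow>
          card (isotropy GL2p \<Gamma>) = 1 \<and> card (isotropy GL2 \<Gamma>) = 2) \<and>
       (Theta \<Gamma> \<notin> bd Neg \<longrightarrow>
          card (isotropy GL2p \<Gamma>) = 1 \<and> card (isotropy GL2 \<Gamma>) = 1)) \<and>
    (\<forall>\<Gamma>\<in>Z Indef.
       card (isotropy GL2p \<Gamma>) = 1 \<and>
       (Theta \<Gamma> \<in> bd Indef \<longrightarrow> card (isotropy GL2 \<Gamma>) = 2) \<and>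
       (Theta \<Gamma> \<notin> bd Indef \<longrightarrow> card (isotropy GL2 \<Gamma>) = 1)) \<and>
    (\<forall>\<epsilon>.
       (\<forall>\<Gamma>\<in>Z \<epsilon>. induced Theta_tilde (orbit GL2p \<Gamma>) = Theta_tilde \<Gamma> \<and>
                induced Theta (orbit GL2p \<Gamma>) = Theta \<Gamma> \<and>
                induced Theta (orbit GL2 \<Gamma>) = Theta \<Gamma>) \<and>
       embedding_map (moduli_top GL2p \<epsilon>) euclidean (induced Theta_tilde) \<and>
       (\<forall>p\<in>moduli GL2p \<epsilon>. induced Theta p = (\<lambda>(x, y, z). (x, y)) (induced Theta_tilde p)) \<and>
       (let I = induced Theta ` moduli GL2 \<epsilon> in
          induced Theta ` moduli GL2p \<epsilon> = I \<and>
          (\<forall>q\<in>I - frontier I. card {p \<in> moduli GL2p \<epsilon>. induced Theta p = q} = 2) \<and>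
          (\<forall>q\<in>frontier I. card {p \<in> moduli GL2p \<epsilon>. induced Theta p = q} = 1) \<and>
          {p \<in> moduli GL2p \<epsilon>. induced Theta p \<in> frontier I} =
            {p \<in> moduli GL2p \<epsilon>. induced chi_inv p = 0}))"
proof -
  have iso: "card (isotropy GL2p \<Gamma>) = (if \<epsilon> = Neg \<and> Theta \<Gamma> = (-2, 1) then 3 else 1)"
    "card (isotropy GL2 \<Gamma>) = (if Theta \<Gamma> \<in> bd \<epsilon> then 2 else 1) * card (isotropy GL2p \<Gamma>)"
    if "\<Gamma> \<in> Z \<epsilon>" for \<Gamma> \<epsilon>
    using card_isotropy_GL2p[OF that] card_isotropy_GL2[OF that] chi_inv_eq_0_iff[OF that] by auto
  have fold: "let I = induced Theta ` moduli GL2 \<epsilon> in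
          induced Theta ` moduli GL2p \<epsilon> = I \<and>
          (\<forall>q\<in>I - frontier I. card {p \<in> moduli GL2p \<epsilon>. induced Theta p = q} = 2) \<and>
          (\<forall>q\<in>frontier I. card {p \<in> moduli GL2p \<epsilon>. induced Theta p = q} = 1) \<and>
          {p \<in> moduli GL2p \<epsilon>. induced Theta p \<in> frontier I} =
            {p \<in> moduli GL2p \<epsilon>. induced chi_inv p = 0}" for \<epsilon>
  proof -
    have "induced Theta p \<in> frontier (closed_band \<epsilon>) \<longleftrightarrow> induced chi_inv p = 0" if "p \<in> moduli GL2p \<epsilon>" for p
      using that by (auto simp: moduli_def induced_Theta induced_chi_inv chi_inv_eq_0_iff bd_eq frontier_closed_band)
    then have "{p \<in> moduli GL2p \<epsilon>. induced Theta p \<in> frontier (closed_band \<epsilon>)} =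
            {p \<in> moduli GL2p \<epsilon>. induced chi_inv p = 0}" by blast
    \<comment> \<open>The image is closed, so it contains its frontier and
      \<open>card_Theta_fibre\<close> applies there too; the frontier is where \<open>disc\<close>
      vanishes.\<close>
    then show ?thesis
      by (simp add: image_induced_Theta frontier_closed_band card_Theta_fibre)
  qed
  have "induced Theta p = (\<lambda>(x, y, z). (x, y)) (induced Theta_tilde p)" if "p \<in> moduli GL2p \<epsilon>" for p \<epsilon>
    using that by (auto simp: moduli_def induced_Theta_tilde induced_Theta Theta_Theta_tilde)
  then show ?thesis
    using iso[of _ Pos] iso[of _ Neg] iso[of _ Indef] Theta_cusp fold embedding_Theta_tilde
    by (simp add: induced_Theta_tilde induced_Theta)
qed

end
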